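(* Let $M$ be a loopless matroid of rank $r\ge 2$ with finite ground set of cardinality $|M|$, let $\mathcal{L}$ be the proper part of its lattice of flats, and let $\mathcal{B}$ be the proper part of the Boolean lattice on the ground set of $M$. Then $\mathcal{B}-\mathcal{L}$ is homotopy equivalent to a wedge of spheres of dimension $|M|-r-1$.
   Context: All matroids are loopless. With ground set $E$, $\mathcal{B}=2^E\setminus\{\emptyset,E\}$ ordered by inclusion, and $\mathcal{L}\subset\mathcal{B}$ is the subposet of flats $\sigma$ of $M$ with $\emptyset\subsetneq\sigma\subsetneq E$. Posets are interpreted topologically via their order complexes. $\mathcal{B}-\mathcal{L}$ is the subcomplex of the order complex of $\mathcal{B}$ induced on the vertices not in $\mathcal{L}$, i.e. the order complex of the poset of nonempty proper subsets of $E$ that are not flats. The $(-1)$-sphere is the empty space. *)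

theory Defs
  imports "HOL-Analysis.Analysis"
begin

section \<open>Matroids\<close>

locale matroid =
  fixes E :: "'a set" and indep :: "'a set \<Rightarrow> bool"
  assumes finite_ground: "finite E"
    and indep_subset_ground: "indep X \<Longrightarrow> X \<subseteq> E"
    and indep_empty: "indep {}"
    and indep_subset: "indep X \<Longrightarrow> Y \<subseteq> X \<Longrightarrow> indep Y"
    and augment: "indep X \<Longrightarrow> indep Y \<Longrightarrow> card X < card Y \<Longrightarrow> \<exists>e\<in>Y - X. indep (insert e X)"

definition loopless :: "'a set \<Rightarrow> ('a set \<Rightarrow> bool) \<Rightarrow> bool" where
  "loopless E indep \<longleftrightarrow> (\<forall>e\<in>E. indep {e})"

definition matroid_rank :: "('a set \<Rightarrow> bool) \<Rightarrow> 'a set \<Rightarrow> nat" where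
  "matroid_rank indep X = Max (card ` {I. I \<subseteq> X \<and> indep I})"

definition flat :: "'a set \<Rightarrow> ('a set \<Rightarrow> bool) \<Rightarrow> 'a set \<Rightarrow> bool" where
  "flat E indep F \<longleftrightarrow>
     F \<subseteq> E \<and> (\<forall>e\<in>E - F. matroid_rank indep F < matroid_rank indep (insert e F))"

definition proper_boolean :: "'a set \<Rightarrow> 'a set set" where
  "proper_boolean E = Pow E - {{}, E}"

definition proper_flats :: "'a set \<Rightarrow> ('a set \<Rightarrow> bool) \<Rightarrow> 'a set set" where
  "proper_flats E indep = {F \<in> proper_boolean E. flat E indep F}"


section \<open>Simplicial complexes and order complexes\<close>

text \<open>A simplicial complex is represented by the set of its nonempty simplices, each being a
  finite set of vertices.\<close>

definition order_complex :: "'v::order set \<Rightarrow> 'v set set" where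
  "order_complex P =
     {C. C \<subseteq> P \<and> C \<noteq> {} \<and> finite C \<and> (\<forall>x\<in>C. \<forall>y\<in>C. x \<le> y \<or> y \<le> x)}"

definition induced_subcomplex :: "'v set set \<Rightarrow> 'v set \<Rightarrow> 'v set set" where
  "induced_subcomplex K W = {C \<in> K. C \<subseteq> W}"

text \<open>Points are given by their barycentric coordinates. The topology of pointwise convergence
  used here is the usual one for complexes with finitely many vertices; it is not meant for
  infinite complexes.\<close>

definition geometric_realization :: "'v set set \<Rightarrow> ('v \<Rightarrow> real) topology" where
  "geometric_realization K =
     subtopology (powertop_real UNIV)
       {x. (\<forall>v. 0 \<le> x v) \<and> {v. x v \<noteq> 0} \<in> K \<and> (\<Sum>v | x v \<noteq> 0. x v) = 1}"


section \<open>Wedges of spheres\<close>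

definition quotient_topology :: "'a topology \<Rightarrow> ('a \<Rightarrow> 'b) \<Rightarrow> 'b topology" where
  "quotient_topology X f =
     topology (\<lambda>U. U \<subseteq> f ` topspace X \<and> openin X {x \<in> topspace X. f x \<in> U})"

lemma openin_quotient_topology:
  "openin (quotient_topology X f) U \<longleftrightarrow>
     U \<subseteq> f ` topspace X \<and> openin X {x \<in> topspace X. f x \<in> U}"
proof -
  have 1: "{x \<in> topspace X. f x \<in> S \<inter> T} =
      {x \<in> topspace X. f x \<in> S} \<inter> {x \<in> topspace X. f x \<in> T}" for S T
    by auto
  have 2: "{x \<in> topspace X. f x \<in> \<Union>\<K>} = (\<Union>S\<in>\<K>. {x \<in> topspace X. f x \<in> S})" for \<K>
    by auto
  have "istopology (\<lambda>U. U \<subseteq> f ` topspace X \<and> openin X {x \<in> topspace X. f x \<in> U})"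
    unfolding istopology_def 1 2 by blast
  then show ?thesis
    by (simp add: quotient_topology_def)
qed

lemma topspace_quotient_topology: "topspace (quotient_topology X f) = f ` topspace X"
proof
  show "topspace (quotient_topology X f) \<subseteq> f ` topspace X"
    unfolding topspace_def[of "quotient_topology X f"] by (auto simp: openin_quotient_topology)
  have "{x \<in> topspace X. f x \<in> f ` topspace X} = topspace X"
    by auto
  then have "openin (quotient_topology X f) (f ` topspace X)"
    by (simp add: openin_quotient_topology)
  then show "f ` topspace X \<subseteq> topspace (quotient_topology X f)"
    by (rule openin_subset)
qed

lemma quotient_map_quotient_topology: "quotient_map X (quotient_topology X f) f"
  by (auto simp: quotient_map_def topspace_quotient_topology openin_quotient_topology)

text \<open>The disjoint union of the spaces \<^term>\<open>X i\<close>, \<^term>\<open>i \<in> I\<close>, with all the base points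
  \<^term>\<open>b i\<close> identified to the single point \<^term>\<open>None\<close>. The index set is meant to be nonempty:
  for \<^term>\<open>I = {}\<close> this is the empty space rather than a point.\<close>

definition wedge_sum :: "'i set \<Rightarrow> ('i \<Rightarrow> 'b topology) \<Rightarrow> ('i \<Rightarrow> 'b) \<Rightarrow> ('i \<times> 'b) option topology" where
  "wedge_sum I X b =
     quotient_topology (sum_topology X I) (\<lambda>(i, x). if x = b i then None else Some (i, x))"

text \<open>The \<open>(-1)\<close>-sphere is the empty space.\<close>

definition sphere_space :: "int \<Rightarrow> (nat \<Rightarrow> real) topology" where
  "sphere_space d = (if d < 0 then discrete_topology {} else nsphere (nat d))"

definition sphere_base :: "nat \<Rightarrow> real" where
  "sphere_base = (\<lambda>i. if i = 0 then 1 else 0)"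

lemma sphere_base_in_sphere: "0 \<le> d \<Longrightarrow> sphere_base \<in> topspace (sphere_space d)"
  by (simp add: sphere_space_def sphere_base_def nsphere sum.atMost_shift power2_eq_square)

text \<open>In dimension \<open>-1\<close> there is no base point to identify, and the wedge is again empty.\<close>

definition wedge_of_spheres :: "nat \<Rightarrow> int \<Rightarrow> (nat \<times> (nat \<Rightarrow> real)) option topology" where
  "wedge_of_spheres k d = wedge_sum {..<k} (\<lambda>_. sphere_space d) (\<lambda>_. sphere_base)"

end

theory Submission
  imports Defs
begin

text \<open>Let \<open>N\<close> be the dual matroid. A set \<open>X\<close> is not a flat iff some element of its complement \<open>Y\<close> is a
  coloop of \<open>N\<close> restricted to \<open>Y\<close>. A point of the order complex of the non-flats is the same as a
  nonnegative function on the ground set all of whose superlevel sets have a coloop in this sense.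
  Lowering each value \<open>f e\<close> by the height up to which \<open>e\<close> fails to be a coloop deforms these functions
  onto those with \<open>N\<close>-independent support, that is, onto the independence complex of \<open>N\<close>.

  Deletion and contraction show that the independence complex becomes collapsible after removing
  suitable bases, at least one of them since \<open>N\<close> has no coloops. A complex obtained from a contractible
  one by attaching \<open>k\<close> simplices of dimension \<open>d\<close> along their whole boundaries is homotopy equivalent to
  a wedge of \<open>k\<close> spheres of dimension \<open>d\<close>: the contraction is run in a collar of each simplex.\<close>

section \<open>Polyhedra and collapses\<close>

text \<open>By the dual rank formula an element of \<open>Y\<close> is a coloop of \<open>N\<close>
  restricted to \<open>Y\<close> exactly if it lies in the closure of the complement of
  \<open>Y\<close>; this is why a non-flat shows up as a coloop of its complement. Bases of
  \<open>N\<close> have |M| - r elements, whence the dimension |M| - r - 1. Functions replace chains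
  because the passage between the two and the lowering of values are then given by minima and maxima
  of coordinates, so that continuity is immediate. Total weight is not preserved on the way and is
  restored by rescaling. For the attached simplices the obstacle is that a contraction of the
  subcomplex does not act on them. In the collar its running time decreases with the depth, reaching
  zero at the inner edge, while the core is stretched over the whole simplex. The end map sends the
  subcomplex to one point and so factors through the wedge. The composite on each sphere is not the
  identity, but it keeps the direction of all coordinates except the polar one, which suffices for a
  homotopy to the identity.\<close>

definition polyhedron :: "'v set set \<Rightarrow> ('v \<Rightarrow> real) set" where
  "polyhedron K = {x. (\<forall>v. 0 \<le> x v) \<and> {v. x v \<noteq> 0} \<in> K \<and> (\<Sum>v | x v \<noteq> 0. x v) = 1}"

lemma geometric_realization_eq: "geometric_realization K = top_of_set (polyhedron K)"
  by (simp add: geometric_realization_def polyhedron_def euclidean_product_topology)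

section \<open>Homotopies between sets of functions, given by formulas\<close>

lemma homotopic_canonI:
  fixes h :: "real \<Rightarrow> 'a::topological_space \<Rightarrow> 'b::topological_space"
  assumes "continuous_on ({0..1} \<times> S) (\<lambda>p. h (fst p) (snd p))"
    and "\<And>u x. \<lbrakk>0 \<le> u; u \<le> 1; x \<in> S\<rbrakk> \<Longrightarrow> h u x \<in> T"
    and "\<And>x. x \<in> S \<Longrightarrow> h 0 x = f x" "\<And>x. x \<in> S \<Longrightarrow> h 1 x = g x"
  shows "homotopic_with_canon (\<lambda>_. True) S T f g"
proof -
  have "continuous_map (prod_topology (top_of_set {0..1}) (top_of_set S)) (top_of_set T)
      (\<lambda>p. h (fst p) (snd p))"
    using assms(1,2) by (auto simp: continuous_map_in_subtopology)
  then show ?thesis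
    using assms(3,4) by (subst homotopic_with) auto
qed

lemma continuous_on_apply: "continuous_on S (\<lambda>x :: 'b \<Rightarrow> 'c::topological_space. x i)"
  by (rule continuous_on_product_then_coordinatewise[OF continuous_on_id])

lemma continuous_on_snd_apply:
  "continuous_on S (\<lambda>p :: 'a::topological_space \<times> ('b \<Rightarrow> 'c::topological_space). snd p i)"
  by (rule continuous_on_product_then_coordinatewise[OF continuous_on_snd[OF continuous_on_id]])

lemma homotopy_equivalent_canonI:
  fixes f :: "'a::topological_space \<Rightarrow> 'b::topological_space"
  assumes "continuous_on S f" "\<And>x. x \<in> S \<Longrightarrow> f x \<in> T"
    and "continuous_on T g" "\<And>y. y \<in> T \<Longrightarrow> g y \<in> S"
    and "homotopic_with_canon (\<lambda>_. True) S S (\<lambda>x. g (f x)) id"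
    and "homotopic_with_canon (\<lambda>_. True) T T (\<lambda>y. f (g y)) id"
  shows "top_of_set S homotopy_equivalent_space top_of_set T"
  unfolding homotopy_equivalent_space_def
proof (intro exI conjI)
  show "continuous_map (top_of_set S) (top_of_set T) f" "continuous_map (top_of_set T) (top_of_set S) g"
    using assms by (auto simp: continuous_map_in_subtopology)
qed (use assms in \<open>simp_all add: o_def\<close>)

lemma continuous_on_Max_image:
  fixes f :: "'i \<Rightarrow> 'a::topological_space \<Rightarrow> real"
  assumes "finite I" "I \<noteq> {}" "\<And>i. i \<in> I \<Longrightarrow> continuous_on S (f i)"
  shows "continuous_on S (\<lambda>x. Max ((\<lambda>i. f i x) ` I))"
  using assms
proof (induction I rule: finite_ne_induct)
  case (insert i I)
  then have "continuous_on S (\<lambda>x. max (f i x) (Max ((\<lambda>i. f i x) ` I)))"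
    by (intro continuous_on_max) auto
  with insert show ?case by simp
qed simp

lemma continuous_on_Min_image:
  fixes f :: "'i \<Rightarrow> 'a::topological_space \<Rightarrow> real"
  assumes "finite I" "I \<noteq> {}" "\<And>i. i \<in> I \<Longrightarrow> continuous_on S (f i)"
  shows "continuous_on S (\<lambda>x. Min ((\<lambda>i. f i x) ` I))"
  using assms
proof (induction I rule: finite_ne_induct)
  case (insert i I)
  then have "continuous_on S (\<lambda>x. min (f i x) (Min ((\<lambda>i. f i x) ` I)))"
    by (intro continuous_on_min) auto
  with insert show ?case by simp
qed simp

text \<open>The total is taken over a fixed finite set and not over the support, which jumps as the
  point moves; so the quotient is continuous wherever the total is nonzero.\<close>

definition normalize_on :: "'v set \<Rightarrow> ('v \<Rightarrow> real) \<Rightarrow> 'v \<Rightarrow> real" where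
  "normalize_on E f = (\<lambda>v. f v / (\<Sum>e\<in>E. f e))"

lemma sum_support:
  fixes f :: "'v \<Rightarrow> real"
  assumes "finite E" "{v. f v \<noteq> 0} \<subseteq> E"
  shows "(\<Sum>v | f v \<noteq> 0. f v) = (\<Sum>e\<in>E. f e)"
  using assms by (intro sum.mono_neutral_left) auto

lemma normalize_on_scale:
  assumes "c \<noteq> 0"
  shows "normalize_on E (\<lambda>v. c * f v) = normalize_on E f"
  using assms by (simp add: normalize_on_def sum_distrib_left[symmetric])

lemma normalize_on_support_sum_pos:
  fixes f :: "'v \<Rightarrow> real"
  assumes "finite E" "\<And>v. 0 \<le> f v" "{v. f v \<noteq> 0} \<subseteq> E" "{v. f v \<noteq> 0} \<noteq> {}"
  shows "(\<Sum>e\<in>E. f e) > 0"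
proof -
  obtain v where "f v \<noteq> 0" using assms(4) by auto
  then have "v \<in> E" "f v > 0" using assms(2)[of v] assms(3) by auto
  then show ?thesis using assms by (meson sum_pos2)
qed

lemma normalize_on_polyhedron:
  assumes "finite E" "\<And>v. 0 \<le> f v" "{v. f v \<noteq> 0} \<in> K" "{v. f v \<noteq> 0} \<subseteq> E" "{v. f v \<noteq> 0} \<noteq> {}"
  shows "normalize_on E f \<in> polyhedron K"
proof -
  have pos: "(\<Sum>e\<in>E. f e) > 0"
    using assms by (intro normalize_on_support_sum_pos) auto
  then have supp: "{v. normalize_on E f v \<noteq> 0} = {v. f v \<noteq> 0}"
    by (auto simp: normalize_on_def)
  have "(\<Sum>v | f v \<noteq> 0. normalize_on E f v) = (\<Sum>e\<in>E. f e) / (\<Sum>e\<in>E. f e)"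
    using assms sum_support[of E f] by (simp add: normalize_on_def sum_divide_distrib[symmetric])
  with pos assms show ?thesis
    unfolding polyhedron_def supp by (auto simp: normalize_on_def)
qed

lemma normalize_on_id:
  assumes "finite E" "x \<in> polyhedron K" "{v. x v \<noteq> 0} \<subseteq> E"
  shows "normalize_on E x = x"
  using assms sum_support[of E x] by (auto simp: polyhedron_def normalize_on_def)

lemma continuous_on_normalize:
  assumes "\<And>e. continuous_on S (\<lambda>x. f x e)" "\<And>x. x \<in> S \<Longrightarrow> (\<Sum>e\<in>E. f x e) \<noteq> 0"
  shows "continuous_on S (\<lambda>x. normalize_on E (f x))"
  unfolding normalize_on_def
  by (intro continuous_on_coordinatewise_then_product continuous_intros assms) (use assms in auto)

text \<open>The end map \<open>f\<close> lands in a contractible set and is therefore null-homotopic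
  in \<open>S\<close>; the identity is homotopic to \<open>f\<close>. No condition on
  \<open>f\<close> restricted to \<open>T\<close> enters.\<close>

lemma contractible_if_deforms:
  fixes S :: "'a::topological_space set"
  assumes "homotopic_with_canon (\<lambda>_. True) S S id f" "\<And>x. x \<in> S \<Longrightarrow> f x \<in> T" "T \<subseteq> S" "contractible T"
  shows "contractible S"
proof -
  have "continuous_on S f"
    using homotopic_with_imp_continuous[OF assms(1)] by simp
  then obtain c where "homotopic_with_canon (\<lambda>_. True) S S (id \<circ> f) (\<lambda>x. c)"
    using assms by (elim nullhomotopic_through_contractible[of S f T id S]) auto
  then have "homotopic_with_canon (\<lambda>_. True) S S id (\<lambda>x. c)"
    using assms(1) by (metis homotopic_with_trans id_comp)
  then show ?thesis by (auto simp: contractible_def)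
qed

text \<open>The rule \<open>expand\<close> is an elementary collapse read backwards: among the faces
  of \<open>insert v \<sigma>\<close> only \<sigma> and the simplex itself are new, so \<sigma> is a
  free face. Building up from a point suits the attachment of cones in the induction over deletion
  and contraction.\<close>

inductive collapsible :: "'v set set \<Rightarrow> bool" where
  point: "collapsible {{v}}"
| expand: "collapsible K \<Longrightarrow> finite \<sigma> \<Longrightarrow> \<sigma> \<noteq> {} \<Longrightarrow> v \<notin> \<sigma> \<Longrightarrow> \<sigma> \<notin> K \<Longrightarrow> insert v \<sigma> \<notin> K \<Longrightarrow>
    (\<And>\<rho>. \<rho> \<subseteq> insert v \<sigma> \<Longrightarrow> \<rho> \<noteq> {} \<Longrightarrow> \<rho> \<noteq> \<sigma> \<Longrightarrow> \<rho> \<noteq> insert v \<sigma> \<Longrightarrow> \<rho> \<in> K) \<Longrightarrow>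
    collapsible (K \<union> {\<sigma>, insert v \<sigma>})"

lemma collapsible_finite: "collapsible K \<Longrightarrow> finite K \<and> (\<forall>\<rho>\<in>K. finite \<rho> \<and> \<rho> \<noteq> {})"
  by (induction rule: collapsible.induct) auto

lemma collapsible_down_closed:
  "collapsible K \<Longrightarrow> \<rho> \<in> K \<Longrightarrow> \<tau> \<subseteq> \<rho> \<Longrightarrow> \<tau> \<noteq> {} \<Longrightarrow> \<tau> \<in> K"
proof (induction arbitrary: \<rho> \<tau> rule: collapsible.induct)
  case (point v)
  then show ?case by auto
next
  case (expand K \<sigma> v)
  show ?case
  proof (cases "\<rho> \<in> K")
    case True
    then show ?thesis using expand.IH expand.prems by blast
  next
    case False
    then have "\<tau> \<subseteq> insert v \<sigma>" using expand.prems by auto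
    then show ?thesis using expand.hyps(7) expand.prems by blast
  qed
qed

text \<open>The new simplex is pushed away from its free face: the least coordinate on \<sigma> is
  gradually subtracted from all vertices of \<sigma> and added once to \<open>v\<close>. At the end
  some vertex of \<sigma> has dropped out, so the support lies in \<open>K\<close>. The total
  changes on the way, hence the normalisation.\<close>

lemma contractible_polyhedron_expand:
  assumes fin: "finite E" "\<Union>K \<subseteq> E" "insert v \<sigma> \<subseteq> E" "\<sigma> \<noteq> {}" "v \<notin> \<sigma>"
    and ne: "{} \<notin> K" and free: "\<And>\<rho>. \<rho> \<in> K \<Longrightarrow> \<not> \<sigma> \<subseteq> \<rho>"
    and faces: "\<And>\<rho>. \<rho> \<subseteq> insert v \<sigma> \<Longrightarrow> \<rho> \<noteq> {} \<Longrightarrow> \<rho> \<noteq> \<sigma> \<Longrightarrow> \<rho> \<noteq> insert v \<sigma> \<Longrightarrow> \<rho> \<in> K"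
    and K: "contractible (polyhedron K)"
  shows "contractible (polyhedron (K \<union> {\<sigma>, insert v \<sigma>}))"
proof -
  let ?K = "K \<union> {\<sigma>, insert v \<sigma>}"
  have fs: "finite \<sigma>" using fin finite_subset by auto
  define m where "m x = Min ((\<lambda>w. x w) ` \<sigma>)" for x :: "_ \<Rightarrow> real"
  define h where "h u x w = (if w \<in> \<sigma> then x w - u * m x else if w = v then x w + u * m x else x w)"
    for u and x :: "_ \<Rightarrow> real" and w
  have m_le: "m x \<le> x w" if "w \<in> \<sigma>" for x w
    using that fs by (auto simp: m_def)
  have m_ex: "\<exists>w\<in>\<sigma>. x w = m x" for x
  proof -
    have "m x \<in> (\<lambda>w. x w) ` \<sigma>" unfolding m_def using fs fin by (intro Min_in) auto
    then show ?thesis by auto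
  qed
  have m0: "m x = 0" if "x \<in> polyhedron K" for x
  proof -
    have "\<forall>v. 0 \<le> x v" "\<not> \<sigma> \<subseteq> {v. x v \<noteq> 0}" using that free by (auto simp: polyhedron_def)
    then obtain w where "w \<in> \<sigma>" "x w = 0" by auto
    then have "m x \<le> 0" using m_le[of w x] by simp
    moreover obtain w' where "x w' = m x" using m_ex by blast
    ultimately show ?thesis using \<open>\<forall>v. 0 \<le> x v\<close> by (metis order_antisym)
  qed
  have m_pos: "0 \<le> m x" if "x \<in> polyhedron ?K" for x
  proof -
    obtain w where "x w = m x" using m_ex by blast
    moreover have "0 \<le> x w" using that by (auto simp: polyhedron_def)
    ultimately show ?thesis by simp
  qed
  have h_nonneg: "0 \<le> h u x w" if "x \<in> polyhedron ?K" "0 \<le> u" "u \<le> 1" for u x w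
  proof -
    have "u * m x \<le> m x" "0 \<le> u * m x" "0 \<le> x w"
      using m_pos[of x] that by (auto simp: mult_left_le_one_le polyhedron_def)
    then show ?thesis using m_le[of w x] by (auto simp: h_def)
  qed
  have triv: "h u x = x" if "m x = 0" for u x
    using that by (auto simp: h_def fun_eq_iff)
  have supp: "{w. h u x w \<noteq> 0} \<in> ?K \<and> (u = 1 \<longrightarrow> {w. h u x w \<noteq> 0} \<in> K)"
    if x: "x \<in> polyhedron ?K" and u: "0 \<le> u" "u \<le> 1" for u x
  proof (cases "m x = 0")
    case True
    have "\<not> \<sigma> \<subseteq> {v. x v \<noteq> 0}" using True m_ex[of x] by auto
    then have "{v. x v \<noteq> 0} \<in> K" using x by (auto simp: polyhedron_def)
    then show ?thesis using triv[OF True] by simp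
  next
    case False
    then have m: "m x > 0" using m_pos[OF x] by auto
    then have "x w > 0" if "w \<in> \<sigma>" for w using m_le[OF that, of x] by auto
    then have "\<sigma> \<subseteq> {v. x v \<noteq> 0}" by force
    then have sx: "{v. x v \<noteq> 0} \<in> {\<sigma>, insert v \<sigma>}" using x free by (auto simp: polyhedron_def)
    have xv: "0 \<le> x v" using x by (auto simp: polyhedron_def)
    have sub: "{w. h u x w \<noteq> 0} \<subseteq> insert v \<sigma>" using sx by (auto simp: h_def)
    show ?thesis
    proof (cases "u = 1")
      case True
      obtain w where w: "w \<in> \<sigma>" "x w = m x" using m_ex by blast
      then have "h u x w = 0" using True by (simp add: h_def)
      \<comment> \<open>The positive weight at \<open>v\<close> excludes both the empty set and
        \<sigma> as supports; the vertex \<open>w\<close> excludes the full simplex.\<close>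
      moreover have "h u x v > 0" using True m xv fin by (simp add: h_def)
      ultimately have "{w. h u x w \<noteq> 0} \<in> K"
      proof (intro faces[OF sub])
        have "v \<in> {w. h u x w \<noteq> 0}" using \<open>h u x v > 0\<close> by simp
        then show "{w. h u x w \<noteq> 0} \<noteq> {}" "{w. h u x w \<noteq> 0} \<noteq> \<sigma>" using fin(5) by blast+
        have "w \<notin> {w. h u x w \<noteq> 0}" using \<open>h u x w = 0\<close> by simp
        then show "{w. h u x w \<noteq> 0} \<noteq> insert v \<sigma>" using w by blast
      qed
      then show ?thesis by blast
    next
      case False
      then have "u * m x < m x" using u m by auto
      then have "h u x w > 0" if "w \<in> \<sigma>" for w
        using m_le[OF that, of x] that by (simp add: h_def)
      then have "\<sigma> \<subseteq> {w. h u x w \<noteq> 0}" by force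
      with sub have "{w. h u x w \<noteq> 0} \<in> {\<sigma>, insert v \<sigma>}" by auto
      then show ?thesis using False by auto
    qed
  qed
  have ne': "{w. h u x w \<noteq> 0} \<noteq> {}" and E': "{w. h u x w \<noteq> 0} \<subseteq> E"
    if "x \<in> polyhedron ?K" "0 \<le> u" "u \<le> 1" for u x
    using supp[OF that] ne fin by auto
  have cm: "continuous_on S (\<lambda>p :: real \<times> ('a \<Rightarrow> real). m (snd p))" for S
    unfolding m_def using fs fin by (intro continuous_on_Min_image continuous_on_snd_apply) auto
  have "homotopic_with_canon (\<lambda>_. True) (polyhedron ?K) (polyhedron ?K) id (\<lambda>x. normalize_on E (h 1 x))"
  proof (rule homotopic_canonI[where h = "\<lambda>u x. normalize_on E (h u x)"])
    show "continuous_on ({0..1} \<times> polyhedron ?K) (\<lambda>p. normalize_on E (h (fst p) (snd p)))"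
    proof (rule continuous_on_normalize)
      fix e
      show "continuous_on ({0..1} \<times> polyhedron ?K) (\<lambda>p. h (fst p) (snd p) e)"
        unfolding h_def
        by (cases "e \<in> \<sigma>"; cases "e = v")
          (simp_all add: continuous_on_snd_apply continuous_on_add continuous_on_diff continuous_on_mult
             continuous_on_fst continuous_on_id cm)
    next
      fix p :: "real \<times> ('a \<Rightarrow> real)" assume "p \<in> {0..1} \<times> polyhedron ?K"
      then show "(\<Sum>e\<in>E. h (fst p) (snd p) e) \<noteq> 0"
        using normalize_on_support_sum_pos[OF fin(1) h_nonneg E' ne', of "snd p" "fst p"]
        by (auto simp: mem_Times_iff)
    qed
    show "normalize_on E (h u x) \<in> polyhedron ?K" if "0 \<le> u" "u \<le> 1" "x \<in> polyhedron ?K" for u x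
      using normalize_on_polyhedron[OF fin(1) h_nonneg _ E' ne', of x u ?K] supp[of x u] that by auto
    show "normalize_on E (h 0 x) = id x" if "x \<in> polyhedron ?K" for x
    proof -
      have "h 0 x = x" by (simp add: h_def fun_eq_iff)
      then show ?thesis using that E'[OF that, of 0] fin normalize_on_id[of E x ?K] by auto
    qed
  qed simp
  moreover have "normalize_on E (h 1 x) \<in> polyhedron K" if "x \<in> polyhedron ?K" for x
    using that supp[OF that, of 1] ne'[OF that, of 1] E'[OF that, of 1] h_nonneg[OF that, of 1] fin
    by (intro normalize_on_polyhedron) auto
  moreover have "polyhedron K \<subseteq> polyhedron ?K" by (auto simp: polyhedron_def)
  ultimately show ?thesis using K by (rule contractible_if_deforms)
qed

lemma contractible_collapsible: "collapsible K \<Longrightarrow> contractible (polyhedron K)"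
proof (induction rule: collapsible.induct)
  case (point v)
  have "x = (\<lambda>w. if w = v then 1 else 0)" if "x \<in> polyhedron {{v}}" for x
  proof -
    from that have s: "{w. x w \<noteq> 0} = {v}" "(\<Sum>w | x w \<noteq> 0. x w) = 1" by (auto simp: polyhedron_def)
    from s(2) have "x v = 1" unfolding s(1) by simp
    with s(1) show ?thesis by (auto simp: fun_eq_iff)
  qed
  moreover have "(\<lambda>w. if w = v then 1 else 0) \<in> polyhedron {{v}}"
    by (auto simp: polyhedron_def)
  ultimately have "polyhedron {{v}} = {\<lambda>w. if w = v then 1 else 0}" by blast
  then have "contractible_space (subtopology euclidean (polyhedron {{v}}))"
    by (simp only: contractible_space_subtopology_singleton)
  then show ?case by simp
next
  case (expand K \<sigma> v)
  let ?E = "\<Union>K \<union> insert v \<sigma>"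
  note K = collapsible_finite[OF expand.hyps(1)]
  show ?case
  proof (rule contractible_polyhedron_expand[of ?E])
    show "\<not> \<sigma> \<subseteq> \<rho>" if "\<rho> \<in> K" for \<rho>
      using collapsible_down_closed[OF expand.hyps(1) that] expand.hyps by blast
  qed (use expand K in auto)
qed

text \<open>A maximal simplex \<sigma> of the base is a free face of
  \<open>insert e \<sigma>\<close> in the cone, so this pair can be added last, to the cone over the
  remaining simplices. The base may be any finite complex; the empty base leaves the apex
  alone.\<close>

lemma collapsible_cone:
  assumes "finite L" "\<And>\<rho>. \<rho> \<in> L \<Longrightarrow> finite \<rho> \<and> \<rho> \<noteq> {} \<and> e \<notin> \<rho>"
    and "\<And>\<rho> \<tau>. \<rho> \<in> L \<Longrightarrow> \<tau> \<subseteq> \<rho> \<Longrightarrow> \<tau> \<noteq> {} \<Longrightarrow> \<tau> \<in> L"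
  shows "collapsible (L \<union> insert e ` (insert {} L))"
  using assms
proof (induction "card L" arbitrary: L)
  case 0
  then show ?case using collapsible.point by auto
next
  case (Suc n)
  then have "L \<noteq> {}" by auto
  with Suc.prems(1) obtain \<sigma> where \<sigma>: "\<sigma> \<in> L" "\<And>\<rho>. \<rho> \<in> L \<Longrightarrow> \<not> \<sigma> \<subset> \<rho>"
    using finite_has_maximal[of L] by (auto simp: psubset_eq)
  let ?L = "L - {\<sigma>}"
  have IH: "collapsible (?L \<union> insert e ` (insert {} ?L))"
  proof (rule Suc.hyps)
    show "n = card ?L" using Suc \<sigma> by simp
    show "\<tau> \<in> ?L" if "\<rho> \<in> ?L" "\<tau> \<subseteq> \<rho>" "\<tau> \<noteq> {}" for \<rho> \<tau>
      using that Suc.prems \<sigma> by blast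
  qed (use Suc.prems in auto)
  have "collapsible ((?L \<union> insert e ` (insert {} ?L)) \<union> {\<sigma>, insert e \<sigma>})"
  proof (rule collapsible.expand[OF IH])
    show "finite \<sigma>" "\<sigma> \<noteq> {}" "e \<notin> \<sigma>" using \<sigma> Suc.prems by auto
    show "\<sigma> \<notin> ?L \<union> insert e ` insert {} ?L" using \<open>e \<notin> \<sigma>\<close> by auto
    show "insert e \<sigma> \<notin> ?L \<union> insert e ` insert {} ?L"
    proof -
      have "insert e \<sigma> \<noteq> insert e \<rho>" if "\<rho> \<in> insert {} ?L" for \<rho>
        using that \<open>e \<notin> \<sigma>\<close> \<open>\<sigma> \<noteq> {}\<close> Suc.prems(2) insert_ident[of e \<sigma> \<rho>] by blast
      then show ?thesis using Suc.prems(2) by blast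
    qed
    show "\<rho> \<in> ?L \<union> insert e ` insert {} ?L"
      if "\<rho> \<subseteq> insert e \<sigma>" "\<rho> \<noteq> {}" "\<rho> \<noteq> \<sigma>" "\<rho> \<noteq> insert e \<sigma>" for \<rho>
    proof (cases "e \<in> \<rho>")
      case False
      then show ?thesis using that Suc.prems(3)[OF \<sigma>(1), of \<rho>] by auto
    next
      case True
      then obtain \<tau> where \<tau>: "\<rho> = insert e \<tau>" "e \<notin> \<tau>" by (meson mk_disjoint_insert)
      then have "\<tau> \<subseteq> \<sigma>" "\<tau> \<noteq> \<sigma>" using that by auto
      then have "\<tau> \<in> insert {} ?L" using Suc.prems(3)[OF \<sigma>(1), of \<tau>] by auto
      then show ?thesis using \<tau> by blast
    qed
  qed
  moreover have "(?L \<union> insert e ` (insert {} ?L)) \<union> {\<sigma>, insert e \<sigma>} = L \<union> insert e ` (insert {} L)"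
    using \<sigma> by auto
  ultimately show ?case by simp
qed

text \<open>An expansion of \<open>L\<close> by \<sigma> and \<open>insert v \<sigma>\<close>
  becomes an expansion of the union by the joins of both with \<open>e\<close>; the simplices of
  \<open>L\<close> themselves are already present in \<open>A\<close>. In the application
  \<open>A\<close> comes from the deletion of \<open>e\<close> and \<open>L\<close> from its
  link.\<close>

lemma collapsible_attach_cone:
  assumes "collapsible L" "collapsible A" "L \<subseteq> A" "e \<notin> \<Union>A"
  shows "collapsible (A \<union> insert e ` (insert {} L))"
  using assms
proof (induction rule: collapsible.induct)
  case (point w)
  \<comment> \<open>The new vertex \<open>e\<close> is the free face here, and the old vertex
    \<open>w\<close> takes the part of \<open>v\<close>.\<close>
  have "collapsible (A \<union> {{e}, insert w {e}})"
  proof (rule collapsible.expand)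
    show "\<rho> \<in> A" if "\<rho> \<subseteq> insert w {e}" "\<rho> \<noteq> {}" "\<rho> \<noteq> {e}" "\<rho> \<noteq> insert w {e}" for \<rho>
    proof -
      have "\<rho> = {w}" using that by blast
      then show ?thesis using point by simp
    qed
  qed (use point in auto)
  moreover have "A \<union> {{e}, insert w {e}} = A \<union> insert e ` (insert {} {{w}})" by auto
  ultimately show ?case by simp
next
  case (expand L \<sigma> v)
  have A: "\<sigma> \<in> A" "insert v \<sigma> \<in> A" "L \<subseteq> A" using expand.prems by auto
  have "e \<notin> \<sigma>" "e \<noteq> v" using A expand.prems by auto
  have eL: "e \<notin> \<rho>" if "\<rho> \<in> L" for \<rho> using that A expand.prems by auto
  have "collapsible (A \<union> insert e ` (insert {} L) \<union> {insert e \<sigma>, insert v (insert e \<sigma>)})"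
  proof (rule collapsible.expand)
    show "collapsible (A \<union> insert e ` insert {} L)" using expand.IH expand.prems by auto
    show "v \<notin> insert e \<sigma>" using \<open>e \<noteq> v\<close> expand by auto
    have nin: "insert e \<tau> \<notin> A \<union> insert e ` insert {} L" if "e \<notin> \<tau>" "\<tau> \<noteq> {}" "\<tau> \<notin> L" for \<tau>
    proof -
      have "insert e \<tau> \<noteq> insert e \<rho>" if "\<rho> \<in> insert {} L" for \<rho>
        using that eL \<open>e \<notin> \<tau>\<close> \<open>\<tau> \<noteq> {}\<close> \<open>\<tau> \<notin> L\<close> by (metis insert_iff insert_ident empty_iff)
      then show ?thesis using expand.prems by blast
    qed
    show "insert e \<sigma> \<notin> A \<union> insert e ` insert {} L"
      using nin[of \<sigma>] \<open>e \<notin> \<sigma>\<close> expand by auto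
    show "insert v (insert e \<sigma>) \<notin> A \<union> insert e ` insert {} L"
      using nin[of "insert v \<sigma>"] \<open>e \<notin> \<sigma>\<close> \<open>e \<noteq> v\<close> expand.hyps by (metis insert_commute insertE insert_not_empty)
    show "\<rho> \<in> A \<union> insert e ` insert {} L"
      if \<rho>: "\<rho> \<subseteq> insert v (insert e \<sigma>)" "\<rho> \<noteq> {}" "\<rho> \<noteq> insert e \<sigma>" "\<rho> \<noteq> insert v (insert e \<sigma>)" for \<rho>
    proof (cases "e \<in> \<rho>")
      case False
      then have "\<rho> \<subseteq> insert v \<sigma>" using \<rho> by auto
      then show ?thesis using collapsible_down_closed[OF expand.prems(1) A(2)] \<rho> by auto
    next
      case True
      then obtain \<tau> where \<tau>: "\<rho> = insert e \<tau>" "e \<notin> \<tau>" by (meson mk_disjoint_insert)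
      then have "\<tau> \<subseteq> insert v \<sigma>" "\<tau> \<noteq> \<sigma>" "\<tau> \<noteq> insert v \<sigma>"
        using \<rho> by (auto simp: insert_commute)
      then have "\<tau> \<in> insert {} L" using expand.hyps(7)[of \<tau>] by auto
      then show ?thesis using \<tau> by blast
    qed
  qed (use expand in auto)
  moreover have "A \<union> insert e ` (insert {} L) \<union> {insert e \<sigma>, insert v (insert e \<sigma>)}
      = A \<union> insert e ` (insert {} (L \<union> {\<sigma>, insert v \<sigma>}))"
    by (auto simp: insert_commute)
  ultimately show ?case by simp
qed

section \<open>Independence complexes of matroids\<close>

context matroid
begin

lemma indep_finite: "indep X \<Longrightarrow> finite X"
  using finite_ground indep_subset_ground finite_subset by blast

lemma augment_to_card:
  assumes "indep X" "indep Y" "card X \<le> card Y"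
  shows "\<exists>Z. X \<subseteq> Z \<and> Z \<subseteq> X \<union> Y \<and> indep Z \<and> card Z = card Y"
  using assms
proof (induction "card Y - card X" arbitrary: X)
  case 0
  then show ?case by (intro exI[of _ X]) auto
next
  case (Suc n)
  have "card X < card Y" using Suc.hyps(2) by linarith
  then obtain e where e: "e \<in> Y - X" "indep (insert e X)" using augment Suc.prems by blast
  then have "card (insert e X) = Suc (card X)" using indep_finite Suc.prems(1) by auto
  then have "\<exists>Z. insert e X \<subseteq> Z \<and> Z \<subseteq> insert e X \<union> Y \<and> indep Z \<and> card Z = card Y"
    using Suc e by (intro Suc.hyps(1)) auto
  then show ?case using e by auto
qed

lemma matroid_delete: "matroid (E - {e}) (\<lambda>X. indep X \<and> e \<notin> X)"
proof
  fix X Y assume "indep X \<and> e \<notin> X" "indep Y \<and> e \<notin> Y" "card X < card Y"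
  then show "\<exists>x\<in>Y - X. indep (insert x X) \<and> e \<notin> insert x X"
    using augment[of X Y] by auto
qed (use finite_ground indep_subset_ground indep_empty in \<open>auto dest: indep_subset\<close>)

lemma matroid_contract:
  assumes "indep {e}"
  shows "matroid (E - {e}) (\<lambda>X. indep (insert e X) \<and> e \<notin> X)"
proof
  fix X Y assume *: "indep (insert e X) \<and> e \<notin> X" "indep (insert e Y) \<and> e \<notin> Y" "card X < card Y"
  then have "finite X" "finite Y" using indep_finite by (metis finite_insert)+
  with * have "card (insert e X) < card (insert e Y)" by simp
  with * obtain x where "x \<in> insert e Y - insert e X" "indep (insert x (insert e X))"
    using augment[of "insert e X" "insert e Y"] by auto
  then show "\<exists>x\<in>Y - X. indep (insert e (insert x X)) \<and> e \<notin> insert x X"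
    using * by (auto simp: insert_commute)
next
  fix X Y assume "indep (insert e X) \<and> e \<notin> X" "Y \<subseteq> X"
  then show "indep (insert e Y) \<and> e \<notin> Y" using indep_subset[of "insert e X" "insert e Y"] by auto
qed (use finite_ground assms in \<open>auto dest: indep_subset_ground\<close>)

end

text \<open>The complex is the deletion of \<open>e\<close> with a cone attached over the link of
  \<open>e\<close>, which is the independence complex of the contraction. The removed sets are the
  bases removed for the deletion together with \<open>e\<close> added to those removed for the
  contraction. The deletion may acquire coloops, so that \<open>H\<close> is nonempty is inherited
  through the contraction, which has no coloop if the matroid has none.\<close>

theorem independence_complex_collapsible:
  assumes "matroid E indep"
    and "\<And>I. indep I \<Longrightarrow> card I \<le> s" "\<exists>I. indep I \<and> card I = s" "1 \<le> s"
  shows "\<exists>H. (\<forall>B\<in>H. indep B \<and> card B = s) \<and> collapsible ({I. indep I \<and> I \<noteq> {}} - H) \<and>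
    ((\<forall>e\<in>E. \<exists>I. indep I \<and> \<not> indep (insert e I)) \<longrightarrow> H \<noteq> {})"
  using assms
proof (induction "card E" arbitrary: E indep s rule: less_induct)
  case less
  interpret matroid E indep by (rule less.prems(1))
  obtain B0 where B0: "indep B0" "card B0 = s" using less.prems(3) by blast
  have fin: "finite {I. indep I}"
    using finite_ground indep_subset_ground by (auto intro!: rev_finite_subset[of "Pow E"])
  have smaller: "card (E - {e}) < card E" if "e \<in> E" for e
    using that finite_ground card_Diff1_less by metis
  show ?case
  proof (cases "\<exists>e\<in>E. \<forall>I. indep I \<longrightarrow> indep (insert e I)")
    case True
    then obtain e where e: "e \<in> E" "\<And>I. indep I \<Longrightarrow> indep (insert e I)" by blast
    \<comment> \<open>A coloop can be added to every independent set, so the complex is a cone with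
      apex \<open>e\<close> and no basis has to be removed.\<close>
    let ?L = "{I. indep I \<and> I \<noteq> {} \<and> e \<notin> I}"
    have "collapsible (?L \<union> insert e ` (insert {} ?L))"
      using fin indep_finite indep_subset by (intro collapsible_cone) (auto intro: finite_subset[OF _ fin])
    moreover have "?L \<union> insert e ` (insert {} ?L) = {I. indep I \<and> I \<noteq> {}}"
    proof (intro equalityI subsetI)
      fix I assume I: "I \<in> {I. indep I \<and> I \<noteq> {}}"
      show "I \<in> ?L \<union> insert e ` (insert {} ?L)"
      proof (cases "e \<in> I")
        case True
        then have "I = insert e (I - {e})" by auto
        moreover have "I - {e} \<in> insert {} ?L" using I indep_subset[of I "I - {e}"] by auto
        ultimately show ?thesis by blast
      qed (use I in auto)
    qed (use e indep_empty in auto)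
    ultimately show ?thesis using e by (intro exI[of _ "{}"]) auto
  next
    case False
    then have nocol: "\<And>e. e \<in> E \<Longrightarrow> \<exists>I. indep I \<and> \<not> indep (insert e I)" by blast
    have "B0 \<noteq> {}" using B0 less.prems(4) by auto
    then obtain e where "e \<in> B0" by auto
    then have e: "e \<in> E" "indep {e}" using B0 indep_subset_ground indep_subset[of B0 "{e}"] by auto
    \<comment> \<open>A set that becomes dependent with \<open>x\<close> extends to a basis, and no
      such basis can contain \<open>x\<close>.\<close>
    have basis_avoiding: "\<exists>B. indep B \<and> card B = s \<and> x \<notin> B" if x: "x \<in> E" for x
    proof -
      obtain I where I: "indep I" "\<not> indep (insert x I)" using nocol[OF x] by blast
      then obtain Z where "I \<subseteq> Z" "indep Z" "card Z = s"
        using augment_to_card[of I B0] less.prems(2) B0 by auto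
      then show ?thesis using I indep_subset[of Z "insert x I"] by auto
    qed
    have "\<exists>H. (\<forall>B\<in>H. (indep B \<and> e \<notin> B) \<and> card B = s) \<and>
        collapsible ({I. (indep I \<and> e \<notin> I) \<and> I \<noteq> {}} - H) \<and>
        ((\<forall>x\<in>E - {e}. \<exists>I. (indep I \<and> e \<notin> I) \<and> \<not> (indep (insert x I) \<and> e \<notin> insert x I)) \<longrightarrow> H \<noteq> {})"
    proof (rule less.hyps[OF smaller[OF e(1)] matroid_delete])
      show "\<exists>I. (indep I \<and> e \<notin> I) \<and> card I = s" using basis_avoiding[OF e(1)] by blast
      show "card I \<le> s" if "indep I \<and> e \<notin> I" for I using that less.prems(2) by blast
    qed (rule less.prems(4))
    then obtain H1 where H1: "\<forall>B\<in>H1. (indep B \<and> e \<notin> B) \<and> card B = s"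
      "collapsible ({I. (indep I \<and> e \<notin> I) \<and> I \<noteq> {}} - H1)" by (elim exE conjE) (rule that)
    let ?A = "{I. (indep I \<and> e \<notin> I) \<and> I \<noteq> {}} - H1"
    have card_con: "card (insert e I) = Suc (card I)" if "indep (insert e I)" "e \<notin> I" for I
      using that indep_finite by (metis card_insert_disjoint finite_insert)
    show ?thesis
    proof (cases "s = 1")
      case True
      \<comment> \<open>In rank one the link of \<open>e\<close> is empty: \<open>{e}\<close> is an
        isolated vertex, and being a basis it is removed instead of attached.\<close>
      have "I = {e}" if "indep I" "e \<in> I" for I
      proof -
        have "card I \<le> Suc 0" using less.prems(2)[OF that(1)] True by simp
        then show ?thesis using that(2) card_le_Suc0_iff_eq[OF indep_finite[OF that(1)]] by auto
      qed
      then have "{I. indep I \<and> I \<noteq> {}} - (insert {e} H1) = ?A" by auto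
      then have "collapsible ({I. indep I \<and> I \<noteq> {}} - (insert {e} H1))" using H1(2) by simp
      then show ?thesis
        using H1(1) e True by (intro exI[of _ "insert {e} H1"]) auto
    next
      case False
      define con where "con I \<longleftrightarrow> indep (insert e I) \<and> e \<notin> I" for I
      have con: "matroid (E - {e}) con"
        using matroid_contract[OF e(2)] unfolding con_def .
      \<comment> \<open>Extending \<open>{e}\<close> by elements of a basis that avoids
        \<open>x\<close> gives a basis through \<open>e\<close> that still avoids
        \<open>x\<close>.\<close>
      have nocol_con: "\<exists>I. con I \<and> \<not> con (insert x I)" if x: "x \<in> E - {e}" for x
      proof -
        obtain B where B: "indep B" "card B = s" "x \<notin> B" using basis_avoiding x by blast
        then obtain Z where Z: "{e} \<subseteq> Z" "Z \<subseteq> {e} \<union> B" "indep Z" "card Z = s"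
          using augment_to_card[of "{e}" B] e less.prems(4) by auto
        have "x \<notin> Z" using Z B x by auto
        then have "\<not> indep (insert x Z)"
          using less.prems(2)[of "insert x Z"] Z indep_finite[of Z] by auto
        moreover have "insert e (insert x (Z - {e})) = insert x Z" "insert e (Z - {e}) = Z" using Z by auto
        ultimately show ?thesis using Z by (intro exI[of _ "Z - {e}"]) (auto simp: con_def)
      qed
      have "\<exists>H. (\<forall>B\<in>H. con B \<and> card B = s - 1) \<and> collapsible ({I. con I \<and> I \<noteq> {}} - H) \<and>
        ((\<forall>x\<in>E - {e}. \<exists>I. con I \<and> \<not> con (insert x I)) \<longrightarrow> H \<noteq> {})"
      proof (rule less.hyps[OF smaller[OF e(1)] con])
        show "card I \<le> s - 1" if "con I" for I
          using that card_con[of I] less.prems(2)[of "insert e I"] by (auto simp: con_def)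
        have "insert e (B0 - {e}) = B0" using \<open>e \<in> B0\<close> by auto
        then show "\<exists>I. con I \<and> card I = s - 1"
          using B0 \<open>e \<in> B0\<close> indep_finite[of B0] by (intro exI[of _ "B0 - {e}"]) (auto simp: con_def)
        show "1 \<le> s - 1" using False less.prems(4) by linarith
      qed
      then obtain H2 where H2: "\<forall>B\<in>H2. con B \<and> card B = s - 1"
        "collapsible ({I. con I \<and> I \<noteq> {}} - H2)"
        and "(\<forall>x\<in>E - {e}. \<exists>I. con I \<and> \<not> con (insert x I)) \<longrightarrow> H2 \<noteq> {}"
        by (elim exE conjE) (rule that)
      then have "H2 \<noteq> {}" using nocol_con by simp
      let ?L = "{I. con I \<and> I \<noteq> {}} - H2"
      \<comment> \<open>A set in the link has fewer than \<open>s\<close> elements, so it is none of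
        the removed bases of the deletion.\<close>
      have LA: "?L \<subseteq> ?A"
      proof
        fix I assume "I \<in> ?L"
        then have I: "indep (insert e I)" "e \<notin> I" "I \<noteq> {}" by (auto simp: con_def)
        then have "card I < s" using less.prems(2)[of "insert e I"] card_con[of I] by simp
        then have "I \<notin> H1" using H1(1) by (metis nat_less_le)
        then show "I \<in> ?A" using I indep_subset[of "insert e I" I] by auto
      qed
      have "collapsible (?A \<union> insert e ` (insert {} ?L))"
        using H1 H2 LA by (intro collapsible_attach_cone) auto
      moreover have "?A \<union> insert e ` (insert {} ?L) = {I. indep I \<and> I \<noteq> {}} - (H1 \<union> insert e ` H2)"
      proof (intro equalityI subsetI)
        fix I assume I: "I \<in> ?A \<union> insert e ` (insert {} ?L)"
        then consider "I \<in> ?A" | "I = {e}" | J where "J \<in> ?L" "I = insert e J" by blast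
        then show "I \<in> {I. indep I \<and> I \<noteq> {}} - (H1 \<union> insert e ` H2)"
        proof cases
          case 2
          have "{e} \<noteq> insert e B" if "B \<in> H2" for B
          proof -
            have "e \<notin> B" "card B = s - 1" using H2(1) that by (auto simp: con_def)
            then have "e \<notin> B" "card B \<noteq> 0" using False less.prems(4) by auto
            then show ?thesis by (metis card.empty insert_ident empty_iff)
          qed
          then show ?thesis using 2 e H1 by auto
        next
          case 3
          then have "insert e J \<noteq> insert e B" if "B \<in> H2" for B
            using H2(1) 3 that insert_ident[of e J B] by (auto simp: con_def)
          then show ?thesis using 3 H1 by (auto simp: con_def)
        qed auto
      next
        fix I assume I: "I \<in> {I. indep I \<and> I \<noteq> {}} - (H1 \<union> insert e ` H2)"
        show "I \<in> ?A \<union> insert e ` (insert {} ?L)"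
        proof (cases "e \<in> I")
          case True
          then have eq: "I = insert e (I - {e})" by auto
          then have "I - {e} \<notin> H2" using I by blast
          then have "I - {e} \<in> insert {} ?L" using I True by (auto simp: con_def insert_absorb)
          then show ?thesis using eq by blast
        qed (use I in auto)
      qed
      ultimately have "collapsible ({I. indep I \<and> I \<noteq> {}} - (H1 \<union> insert e ` H2))" by simp
      moreover have "\<forall>B\<in>H1 \<union> insert e ` H2. indep B \<and> card B = s"
        using H1 H2(1) card_con less.prems(4) by (auto simp: con_def)
      ultimately show ?thesis
        using \<open>H2 \<noteq> {}\<close> by (intro exI[of _ "H1 \<union> insert e ` H2"]) simp
    qed
  qed
qed

subsection \<open>The dual matroid\<close>

context matroid
begin

abbreviation "rk \<equiv> matroid_rank indep"

lemma rk_finite: "finite {I. I \<subseteq> X \<and> indep I}"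
  using finite_ground indep_subset_ground by (auto intro!: rev_finite_subset[of "Pow E"])

lemma card_le_rk: "indep I \<Longrightarrow> I \<subseteq> X \<Longrightarrow> card I \<le> rk X"
  unfolding matroid_rank_def using rk_finite[of X] by (intro Max_ge) auto

lemma rk_attained: "\<exists>I. indep I \<and> I \<subseteq> X \<and> card I = rk X"
proof -
  have "rk X \<in> card ` {I. I \<subseteq> X \<and> indep I}"
    unfolding matroid_rank_def using rk_finite[of X] indep_empty by (intro Max_in) auto
  then show ?thesis by auto
qed

lemma rk_mono: "X \<subseteq> Y \<Longrightarrow> rk X \<le> rk Y"
  using rk_attained[of X] card_le_rk by (metis subset_trans)

text \<open>Closure is monotone. If \<open>c\<close> were not spanned by \<open>Y\<close>, a basis
  of \<open>Y\<close> that contains a basis \<open>I\<close> of \<open>X\<close> could be enlarged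
  by \<open>c\<close>, and then \<open>insert c I\<close> would be independent inside
  \<open>insert c X\<close>, against the rank.\<close>

lemma rk_insert_eq_mono:
  assumes "rk (insert c X) = rk X" "X \<subseteq> Y"
  shows "rk (insert c Y) = rk Y"
proof (cases "c \<in> Y")
  case False
  show ?thesis
  proof (rule ccontr)
    assume "rk (insert c Y) \<noteq> rk Y"
    then have less: "rk Y < rk (insert c Y)"
      using rk_mono[OF subset_insertI, of Y c] by linarith
    obtain I where I: "indep I" "I \<subseteq> X" "card I = rk X" using rk_attained by blast
    obtain J where J: "indep J" "J \<subseteq> Y" "card J = rk Y" using rk_attained by blast
    obtain Z where Z: "I \<subseteq> Z" "Z \<subseteq> I \<union> J" "indep Z" "card Z = rk Y"
      using augment_to_card[of I J] I J rk_mono[OF assms(2)] by auto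
    obtain W where W: "indep W" "W \<subseteq> insert c Y" "card W = rk (insert c Y)" using rk_attained by blast
    obtain e where e: "e \<in> W - Z" "indep (insert e Z)" using augment[of Z W] Z W less by auto
    have "card (insert e Z) = Suc (rk Y)" using e Z indep_finite by auto
    moreover have "Z \<subseteq> Y" using Z(2) I(2) J(2) assms(2) by blast
    ultimately have "e \<notin> Y" using card_le_rk[OF e(2), of Y] by auto
    then have "e = c" using e W by auto
    then have "indep (insert c I)" using e Z indep_subset[of "insert e Z" "insert c I"] by auto
    moreover have "c \<notin> I" using False I assms by auto
    ultimately show False
      using card_le_rk[of "insert c I" "insert c X"] I assms(1) indep_finite[of I] by auto
  qed
qed (simp add: insert_absorb)

definition coindep :: "'a set \<Rightarrow> bool" where
  "coindep X \<longleftrightarrow> X \<subseteq> E \<and> rk (E - X) = rk E"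

lemma coindep_iff: "coindep X \<longleftrightarrow> X \<subseteq> E \<and> (\<exists>B. indep B \<and> B \<inter> X = {} \<and> card B = rk E)"
proof
  assume "coindep X"
  then show "X \<subseteq> E \<and> (\<exists>B. indep B \<and> B \<inter> X = {} \<and> card B = rk E)"
    using rk_attained[of "E - X"] by (auto simp: coindep_def)
next
  assume X: "X \<subseteq> E \<and> (\<exists>B. indep B \<and> B \<inter> X = {} \<and> card B = rk E)"
  then obtain B where "indep B" "B \<inter> X = {}" "card B = rk E" by auto
  then have "rk E \<le> rk (E - X)" using card_le_rk[of B "E - X"] indep_subset_ground[of B] by auto
  then show "coindep X" using X rk_mono[of "E - X" E] by (auto simp: coindep_def)
qed

text \<open>Exchange by counting. Let \<open>I\<close> be a basis of the complement of
  \<open>X \<union> Y\<close>, extended to bases \<open>C1\<close> avoiding \<open>X\<close> and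
  \<open>C2\<close> avoiding \<open>Y\<close>. If no element can be exchanged, \<open>C1\<close>
  contains \<open>I\<close> and \<open>Y - X\<close>, while maximality of \<open>I\<close> puts
  \<open>C2 - I\<close> into \<open>X - Y\<close>; as \<open>X - Y\<close> is smaller than
  \<open>Y - X\<close>, the two bases would differ in size.\<close>

lemma matroid_coindep: "matroid E coindep"
proof
  show "coindep {}" by (simp add: coindep_def)
  show "coindep Y" if "coindep X" "Y \<subseteq> X" for X Y
    using that by (auto simp: coindep_iff)
  fix X Y assume X: "coindep X" and Y: "coindep Y" and card: "card X < card Y"
  show "\<exists>e\<in>Y - X. coindep (insert e X)"
  proof (rule ccontr)
    assume contra: "\<not> ?thesis"
    obtain I where I: "indep I" "I \<subseteq> E - (X \<union> Y)" "card I = rk (E - (X \<union> Y))"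
      using rk_attained by blast
    obtain B1 where B1: "indep B1" "B1 \<inter> X = {}" "card B1 = rk E" using X coindep_iff by auto
    obtain B2 where B2: "indep B2" "B2 \<inter> Y = {}" "card B2 = rk E" using Y coindep_iff by auto
    have "card I \<le> rk E" using I card_le_rk[of I E] by auto
    then obtain C1 C2 where C1: "I \<subseteq> C1" "C1 \<subseteq> I \<union> B1" "indep C1" "card C1 = rk E"
      and C2: "I \<subseteq> C2" "C2 \<subseteq> I \<union> B2" "indep C2" "card C2 = rk E"
      using augment_to_card[OF I(1) B1(1)] augment_to_card[OF I(1) B2(1)] B1 B2 by metis
    \<comment> \<open>An element of \<open>Y - X\<close> outside the basis \<open>C1\<close> could
      be added to \<open>X\<close>, with \<open>C1\<close> as witness.\<close>
    have YC: "Y - X \<subseteq> C1"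
    proof
      fix e assume e: "e \<in> Y - X"
      then have "\<not> coindep (insert e X)" using contra by auto
      moreover have "insert e X \<subseteq> E" using e X Y by (auto simp: coindep_def)
      moreover have "C1 \<inter> X = {}" using C1 B1 I by auto
      ultimately show "e \<in> C1" using C1 by (auto simp: coindep_iff)
    qed
    have "C2 - I \<subseteq> X - Y"
    proof
      fix e assume e: "e \<in> C2 - I"
      then have "e \<notin> Y" "e \<in> E" using C2 B2 indep_subset_ground[of C2] by auto
      moreover have "e \<in> X"
      proof (rule ccontr)
        assume "e \<notin> X"
        have "indep (insert e I)" using e C2 indep_subset[of C2 "insert e I"] by auto
        moreover have "insert e I \<subseteq> E - (X \<union> Y)" using \<open>e \<notin> X\<close> \<open>e \<notin> Y\<close> \<open>e \<in> E\<close> I by auto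
        ultimately have "card (insert e I) \<le> card I" using card_le_rk I by metis
        then show False using e I indep_finite[of I] by auto
      qed
      ultimately show "e \<in> X - Y" by auto
    qed
    moreover have fin: "finite X" "finite Y" "finite I" "finite C1" "finite C2"
      using X Y finite_ground I C1 C2 indep_finite by (auto simp: coindep_def intro: finite_subset)
    ultimately have "card (C2 - I) \<le> card (X - Y)" by (meson card_mono finite_Diff)
    moreover have "card (C2 - I) = card C2 - card I" "card I \<le> card C2"
      using fin C2(1) by (simp_all add: card_Diff_subset card_mono)
    ultimately have "rk E \<le> card I + card (X - Y)" using C2 by auto
    moreover have "card (X - Y) < card (Y - X)"
    proof -
      have "card X = card (X - Y) + card (X \<inter> Y)" "card Y = card (Y - X) + card (X \<inter> Y)"
        using fin card_Diff_subset_Int[of X Y] card_Diff_subset_Int[of Y X]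
          card_mono[of X "X \<inter> Y"] card_mono[of Y "X \<inter> Y"] by (auto simp: Int_commute)
      then show ?thesis using card by linarith
    qed
    moreover have "card I + card (Y - X) = card (I \<union> (Y - X))"
      using fin I by (subst card_Un_disjoint) auto
    moreover have "card (I \<union> (Y - X)) \<le> card C1" using C1 YC fin by (intro card_mono) auto
    ultimately show False using C1 by linarith
  qed
qed (auto simp: coindep_def finite_ground)

lemma coindep_card_le:
  assumes "coindep X" shows "card X \<le> card E - rk E"
proof -
  obtain B where B: "indep B" "B \<inter> X = {}" "card B = rk E" "X \<subseteq> E" using assms coindep_iff by auto
  then have "card B + card X = card (B \<union> X)"
    using finite_ground indep_finite finite_subset by (metis card_Un_disjoint)
  also have "\<dots> \<le> card E" using B indep_subset_ground finite_ground by (intro card_mono) auto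
  finally show ?thesis using B by linarith
qed

lemma coindep_card_attained: "\<exists>X. coindep X \<and> card X = card E - rk E"
proof -
  obtain B where B: "indep B" "B \<subseteq> E" "card B = rk E" using rk_attained by blast
  then have "coindep (E - B)" by (auto simp: coindep_iff)
  moreover have "card (E - B) = card E - rk E" using B indep_finite by (simp add: card_Diff_subset)
  ultimately show ?thesis by blast
qed

text \<open>A non-loop lies in some basis \<open>Z\<close>. The complement of \<open>Z\<close> is
  coindependent, but with \<open>e\<close> added its complement is only \<open>Z - {e}\<close>, too
  small to contain a basis.\<close>

lemma coindep_no_coloop:
  assumes "loopless E indep" "e \<in> E"
  shows "\<exists>I. coindep I \<and> \<not> coindep (insert e I)"
proof -
  obtain B where B: "indep B" "card B = rk E" using rk_attained[of E] by blast
  have e: "indep {e}" using assms by (auto simp: loopless_def)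
  have "card {e} \<le> card B" using card_le_rk[OF e, of E] B assms by auto
  then obtain Z where Z: "{e} \<subseteq> Z" "indep Z" "card Z = rk E"
    using augment_to_card[OF e B(1)] B by auto
  then have "coindep (E - Z)" by (auto simp: coindep_iff)
  moreover have "\<not> coindep (insert e (E - Z))"
  proof
    assume "coindep (insert e (E - Z))"
    then obtain B' where B': "indep B'" "B' \<inter> insert e (E - Z) = {}" "card B' = rk E"
      by (auto simp: coindep_iff)
    then have "B' \<subseteq> Z - {e}" using indep_subset_ground by blast
    moreover have "finite Z" using Z indep_finite by auto
    ultimately have "card B' < card Z" using Z by (intro psubset_card_mono) auto
    then show False using B' Z by simp
  qed
  ultimately show ?thesis by blast
qed

end

section \<open>Non-flats and weight functions\<close>

text \<open>\<open>col Y c\<close> stands for: \<open>c\<close> is a coloop of the dual matroid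
  restricted to \<open>Y\<close>. The deformation rests on the fact that a coloop stays one in
  smaller sets; \<open>no_col_E\<close> keeps the empty set out of the non-flats.\<close>

locale coloops =
  fixes E :: "'a set" and col :: "'a set \<Rightarrow> 'a \<Rightarrow> bool"
  assumes finite_E: "finite E"
    and col_mem: "col Y c \<Longrightarrow> c \<in> Y"
    and col_mono: "col Y c \<Longrightarrow> Z \<subseteq> Y \<Longrightarrow> c \<in> Z \<Longrightarrow> col Z c"
    and no_col_E: "\<not> col E c"
begin

definition has_col :: "'a set \<Rightarrow> bool" where
  "has_col Y \<longleftrightarrow> Y \<subseteq> E \<and> (\<exists>c. col Y c)"

text \<open>For a matroid these are the nonempty sets independent in the dual; here independence is
  expressed through coloops of subsets alone.\<close>

definition free :: "'a set \<Rightarrow> bool" where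
  "free S \<longleftrightarrow> S \<noteq> {} \<and> (\<forall>C\<subseteq>S. C \<noteq> {} \<longrightarrow> has_col C)"

text \<open>Thresholds are positive because at \<open>t \<le> 0\<close> the superlevel set is the
  whole type. The functions are not normalised, so scaling by positive factors stays inside the
  space.\<close>

definition weights :: "('a \<Rightarrow> real) set" where
  "weights = {f. (\<forall>e. 0 \<le> f e) \<and> {e. f e \<noteq> 0} \<subseteq> E \<and> {e. f e \<noteq> 0} \<noteq> {} \<and>
     (\<forall>t>0. {e. t \<le> f e} \<noteq> {} \<longrightarrow> has_col {e. t \<le> f e})}"

lemma weights_scale:
  assumes "f \<in> weights" "c > 0"
  shows "(\<lambda>e. c * f e) \<in> weights"
proof -
  have "{e. t \<le> c * f e} = {e. t / c \<le> f e}" for t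
    using assms(2) by (auto simp: field_simps)
  moreover have "has_col {e. t / c \<le> f e}" if "t > 0" "{e. t / c \<le> f e} \<noteq> {}" for t
  proof -
    have "0 < t / c" using assms(2) that(1) by simp
    then show ?thesis using assms(1) that(2) unfolding weights_def by blast
  qed
  ultimately have "\<forall>t>0. {e. t \<le> c * f e} \<noteq> {} \<longrightarrow> has_col {e. t \<le> c * f e}"
    by simp
  moreover have "\<forall>e. 0 \<le> c * f e" "{e. c * f e \<noteq> 0} = {e. f e \<noteq> 0}"
    using assms by (auto simp: weights_def)
  ultimately show ?thesis using assms(1) unfolding weights_def mem_Collect_eq by simp
qed

lemma weights_sum_pos: "f \<in> weights \<Longrightarrow> (\<Sum>e\<in>E. f e) > 0"
  using finite_E by (intro normalize_on_support_sum_pos) (auto simp: weights_def)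

subsection \<open>Weight functions and chains of non-flats\<close>

definition nonflats :: "'a set set" where
  "nonflats = {X. X \<subseteq> E \<and> has_col (E - X)}"

lemma nonflats_proper: "X \<in> nonflats \<Longrightarrow> X \<subseteq> E \<and> X \<noteq> {} \<and> E - X \<noteq> {}"
  using no_col_E by (auto simp: nonflats_def has_col_def dest: col_mem)

text \<open>The combination of the indicator functions of the complements \<open>E - X\<close> with
  coefficients \<open>x X\<close>. If the coefficients live on a chain, the nonempty superlevel sets
  at positive heights are complements of members of the chain.\<close>

definition level_sum :: "('a set \<Rightarrow> real) \<Rightarrow> 'a \<Rightarrow> real" where
  "level_sum x e = (\<Sum>X\<in>Pow E. if e \<in> E - X then x X else 0)"

lemma level_sum_outside: "e \<notin> E \<Longrightarrow> level_sum x e = 0"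
  by (simp add: level_sum_def)

lemma level_sum_nonneg: "(\<And>X. 0 \<le> x X) \<Longrightarrow> 0 \<le> level_sum x e"
  by (simp add: level_sum_def sum_nonneg)

definition chain_weight :: "('a set \<Rightarrow> real) \<Rightarrow> bool" where
  "chain_weight x \<longleftrightarrow> (\<forall>X. 0 \<le> x X) \<and> {X. x X \<noteq> 0} \<subseteq> Pow E \<and>
     (\<forall>X Z. x X \<noteq> 0 \<longrightarrow> x Z \<noteq> 0 \<longrightarrow> X \<subseteq> Z \<or> Z \<subseteq> X)"

lemma chain_weightD:
  assumes "chain_weight x"
  shows "0 \<le> x X" "x X \<noteq> 0 \<Longrightarrow> X \<subseteq> E" "x X \<noteq> 0 \<Longrightarrow> x Z \<noteq> 0 \<Longrightarrow> X \<subseteq> Z \<or> Z \<subseteq> X"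
  using assms unfolding chain_weight_def by auto

lemma finite_chain_support: "chain_weight x \<Longrightarrow> finite {X. x X \<noteq> 0 \<and> P X}"
  by (rule finite_subset[of _ "Pow E"]) (auto simp: finite_E chain_weight_def)

lemma chain_weight_max:
  assumes x: "chain_weight x" and "x Y \<noteq> 0" "P Y"
  obtains X0 where "x X0 \<noteq> 0" "P X0" "\<And>X. x X \<noteq> 0 \<Longrightarrow> P X \<Longrightarrow> X \<subseteq> X0"
proof -
  let ?C = "{X. x X \<noteq> 0 \<and> P X}"
  have "?C \<noteq> {}" using assms by auto
  then obtain X0 where X0: "X0 \<in> ?C" "\<forall>X\<in>?C. X0 \<subseteq> X \<longrightarrow> X0 = X"
    using finite_has_maximal[OF finite_chain_support[OF x, of P]] by metis
  have "X \<subseteq> X0" if "x X \<noteq> 0" "P X" for X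
  proof -
    have "X \<subseteq> X0 \<or> X0 \<subseteq> X" using chain_weightD(3)[OF x that(1)] X0(1) by simp
    then show ?thesis using X0(2) that by auto
  qed
  then show thesis using X0(1) that[of X0] by blast
qed

lemma chain_weight_min:
  assumes x: "chain_weight x" and "x Y \<noteq> 0" "P Y"
  obtains X0 where "x X0 \<noteq> 0" "P X0" "\<And>X. x X \<noteq> 0 \<Longrightarrow> P X \<Longrightarrow> X0 \<subseteq> X"
proof -
  let ?C = "{X. x X \<noteq> 0 \<and> P X}"
  have "?C \<noteq> {}" using assms by auto
  then obtain X0 where X0: "X0 \<in> ?C" "\<forall>X\<in>?C. X \<subseteq> X0 \<longrightarrow> X0 = X"
    using finite_has_minimal[OF finite_chain_support[OF x, of P]] by metis
  have "X0 \<subseteq> X" if "x X \<noteq> 0" "P X" for X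
  proof -
    have "X \<subseteq> X0 \<or> X0 \<subseteq> X" using chain_weightD(3)[OF x that(1)] X0(1) by simp
    then show ?thesis using X0(2) that by auto
  qed
  then show thesis using X0(1) that[of X0] by blast
qed

text \<open>\<open>X0\<close> is the largest member of the chain missing \<open>e0\<close>; it
  exists because the value at \<open>e0\<close> is positive. An element outside \<open>X0\<close> is
  missed by every member that misses \<open>e0\<close>, so its value is at least as large. An
  element of \<open>X0\<close> is missed by fewer members, and loses at least the coefficient of
  \<open>X0\<close>.\<close>

lemma level_sum_superlevel:
  assumes x: "chain_weight x" and e0: "e0 \<in> E" "0 < level_sum x e0"
  shows "\<exists>X0. x X0 \<noteq> 0 \<and> (\<forall>e\<in>E. level_sum x e0 \<le> level_sum x e \<longleftrightarrow> e \<notin> X0)"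
proof -
  have "\<exists>Y. x Y \<noteq> 0 \<and> e0 \<notin> Y"
  proof (rule ccontr)
    assume "\<not> ?thesis"
    then have "level_sum x e0 = 0" unfolding level_sum_def by (intro sum.neutral) auto
    then show False using e0 by simp
  qed
  then obtain X0 where X0: "x X0 \<noteq> 0" "e0 \<notin> X0" and below: "\<And>X. x X \<noteq> 0 \<Longrightarrow> e0 \<notin> X \<Longrightarrow> X \<subseteq> X0"
    using chain_weight_max[OF x, where P = "\<lambda>X. e0 \<notin> X"] by metis
  have "level_sum x e0 \<le> level_sum x e" if "e \<in> E" "e \<notin> X0" for e
    unfolding level_sum_def
  proof (rule sum_mono)
    fix X
    show "(if e0 \<in> E - X then x X else 0) \<le> (if e \<in> E - X then x X else 0)"
      using below[of X] that chain_weightD(1)[OF x, of X] by (cases "x X = 0") auto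
  qed
  moreover have "level_sum x e < level_sum x e0" if "e \<in> E" "e \<in> X0" for e
    unfolding level_sum_def
  proof (rule sum_strict_mono_ex1)
    show "\<forall>X\<in>Pow E. (if e \<in> E - X then x X else 0) \<le> (if e0 \<in> E - X then x X else 0)"
    proof
      fix X
      have "e0 \<notin> X" if "x X \<noteq> 0" "e \<notin> X"
        using chain_weightD(3)[OF x that(1) X0(1)] X0(2) that(2) \<open>e \<in> X0\<close> by auto
      then show "(if e \<in> E - X then x X else 0) \<le> (if e0 \<in> E - X then x X else 0)"
        using e0 chain_weightD(1)[OF x, of X] by (cases "x X = 0") auto
    qed
    have "x X0 > 0" using X0(1) chain_weightD(1)[OF x, of X0] by auto
    then show "\<exists>X\<in>Pow E. (if e \<in> E - X then x X else 0) < (if e0 \<in> E - X then x X else 0)"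
      using X0 e0 that chain_weightD(2)[OF x, of X0] by (intro bexI[of _ X0]) auto
  qed (simp add: finite_E)
  ultimately show ?thesis using X0(1) by (intro exI[of _ X0]) (auto simp: not_less[symmetric])
qed

text \<open>The inverse of \<open>level_sum\<close>: the coefficient of \<open>X\<close> is the drop
  from the least value off \<open>X\<close> to the greatest value on \<open>X\<close>, cut off at
  zero. As a closed formula in minima and maxima it is continuous, unlike an enumeration of the
  levels of \<open>f\<close>. The default 0 covers the sets for which one of the two extrema would
  be over the empty set.\<close>

definition gap :: "('a \<Rightarrow> real) \<Rightarrow> 'a set \<Rightarrow> real" where
  "gap f X = (if X \<subseteq> E \<and> X \<noteq> {} \<and> E - X \<noteq> {} then max 0 (Min (f ` (E - X)) - Max (f ` X)) else 0)"

lemma gap_nonneg: "0 \<le> gap f X"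
  by (simp add: gap_def)

text \<open>For a member \<open>X\<close> of the chain the least value off \<open>X\<close> adds the
  coefficients of all members contained in \<open>X\<close>, and the greatest value on
  \<open>X\<close> adds those of the proper subsets only; the difference is
  \<open>x X\<close>.\<close>

lemma gap_level_sum:
  assumes x: "chain_weight x" and proper: "\<And>X. x X \<noteq> 0 \<Longrightarrow> X \<noteq> {} \<and> E - X \<noteq> {}"
  shows "gap (level_sum x) = x"
proof
  fix X
  show "gap (level_sum x) X = x X"
  proof (cases "X \<subseteq> E \<and> X \<noteq> {} \<and> E - X \<noteq> {}")
    case False
    then have "x X = 0" using chain_weightD(2)[OF x, of X] proper[of X] by auto
    then show ?thesis using False by (auto simp: gap_def)
  next
    case X: True
    have fin: "finite (E - X)" "finite X" using finite_E X finite_subset by auto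
    show ?thesis
    proof (cases "x X = 0")
      case True
      \<comment> \<open>A positive gap would make \<open>X\<close> the complement of the superlevel
        set at the least value off \<open>X\<close>, hence a member of the chain.\<close>
      have "Min (level_sum x ` (E - X)) \<le> Max (level_sum x ` X)"
      proof (rule ccontr)
        assume *: "\<not> ?thesis"
        have "Min (level_sum x ` (E - X)) \<in> level_sum x ` (E - X)"
          using fin X by (intro Min_in) auto
        then obtain e0 where e0: "e0 \<in> E - X" "level_sum x e0 = Min (level_sum x ` (E - X))" by auto
        have le: "level_sum x e0 \<le> level_sum x e" if "e \<in> E - X" for e
          using that fin by (auto simp: e0 intro!: Min_le)
        have gr: "level_sum x e < level_sum x e0" if "e \<in> X" for e
        proof -
          have "level_sum x e \<le> Max (level_sum x ` X)" using that fin by (intro Max_ge) auto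
          then show ?thesis using * e0 by simp
        qed
        obtain e1 where "e1 \<in> X" using X by auto
        then have "0 < level_sum x e0"
          using gr[of e1] level_sum_nonneg[of x e1] chain_weightD(1)[OF x] by fastforce
        then obtain X0 where X0: "x X0 \<noteq> 0" "\<forall>e\<in>E. level_sum x e0 \<le> level_sum x e \<longleftrightarrow> e \<notin> X0"
          using level_sum_superlevel[OF x _ , of e0] e0(1) by blast
        have "X0 \<subseteq> E" using chain_weightD(2)[OF x X0(1)] .
        have "X = X0"
        proof (rule set_eqI)
          fix e
          show "e \<in> X \<longleftrightarrow> e \<in> X0"
            using X0(2) le[of e] gr[of e] X \<open>X0 \<subseteq> E\<close> by (cases "e \<in> E") (auto simp: not_less[symmetric])
        qed
        then show False using True X0 by simp
      qed
      then show ?thesis using True by (simp add: gap_def)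
    next
      case False
      let ?A = "\<Sum>Z\<in>Pow E. if Z \<subseteq> X then x Z else 0"
      let ?B = "\<Sum>Z\<in>Pow E. if Z \<subset> X then x Z else 0"
      have xX: "x Z \<noteq> 0 \<Longrightarrow> Z \<subseteq> X \<or> X \<subset> Z" for Z
        using chain_weightD(3)[OF x False, of Z] by auto
      have "Min (level_sum x ` (E - X)) = ?A"
      proof (rule Min_eqI)
        fix s assume "s \<in> level_sum x ` (E - X)"
        then obtain e where e: "e \<in> E - X" "s = level_sum x e" by auto
        show "?A \<le> s" unfolding e level_sum_def
        proof (rule sum_mono)
          fix Z
          show "(if Z \<subseteq> X then x Z else 0) \<le> (if e \<in> E - Z then x Z else 0)"
            using e chain_weightD(1)[OF x, of Z] by auto
        qed
      next
        \<comment> \<open>The minimum is attained at an element that the next larger member adds to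
          \<open>X\<close>; without a larger member any element off \<open>X\<close> will
          do.\<close>
        have "\<exists>e\<in>E - X. \<forall>Z. x Z \<noteq> 0 \<longrightarrow> X \<subset> Z \<longrightarrow> e \<in> Z"
        proof (cases "{Z. x Z \<noteq> 0 \<and> X \<subset> Z} = {}")
          case True
          then show ?thesis using X by blast
        next
          case False
          then obtain Y where "x Y \<noteq> 0" "X \<subset> Y" by auto
          then obtain Z1 where Z1: "x Z1 \<noteq> 0" "X \<subset> Z1" "\<And>Z. x Z \<noteq> 0 \<Longrightarrow> X \<subset> Z \<Longrightarrow> Z1 \<subseteq> Z"
            using chain_weight_min[OF x, where P = "\<lambda>Z. X \<subset> Z"] by metis
          obtain e where e: "e \<in> Z1 - X" using Z1(2) by auto
          moreover have "e \<in> E" using e chain_weightD(2)[OF x Z1(1)] by auto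
          moreover have "e \<in> Z" if "x Z \<noteq> 0" "X \<subset> Z" for Z using Z1(3)[OF that] e by auto
          ultimately show ?thesis by blast
        qed
        then obtain e where e: "e \<in> E - X" "\<And>Z. x Z \<noteq> 0 \<Longrightarrow> X \<subset> Z \<Longrightarrow> e \<in> Z" by blast
        have "?A = level_sum x e" unfolding level_sum_def
        proof (rule sum.cong[OF refl])
          fix Z
          show "(if Z \<subseteq> X then x Z else 0) = (if e \<in> E - Z then x Z else 0)"
            using e xX[of Z] by (cases "x Z = 0") auto
        qed
        then show "?A \<in> level_sum x ` (E - X)" using e by auto
      qed (use fin in auto)
      moreover have "Max (level_sum x ` X) = ?B"
      proof (rule Max_eqI)
        fix s assume "s \<in> level_sum x ` X"
        then obtain e where e: "e \<in> X" "s = level_sum x e" by auto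
        show "s \<le> ?B" unfolding e level_sum_def
        proof (rule sum_mono)
          fix Z
          show "(if e \<in> E - Z then x Z else 0) \<le> (if Z \<subset> X then x Z else 0)"
            using e xX[of Z] chain_weightD(1)[OF x, of Z] by (cases "x Z = 0") auto
        qed
      next
        \<comment> \<open>Dually, the maximum is attained at an element of \<open>X\<close> outside
          the next smaller member.\<close>
        have "\<exists>e\<in>X. \<forall>Z. x Z \<noteq> 0 \<longrightarrow> Z \<subset> X \<longrightarrow> e \<notin> Z"
        proof (cases "{Z. x Z \<noteq> 0 \<and> Z \<subset> X} = {}")
          case True
          then show ?thesis using X by blast
        next
          case False
          then obtain Y where "x Y \<noteq> 0" "Y \<subset> X" by auto
          then obtain Z1 where Z1: "x Z1 \<noteq> 0" "Z1 \<subset> X" "\<And>Z. x Z \<noteq> 0 \<Longrightarrow> Z \<subset> X \<Longrightarrow> Z \<subseteq> Z1"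
            using chain_weight_max[OF x, where P = "\<lambda>Z. Z \<subset> X"] by metis
          obtain e where e: "e \<in> X - Z1" using Z1(2) by auto
          moreover have "e \<notin> Z" if "x Z \<noteq> 0" "Z \<subset> X" for Z using Z1(3)[OF that] e by auto
          ultimately show ?thesis by blast
        qed
        then obtain e where e: "e \<in> X" "\<And>Z. x Z \<noteq> 0 \<Longrightarrow> Z \<subset> X \<Longrightarrow> e \<notin> Z" by blast
        have "?B = level_sum x e" unfolding level_sum_def
        proof (rule sum.cong[OF refl])
          fix Z
          show "(if Z \<subset> X then x Z else 0) = (if e \<in> E - Z then x Z else 0)"
            using e xX[of Z] X by (cases "x Z = 0") auto
        qed
        then show "?B \<in> level_sum x ` X" using e by auto
      qed (use fin in auto)
      moreover have "?A - ?B = x X"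
      proof -
        have "?A - ?B = (\<Sum>Z\<in>Pow E. if Z = X then x X else 0)"
          unfolding sum_subtractf[symmetric] by (rule sum.cong) auto
        also have "\<dots> = x X" using X finite_E by simp
        finally show ?thesis .
      qed
      ultimately show ?thesis using X chain_weightD(1)[OF x, of X] by (simp add: gap_def)
    qed
  qed
qed

text \<open>The least positive value \<open>m\<close> is subtracted on the whole support; this layer
  is the coefficient of the complement of the support, and the remaining function has smaller
  support.\<close>

lemma layer_cake:
  fixes f :: "'a \<Rightarrow> real"
  assumes "\<And>e. 0 \<le> f e" "{e. f e \<noteq> 0} \<subseteq> E"
  shows "\<exists>x. (\<forall>X. 0 \<le> x X) \<and> level_sum x = f \<and>
    (\<forall>X. x X \<noteq> 0 \<longrightarrow> (\<exists>t>0. {e. t \<le> f e} \<noteq> {} \<and> X = E - {e. t \<le> f e}))"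
  using assms
proof (induction "card {e. f e \<noteq> 0}" arbitrary: f rule: less_induct)
  case less
  let ?Y = "{e. f e \<noteq> 0}"
  show ?case
  proof (cases "?Y = {}")
    case True
    then show ?thesis by (intro exI[of _ "\<lambda>_. 0"]) (auto simp: level_sum_def fun_eq_iff)
  next
    case False
    have finY: "finite ?Y" using less.prems finite_E finite_subset by blast
    define m where "m = Min (f ` ?Y)"
    have "m \<in> f ` ?Y" unfolding m_def using finY False by (intro Min_in) auto
    then obtain e0 where e0: "e0 \<in> ?Y" "f e0 = m" by auto
    have m_le: "m \<le> f e" if "f e \<noteq> 0" for e
      unfolding m_def using that finY by (intro Min_le) auto
    have "m > 0" using e0 less.prems(1)[of e0] by auto
    define g where "g e = (if f e \<noteq> 0 then f e - m else 0)" for e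
    have "{e. g e \<noteq> 0} \<subset> ?Y" using e0 by (auto simp: g_def)
    then have "card {e. g e \<noteq> 0} < card ?Y" "{e. g e \<noteq> 0} \<subseteq> E"
      using finY less.prems(2) by (auto intro: psubset_card_mono)
    moreover have "0 \<le> g e" for e using m_le[of e] by (auto simp: g_def)
    ultimately obtain x where x: "\<forall>X. 0 \<le> x X" "level_sum x = g"
      "\<forall>X. x X \<noteq> 0 \<longrightarrow> (\<exists>t>0. {e. t \<le> g e} \<noteq> {} \<and> X = E - {e. t \<le> g e})"
      using less.hyps[of g] by blast
    have level: "{e. t \<le> g e} = {e. t + m \<le> f e}" if "t > 0" for t
      using that \<open>m > 0\<close> by (auto simp: g_def split: if_splits)
    have Y: "{e. m \<le> f e} = ?Y" using \<open>m > 0\<close> m_le by auto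
    \<comment> \<open>The superlevel sets of \<open>g\<close> miss \<open>e0\<close>, where
      \<open>f\<close> takes its least positive value. So setting the coefficient to
      \<open>m\<close> overwrites nothing.\<close>
    have x0: "x (E - ?Y) = 0"
    proof (rule ccontr)
      assume "x (E - ?Y) \<noteq> 0"
      then obtain t where t: "t > 0" "E - ?Y = E - {e. t \<le> g e}" using x(3) by blast
      have "e0 \<in> E" using e0 less.prems(2) by blast
      moreover have "\<not> t \<le> g e0" using t e0 by (auto simp: g_def)
      ultimately show False using t(2) e0(1) by blast
    qed
    define y where "y = x(E - ?Y := m)"
    have "level_sum y = f"
    proof
      fix e
      show "level_sum y e = f e"
      proof (cases "e \<in> E")
        case True
        have "level_sum y e = (\<Sum>X\<in>Pow E. (if e \<in> E - X then x X else 0) + (if X = E - ?Y then (if e \<in> ?Y then m else 0) else 0))"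
          unfolding level_sum_def using x0 True by (intro sum.cong[OF refl]) (auto simp: y_def)
        also have "\<dots> = level_sum x e + (if e \<in> ?Y then m else 0)"
          unfolding sum.distrib level_sum_def using finite_E by (simp add: sum.delta)
        also have "\<dots> = f e" using x(2) by (simp add: g_def)
        finally show ?thesis .
      qed (use less.prems(2) in \<open>auto simp: level_sum_outside\<close>)
    qed
    moreover have "\<exists>t>0. {e. t \<le> f e} \<noteq> {} \<and> X = E - {e. t \<le> f e}" if "y X \<noteq> 0" for X
    proof (cases "X = E - ?Y")
      case True
      then show ?thesis using Y \<open>m > 0\<close> False by (intro exI[of _ m]) simp
    next
      case False
      then have "x X \<noteq> 0" using that by (simp add: y_def)
      then obtain t where "t > 0" "{e. t \<le> g e} \<noteq> {}" "X = E - {e. t \<le> g e}" using x(3) by blast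
      then show ?thesis using level[of t] \<open>m > 0\<close> by (intro exI[of _ "t + m"]) simp
    qed
    ultimately show ?thesis using x(1) \<open>m > 0\<close> by (intro exI[of _ y]) (simp add: y_def)
  qed
qed

lemma superlevel_has_col:
  assumes "f \<in> weights" "t > 0" "{e. t \<le> f e} \<noteq> {}"
  shows "has_col {e. t \<le> f e}"
  using assms unfolding weights_def by blast

text \<open>The layer decomposition \<open>x\<close> of \<open>f\<close> is supported on a chain of
  non-flats, so \<open>gap_level_sum\<close> identifies it with \<open>gap f\<close>; the properties
  of \<open>x\<close> pass to the closed formula.\<close>

lemma gap_weights:
  assumes f: "f \<in> weights"
  shows "chain_weight (gap f)" "{X. gap f X \<noteq> 0} \<subseteq> nonflats" "{X. gap f X \<noteq> 0} \<noteq> {}"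
    "level_sum (gap f) = f"
proof -
  have f': "\<And>e. 0 \<le> f e" "{e. f e \<noteq> 0} \<subseteq> E" "{e. f e \<noteq> 0} \<noteq> {}" using f by (auto simp: weights_def)
  obtain x where x: "\<And>X. 0 \<le> x X" "level_sum x = f"
    "\<And>X. x X \<noteq> 0 \<Longrightarrow> \<exists>t>0. {e. t \<le> f e} \<noteq> {} \<and> X = E - {e. t \<le> f e}"
    using layer_cake[OF f'(1,2)] by blast
  have nf: "X \<in> nonflats" if "x X \<noteq> 0" for X
  proof -
    obtain t where t: "t > 0" "{e. t \<le> f e} \<noteq> {}" "X = E - {e. t \<le> f e}" using x(3)[OF \<open>x X \<noteq> 0\<close>] by blast
    have "has_col {e. t \<le> f e}" using superlevel_has_col[OF f t(1,2)] .
    moreover from this have "E - X = {e. t \<le> f e}" using t(3) by (auto simp: has_col_def)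
    ultimately show ?thesis using t(3) by (auto simp: nonflats_def)
  qed
  have cw: "chain_weight x"
    unfolding chain_weight_def
  proof (intro conjI allI impI)
    show "{X. x X \<noteq> 0} \<subseteq> Pow E" using nf nonflats_proper by blast
    fix X Z assume "x X \<noteq> 0" "x Z \<noteq> 0"
    then obtain t s where "X = E - {e. t \<le> f e}" "Z = E - {e. s \<le> f e}" using x(3) by meson
    then show "X \<subseteq> Z \<or> Z \<subseteq> X" by (cases "s \<le> t") auto
  qed (rule x(1))
  have g: "gap f = x"
    using gap_level_sum[OF cw] nonflats_proper nf x(2) by blast
  show "chain_weight (gap f)" "{X. gap f X \<noteq> 0} \<subseteq> nonflats" "level_sum (gap f) = f"
    using g cw nf x(2) by auto
  show "{X. gap f X \<noteq> 0} \<noteq> {}"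
  proof
    assume "{X. gap f X \<noteq> 0} = {}"
    then have "x = (\<lambda>_. 0)" unfolding g by auto
    then have "level_sum x e = 0" for e by (auto simp: level_sum_def intro!: sum.neutral)
    then have "f = (\<lambda>_. 0)" using x(2) by (simp add: fun_eq_iff)
    then show False using f'(3) by auto
  qed
qed

lemma polyhedron_chain_weight:
  assumes "x \<in> polyhedron (order_complex nonflats)"
  shows "chain_weight x" "{X. x X \<noteq> 0} \<subseteq> nonflats"
proof -
  have x: "\<forall>X. 0 \<le> x X" "{X. x X \<noteq> 0} \<subseteq> nonflats"
    "\<forall>X\<in>{X. x X \<noteq> 0}. \<forall>Z\<in>{X. x X \<noteq> 0}. X \<subseteq> Z \<or> Z \<subseteq> X"
    using assms by (simp_all add: polyhedron_def order_complex_def)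
  then show "{X. x X \<noteq> 0} \<subseteq> nonflats" by simp
  show "chain_weight x"
    unfolding chain_weight_def
  proof (intro conjI)
    show "{X. x X \<noteq> 0} \<subseteq> Pow E" using x(2) nonflats_proper by blast
  qed (use x in auto)
qed

lemma gap_polyhedron:
  assumes "x \<in> polyhedron (order_complex nonflats)"
  shows "gap (level_sum x) = x"
proof (rule gap_level_sum)
  show "X \<noteq> {} \<and> E - X \<noteq> {}" if "x X \<noteq> 0" for X
    using polyhedron_chain_weight(2)[OF assms] that nonflats_proper[of X] by auto
qed (rule polyhedron_chain_weight(1)[OF assms])

text \<open>A superlevel set at \<open>t\<close> is also the one at the least value attained on it,
  and that one is the complement of a member of the chain.\<close>

lemma level_sum_in_weights:
  assumes x: "x \<in> polyhedron (order_complex nonflats)"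
  shows "level_sum x \<in> weights"
proof -
  note cw = polyhedron_chain_weight[OF x]
  have nonneg: "0 \<le> level_sum x e" for e using chain_weightD(1)[OF cw(1)] by (rule level_sum_nonneg)
  have off: "{e. level_sum x e \<noteq> 0} \<subseteq> E" using level_sum_outside by auto
  have "{e. level_sum x e \<noteq> 0} \<noteq> {}"
  proof
    assume "{e. level_sum x e \<noteq> 0} = {}"
    then have "level_sum x = (\<lambda>_. 0)" by auto
    then have "gap (\<lambda>_. 0) = x" using gap_polyhedron[OF x] by simp
    moreover have "gap (\<lambda>_. 0) X = 0" for X by (auto simp: gap_def image_constant_conv)
    ultimately have "x = (\<lambda>_. 0)" by (simp add: fun_eq_iff)
    then show False using x by (simp add: polyhedron_def)
  qed
  moreover have "has_col {e. t \<le> level_sum x e}" if t: "t > 0" "{e. t \<le> level_sum x e} \<noteq> {}" for t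
  proof -
    let ?S = "{e. t \<le> level_sum x e}"
    have sub: "?S \<subseteq> E" using off t(1) by force
    then have "finite ?S" using finite_E by (rule finite_subset)
    then have "Min (level_sum x ` ?S) \<in> level_sum x ` ?S" using t(2) by (intro Min_in) auto
    then obtain e0 where e0: "e0 \<in> ?S" "level_sum x e0 = Min (level_sum x ` ?S)" by auto
    have min: "level_sum x e0 \<le> level_sum x e" if "e \<in> ?S" for e
      unfolding e0(2) using that \<open>finite ?S\<close> by (intro Min_le) auto
    have "e0 \<in> E" "0 < level_sum x e0" using e0(1) sub t(1) by auto
    then obtain X0 where X0: "x X0 \<noteq> 0" "\<forall>e\<in>E. level_sum x e0 \<le> level_sum x e \<longleftrightarrow> e \<notin> X0"
      using level_sum_superlevel[OF cw(1)] by blast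
    have "?S = E - X0"
    proof (rule set_eqI)
      fix e
      have "t \<le> level_sum x e" if "level_sum x e0 \<le> level_sum x e" using that e0(1) by simp
      then show "e \<in> ?S \<longleftrightarrow> e \<in> E - X0" using X0(2) min[of e] sub by blast
    qed
    then show ?thesis using cw(2) X0(1) by (auto simp: nonflats_def)
  qed
  ultimately show ?thesis using nonneg off by (simp add: weights_def)
qed

lemma continuous_on_gap: "continuous_on S (\<lambda>f. gap f X)"
proof (cases "X \<subseteq> E \<and> X \<noteq> {} \<and> E - X \<noteq> {}")
  case True
  then have fin: "finite X" "finite (E - X)" using finite_E finite_subset by auto
  have "continuous_on S (\<lambda>f. max 0 (Min (f ` (E - X)) - Max (f ` X)))"
    using True fin
    by (intro continuous_on_max continuous_on_diff continuous_on_Max_image continuous_on_Min_image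
        continuous_on_apply continuous_on_const) auto
  moreover have "(\<lambda>f. gap f X) = (\<lambda>f. max 0 (Min (f ` (E - X)) - Max (f ` X)))"
    using True by (simp add: gap_def)
  ultimately show ?thesis by (simp only:)
next
  case False
  then have "gap f X = 0" for f by (simp only: gap_def if_False)
  then show ?thesis by simp
qed

lemma gap_sum_pos:
  assumes "f \<in> weights"
  shows "0 < (\<Sum>X\<in>Pow E. gap f X)"
proof (rule normalize_on_support_sum_pos)
  show "{X. gap f X \<noteq> 0} \<subseteq> Pow E"
    using gap_weights(1)[OF assms] unfolding chain_weight_def by blast
qed (simp_all add: finite_E gap_nonneg gap_weights(3)[OF assms, simplified])

lemma level_sum_scale: "level_sum (\<lambda>X. x X / c) e = level_sum x e / c"
  unfolding level_sum_def sum_divide_distrib by (rule sum.cong) auto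

lemma continuous_on_level_sum: "continuous_on S level_sum"
proof (rule continuous_on_coordinatewise_then_product)
  fix e
  have "continuous_on S (\<lambda>x. if e \<in> E - X then x X else 0 :: real)" for X
    by (cases "e \<in> E - X") (simp_all only: simp_thms if_True if_False continuous_on_apply continuous_on_const)
  then show "continuous_on S (\<lambda>x. level_sum x e)"
    unfolding level_sum_def by (rule continuous_on_sum)
qed

lemma continuous_on_gap_snd:
  "continuous_on S (\<lambda>p :: 'b::topological_space \<times> ('a \<Rightarrow> real). gap (snd p) X)"
  by (rule continuous_on_compose2[OF continuous_on_gap[of UNIV X]])
    (simp_all add: continuous_on_snd continuous_on_id)

text \<open>Up to scaling the two maps are inverse to each other. On the polyhedron the composite is
  the identity; on weight functions it divides by the total of the gaps, and the scaling factor is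
  moved linearly back to 1.\<close>

lemma nonflats_homotopy_weights:
  "top_of_set (polyhedron (order_complex nonflats)) homotopy_equivalent_space top_of_set weights"
proof (rule homotopy_equivalent_canonI[where f = level_sum and g = "\<lambda>f. normalize_on (Pow E) (gap f)"])
  let ?P = "polyhedron (order_complex nonflats)"
  show "continuous_on ?P level_sum" by (rule continuous_on_level_sum)
  show "level_sum x \<in> weights" if "x \<in> ?P" for x using level_sum_in_weights[OF that] .
  show "continuous_on weights (\<lambda>f. normalize_on (Pow E) (gap f))"
  proof (rule continuous_on_normalize[OF continuous_on_gap])
    show "(\<Sum>X\<in>Pow E. gap f X) \<noteq> 0" if "f \<in> weights" for f using gap_sum_pos[OF that] by simp
  qed
  show in_P: "normalize_on (Pow E) (gap f) \<in> ?P" if "f \<in> weights" for f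
  proof (rule normalize_on_polyhedron)
    note g = gap_weights[OF that]
    show "{X. gap f X \<noteq> 0} \<in> order_complex nonflats"
      unfolding order_complex_def mem_Collect_eq
    proof (intro conjI ballI)
      show "finite {X. gap f X \<noteq> 0}" using finite_chain_support[OF g(1), of "\<lambda>_. True"] by simp
    qed (use g(2,3) chain_weightD(3)[OF g(1)] in simp_all)
    show "{X. gap f X \<noteq> 0} \<subseteq> Pow E" using g(1) unfolding chain_weight_def by blast
    show "{X. gap f X \<noteq> 0} \<noteq> {}" by (rule g(3))
  qed (simp_all add: finite_E gap_nonneg)
  have "normalize_on (Pow E) (gap (level_sum x)) = x" if "x \<in> ?P" for x
  proof -
    note cw = polyhedron_chain_weight[OF that]
    show ?thesis unfolding gap_polyhedron[OF that]
      using that cw normalize_on_id[of "Pow E" x] finite_E by (simp add: chain_weight_def)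
  qed
  then show "homotopic_with_canon (\<lambda>_. True) ?P ?P (\<lambda>x. normalize_on (Pow E) (gap (level_sum x))) id"
    by (intro homotopic_canonI[where h = "\<lambda>_ x. x"]) (auto intro: continuous_on_snd continuous_on_id)
  show "homotopic_with_canon (\<lambda>_. True) weights weights (\<lambda>f. level_sum (normalize_on (Pow E) (gap f))) id"
  proof (rule homotopic_canonI)
    let ?h = "\<lambda>(u::real) f (e::'a). ((1 - u) / (\<Sum>X\<in>Pow E. gap f X) + u) * f e"
    show "continuous_on ({0..1} \<times> weights) (\<lambda>p. ?h (fst p) (snd p))"
    proof (rule continuous_on_coordinatewise_then_product)
      fix e
      have "\<forall>p\<in>{0..1} \<times> weights. (\<Sum>X\<in>Pow E. gap (snd p) X) \<noteq> 0"
        using gap_sum_pos by (metis less_irrefl mem_Times_iff)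
      then show "continuous_on ({0..1::real} \<times> weights) (\<lambda>p. ?h (fst p) (snd p) e)"
        by (intro continuous_on_mult continuous_on_add continuous_on_divide continuous_on_sum continuous_on_diff
            continuous_on_const continuous_on_fst continuous_on_id continuous_on_snd_apply continuous_on_gap_snd)
    qed
    show "?h u f \<in> weights" if "0 \<le> u" "u \<le> 1" "f \<in> weights" for u f
    proof (rule weights_scale)
      have "0 < (\<Sum>X\<in>Pow E. gap f X)" using gap_sum_pos that by blast
      then have "0 \<le> (1 - u) / (\<Sum>X\<in>Pow E. gap f X)" "u < 1 \<longrightarrow> 0 < (1 - u) / (\<Sum>X\<in>Pow E. gap f X)"
        using that by auto
      then show "0 < (1 - u) / (\<Sum>X\<in>Pow E. gap f X) + u" using that by linarith
    qed (rule that)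
    show "?h 0 f = level_sum (normalize_on (Pow E) (gap f))" if "f \<in> weights" for f
    proof
      fix e
      show "?h 0 f e = level_sum (normalize_on (Pow E) (gap f)) e"
        unfolding normalize_on_def level_sum_scale gap_weights(4)[OF that] by simp
    qed
    show "?h 1 f = id f" for f by simp
  qed
qed

subsection \<open>Retraction onto weight functions with free support\<close>

text \<open>The value \<open>block f e\<close> is the largest \<open>t\<close> such that \<open>e\<close> lies in a subset of the superlevel set
  \<open>{f \<ge> t}\<close> of which it is not a coloop. Subtracting it retracts the weight functions onto those
  with free support, and the straight-line homotopy does not leave the space of weight functions.\<close>

definition min_on :: "('a \<Rightarrow> real) \<Rightarrow> 'a set \<Rightarrow> real" where
  "min_on f C = (if C = {} then 0 else Min (f ` C))"

definition block :: "('a \<Rightarrow> real) \<Rightarrow> 'a \<Rightarrow> real" where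
  "block f e = Max (min_on f ` insert {} {C. C \<subseteq> E \<and> e \<in> C \<and> \<not> col C e})"

lemma finite_blocking: "finite (insert {} {C. C \<subseteq> E \<and> e \<in> C \<and> \<not> col C e})"
  using finite_E by auto

text \<open>The value 0 comes from the empty set, which is put among the candidates so that
  \<open>Max\<close> is taken over a nonempty set even if nothing blocks \<open>e\<close>.\<close>

lemma block_cases: "block f e = 0 \<or> (\<exists>C\<subseteq>E. e \<in> C \<and> \<not> col C e \<and> block f e = Min (f ` C))"
proof -
  have "block f e \<in> min_on f ` insert {} {C. C \<subseteq> E \<and> e \<in> C \<and> \<not> col C e}"
    unfolding block_def by (rule Max_in) (use finite_blocking in auto)
  then show ?thesis by (auto simp: min_on_def)
qed

lemma block_ge: "C \<subseteq> E \<Longrightarrow> e \<in> C \<Longrightarrow> \<not> col C e \<Longrightarrow> Min (f ` C) \<le> block f e"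
  unfolding block_def by (rule Max_ge) (use finite_blocking in \<open>auto simp: min_on_def image_iff\<close>)

lemma block_nonneg: "0 \<le> block f e"
  unfolding block_def by (rule Max_ge) (use finite_blocking in \<open>auto simp: min_on_def\<close>)

lemma Min_image_le:
  assumes "C \<subseteq> E" "e \<in> C"
  shows "Min (f ` C) \<le> (f e :: real)"
  using assms finite_subset[OF assms(1) finite_E] by (intro Min_le) auto

lemma block_le:
  assumes "0 \<le> f e"
  shows "block f e \<le> f e"
  using block_cases[of f e] assms by (elim disjE exE conjE) (metis Min_image_le)+

lemma continuous_on_block: "continuous_on S (\<lambda>f. block f e)"
  unfolding block_def
proof (intro continuous_on_Max_image finite_blocking)
  fix C assume "C \<in> insert {} {C. C \<subseteq> E \<and> e \<in> C \<and> \<not> col C e}"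
  then have "finite C" using finite_E finite_subset by auto
  then show "continuous_on S (\<lambda>f. min_on f C)"
    unfolding min_on_def by (cases "C = {}") (simp_all add: continuous_on_Min_image continuous_on_apply)
qed simp

text \<open>A set blocking \<open>c\<close> at height \<open>a\<close> or above would lie inside the
  superlevel set, and a coloop of the larger set stays a coloop of the smaller one.\<close>

lemma col_superlevel_block:
  assumes "0 < a" "col {e. a \<le> f e} c" "{e. a \<le> f e} \<subseteq> E"
  shows "block f c < a"
proof (rule ccontr)
  assume "\<not> ?thesis"
  then obtain C where C: "C \<subseteq> E" "c \<in> C" "\<not> col C c" "a \<le> Min (f ` C)"
    using block_cases[of f c] assms(1) by auto
  then have "C \<subseteq> {e. a \<le> f e}" using Min_image_le[of C _ f] by fastforce
  then show False using col_mono[OF assms(2)] C by blast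
qed

text \<open>Suppose a superlevel set \<open>Z\<close> of the lowered function has no coloop, and let
  \<open>e\<close> minimise \<open>f\<close> on \<open>Z\<close>. Then \<open>Z\<close> itself
  blocks \<open>e\<close> up to \<open>f e\<close>, so the lowered value at \<open>e\<close> is
  \<open>(1 - u) * f e\<close>. A coloop \<open>c\<close> of the superlevel set of \<open>f\<close>
  at \<open>f e\<close> keeps at least this much, so \<open>c\<close> belongs to \<open>Z\<close>
  and is a coloop of it.\<close>

lemma weights_minus_block:
  assumes f: "f \<in> weights" and u: "0 \<le> u" "u \<le> 1"
  shows "(\<lambda>e. f e - u * block f e) \<in> weights" (is "?g \<in> _")
proof -
  have f': "\<And>e. 0 \<le> f e" "{e. f e \<noteq> 0} \<subseteq> E" "{e. f e \<noteq> 0} \<noteq> {}" using f by (auto simp: weights_def)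
  have ub: "0 \<le> u * block f e" "u * block f e \<le> block f e" "block f e \<le> f e" for e
    using u block_nonneg[of f e] block_le[OF f'(1)] by (auto simp: mult_left_le_one_le)
  have g: "0 \<le> ?g e" "?g e \<le> f e" for e using ub[of e] by auto
  have gE: "{e. ?g e \<noteq> 0} \<subseteq> E"
  proof
    fix e assume "e \<in> {e. ?g e \<noteq> 0}"
    then have "f e \<noteq> 0" using g[of e] by auto
    then show "e \<in> E" using f'(2) by auto
  qed
  have supE: "{e. a \<le> f e} \<subseteq> E" if "a > 0" for a using f'(2) that by force
  \<comment> \<open>A coloop of \<open>{f \<ge> a}\<close> is blocked only below \<open>a\<close>,
    so it loses at most \<open>u * a\<close> and never its whole value.\<close>
  have col_above: "\<exists>c. col {e. a \<le> f e} c \<and> a - u * a \<le> ?g c \<and> 0 < ?g c" if a: "a > 0" "f e = a" for a e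
  proof -
    have "{e. a \<le> f e} \<noteq> {}" using a(2) by auto
    then obtain c where c: "col {e. a \<le> f e} c"
      using superlevel_has_col[OF f a(1)] by (auto simp: has_col_def)
    then have b: "block f c < a" using col_superlevel_block[OF a(1)] supE[OF a(1)] by blast
    have "a \<le> f c" using col_mem[OF c] by simp
    moreover have "u * block f c \<le> u * a" using b u by (intro mult_left_mono) auto
    moreover have "u * block f c < a" using b ub(2)[of c] by linarith
    ultimately show ?thesis using c by (intro exI[of _ c]) auto
  qed
  obtain e1 where "f e1 \<noteq> 0" using f'(3) by auto
  then have "f e1 > 0" using f'(1)[of e1] by auto
  then obtain c where "0 < ?g c" using col_above[of "f e1" e1] by blast
  then have ne: "{e. ?g e \<noteq> 0} \<noteq> {}" by force
  have "has_col {e. t \<le> ?g e}" if t: "t > 0" "{e. t \<le> ?g e} \<noteq> {}" for t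
  proof (rule ccontr)
    assume no: "\<not> ?thesis"
    let ?Z = "{e. t \<le> ?g e}"
    have ZE: "?Z \<subseteq> E" using gE t(1) by force
    then have "finite ?Z" using finite_E by (rule finite_subset)
    then have "Min (f ` ?Z) \<in> f ` ?Z" using t(2) by (intro Min_in) auto
    then obtain e where e: "e \<in> ?Z" "f e = Min (f ` ?Z)" by auto
    have "\<not> col ?Z e" using no ZE by (auto simp: has_col_def)
    then have "f e \<le> block f e" using block_ge[OF ZE e(1)] e(2) by simp
    then have be: "block f e = f e" using ub(3)[of e] by simp
    have te: "t \<le> f e - u * f e" using e(1) be by simp
    have "f e > 0" using e(1) g(2)[of e] t(1) by simp
    then obtain c where c: "col {e'. f e \<le> f e'} c" "f e - u * f e \<le> ?g c"
      using col_above[of "f e" e] by blast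
    have "?Z \<subseteq> {e'. f e \<le> f e'}"
    proof
      fix e' assume "e' \<in> ?Z"
      then have "Min (f ` ?Z) \<le> f e'" using \<open>finite ?Z\<close> by (intro Min_le) auto
      then show "e' \<in> {e'. f e \<le> f e'}" using e(2) by simp
    qed
    moreover have "c \<in> ?Z" using c(2) te by simp
    ultimately have "col ?Z c" using col_mono[OF c(1)] by blast
    then show False using no ZE by (auto simp: has_col_def)
  qed
  then show ?thesis using g gE ne by (simp add: weights_def)
qed

text \<open>If \<open>e\<close> minimises \<open>f\<close> on a subset \<open>C\<close> of the new
  support and were not a coloop of \<open>C\<close>, then \<open>C\<close> would block
  \<open>e\<close> up to \<open>f e\<close> and remove it from the support.\<close>

lemma free_support_minus_block:
  assumes f: "f \<in> weights"
  shows "free {e. f e - block f e \<noteq> 0}"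
proof -
  have w: "(\<lambda>e. f e - block f e) \<in> weights" using weights_minus_block[OF f, of 1] by simp
  have "has_col C" if C: "C \<subseteq> {e. f e - block f e \<noteq> 0}" "C \<noteq> {}" for C
  proof -
    have CE: "C \<subseteq> E" using C w by (auto simp: weights_def)
    then have "finite C" using finite_E by (rule finite_subset)
    then have "Min (f ` C) \<in> f ` C" using C by (intro Min_in) auto
    then obtain e where e: "e \<in> C" "f e = Min (f ` C)" by auto
    have "0 \<le> f e" using f by (auto simp: weights_def)
    then have "block f e < f e" using block_le[of f e] C e(1) by fastforce
    then have "col C e" using block_ge[OF CE e(1), of f] e(2) by linarith
    then show ?thesis using CE by (auto simp: has_col_def)
  qed
  then show ?thesis using w by (auto simp: free_def weights_def)
qed

text \<open>Functions with free support are fixed by the lowering: a set blocking \<open>e\<close>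
  above 0 lies in the support, where \<open>e\<close> is a coloop by \<open>col_free\<close>. On all
  weight functions the straight line, followed by a rescaling, joins the identity to the normalised
  retraction.\<close>

lemma weights_homotopy_free:
  assumes col_free: "\<And>S c. free S \<Longrightarrow> c \<in> S \<Longrightarrow> col S c"
  shows "top_of_set weights homotopy_equivalent_space top_of_set (polyhedron {S. free S})"
proof (rule homotopy_equivalent_canonI[where g = "\<lambda>x. x" and f = "\<lambda>f. normalize_on E (\<lambda>e. f e - block f e)"])
  let ?P = "polyhedron {S. free S}" and ?r = "\<lambda>f e. f e - block f e"
  have r: "?r f \<in> weights" if "f \<in> weights" for f
    using weights_minus_block[OF that, of 1] by simp
  have cont_r: "continuous_on S (\<lambda>f. ?r f e)" for S e
    by (intro continuous_on_diff continuous_on_apply continuous_on_block)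
  show "continuous_on weights (\<lambda>f. normalize_on E (?r f))"
  proof (rule continuous_on_normalize[OF cont_r])
    show "(\<Sum>e\<in>E. ?r f e) \<noteq> 0" if "f \<in> weights" for f using weights_sum_pos[OF r[OF that]] by simp
  qed
  show rP: "normalize_on E (?r f) \<in> ?P" if "f \<in> weights" for f
    using r[OF that] free_support_minus_block[OF that] finite_E
    by (intro normalize_on_polyhedron) (auto simp: weights_def)
  have freeE: "S \<subseteq> E" if "free S" for S using that by (auto simp: free_def has_col_def)
  show P_weights: "x \<in> weights" if "x \<in> ?P" for x
  proof -
    have x: "\<forall>e. 0 \<le> x e" "free {e. x e \<noteq> 0}" using that by (auto simp: polyhedron_def)
    have "has_col {e. t \<le> x e}" if "t > 0" "{e. t \<le> x e} \<noteq> {}" for t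
    proof -
      have "{e. t \<le> x e} \<subseteq> {e. x e \<noteq> 0}" using that by auto
      then show ?thesis using x(2) that by (auto simp: free_def)
    qed
    then show ?thesis using x freeE[OF x(2)] by (auto simp: weights_def free_def)
  qed
  have "normalize_on E (?r x) = x" if "x \<in> ?P" for x
  proof -
    have x: "\<And>e. 0 \<le> x e" "free {e. x e \<noteq> 0}" using that by (auto simp: polyhedron_def)
    have "block x e = 0" for e
    proof (rule ccontr)
      assume *: "block x e \<noteq> 0"
      then obtain C where C: "C \<subseteq> E" "e \<in> C" "\<not> col C e" "block x e = Min (x ` C)" using block_cases by blast
      have "0 < Min (x ` C)" using * block_nonneg[of x e] C(4) by simp
      then have sub: "C \<subseteq> {e. x e \<noteq> 0}" using Min_image_le[OF C(1), of _ x] by fastforce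
      then have "col {e. x e \<noteq> 0} e" using col_free[OF x(2)] C(2) by blast
      then show False using col_mono sub C by blast
    qed
    then show ?thesis using that normalize_on_id[of E x] finite_E freeE[OF x(2)] by simp
  qed
  then show "homotopic_with_canon (\<lambda>_. True) ?P ?P (\<lambda>x. normalize_on E (?r x)) id"
    by (intro homotopic_canonI[where h = "\<lambda>_ x. x"]) (auto intro: continuous_on_snd continuous_on_id)
  have cont_r2: "continuous_on S (\<lambda>p :: real \<times> ('a \<Rightarrow> real). block (snd p) e)" for S e
    by (rule continuous_on_compose2[OF continuous_on_block[of UNIV e]])
      (simp_all add: continuous_on_snd continuous_on_id)
  have "homotopic_with_canon (\<lambda>_. True) weights weights id ?r"
  proof (rule homotopic_canonI[where h = "\<lambda>u f e. f e - u * block f e"])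
    show "continuous_on ({0..1} \<times> weights) (\<lambda>p e. snd p e - fst p * block (snd p) e)"
      by (rule continuous_on_coordinatewise_then_product)
        (intro continuous_on_diff continuous_on_mult continuous_on_snd_apply cont_r2 continuous_on_fst continuous_on_id)
  qed (auto intro: weights_minus_block)
  moreover have "homotopic_with_canon (\<lambda>_. True) weights weights ?r (\<lambda>f. normalize_on E (?r f))"
  proof (rule homotopic_canonI)
    let ?h = "\<lambda>(u::real) f (e::'a). ((1 - u) + u / (\<Sum>e\<in>E. ?r f e)) * ?r f e"
    show "continuous_on ({0..1} \<times> weights) (\<lambda>p. ?h (fst p) (snd p))"
    proof (rule continuous_on_coordinatewise_then_product)
      fix e
      have "\<forall>p\<in>{0..1} \<times> weights. (\<Sum>e\<in>E. ?r (snd p) e) \<noteq> 0"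
        using weights_sum_pos[OF r] by (metis less_irrefl mem_Times_iff)
      then show "continuous_on ({0..1::real} \<times> weights) (\<lambda>p. ?h (fst p) (snd p) e)"
        by (intro continuous_on_mult continuous_on_add continuous_on_divide continuous_on_sum continuous_on_diff
            continuous_on_const continuous_on_fst continuous_on_id continuous_on_snd_apply cont_r2)
    qed
    show "?h u f \<in> weights" if "0 \<le> u" "u \<le> 1" "f \<in> weights" for u f
    proof (rule weights_scale[OF r[OF that(3)]])
      have "0 < (\<Sum>e\<in>E. ?r f e)" using weights_sum_pos[OF r[OF that(3)]] .
      then have "0 \<le> u / (\<Sum>e\<in>E. ?r f e)" "0 < u \<longrightarrow> 0 < u / (\<Sum>e\<in>E. ?r f e)" using that by auto
      then show "0 < (1 - u) + u / (\<Sum>e\<in>E. ?r f e)" using that by linarith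
    qed
  qed (simp_all add: normalize_on_def)
  ultimately show "homotopic_with_canon (\<lambda>_. True) weights weights (\<lambda>f. normalize_on E (?r f)) id"
    by (rule homotopic_with_symD[OF homotopic_with_trans])
qed (rule continuous_on_id)

end

section \<open>Wedges\<close>

text \<open>The wedge realised in a product, as the union of the coordinate axes through the base
  point; continuity of maps into it is coordinatewise.\<close>

definition wedge_model :: "nat \<Rightarrow> 'b set \<Rightarrow> 'b \<Rightarrow> (nat \<Rightarrow> 'b) set" where
  "wedge_model k S b = {y. (\<forall>j. y j \<in> S) \<and> (\<forall>j. k \<le> j \<longrightarrow> y j = b) \<and>
     (\<forall>i j. y i \<noteq> b \<longrightarrow> y j \<noteq> b \<longrightarrow> i = j)}"

text \<open>The map out of the wedge given by \<open>f j\<close> on the axis \<open>j\<close>, with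
  \<open>p\<close> as common value at the base point. On the model at most one coordinate can be
  chosen by \<open>SOME\<close>.\<close>

definition wedge_lift :: "'b \<Rightarrow> 'c \<Rightarrow> (nat \<Rightarrow> 'b \<Rightarrow> 'c) \<Rightarrow> (nat \<Rightarrow> 'b) \<Rightarrow> 'c" where
  "wedge_lift b p f y = (if \<forall>j. y j = b then p else let j = SOME j. y j \<noteq> b in f j (y j))"

lemma wedge_lift_base: "wedge_lift b p f (\<lambda>_. b) = p"
  by (simp add: wedge_lift_def)

lemma wedge_model_less:
  assumes "y \<in> wedge_model k S b" "y j \<noteq> b"
  shows "j < k"
  using assms by (intro ccontr[of "j < k"]) (simp add: wedge_model_def not_less)

lemma wedge_model_unique:
  assumes "y \<in> wedge_model k S b" "y j \<noteq> b" "i \<noteq> j"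
  shows "y i = b"
  using assms unfolding wedge_model_def by blast

lemma wedge_lift_eq:
  assumes "y \<in> wedge_model k S b" "y j \<noteq> b"
  shows "wedge_lift b p f y = f j (y j)"
proof -
  have "(SOME i. y i \<noteq> b) = j"
    using assms by (intro some_equality) (auto simp: wedge_model_def)
  then show ?thesis using assms(2) by (auto simp: wedge_lift_def Let_def)
qed

text \<open>Pasting over the finitely many axes, which are closed because points are closed.\<close>

lemma continuous_map_wedge_lift:
  fixes S :: "'b::t1_space set"
  assumes "1 \<le> k" and f: "\<And>j. j < k \<Longrightarrow> continuous_map (top_of_set S) Y (f j)"
    and base: "\<And>j. j < k \<Longrightarrow> f j b = p"
  shows "continuous_map (top_of_set (wedge_model k S b)) Y (wedge_lift b p f)"
proof (rule pasting_lemma_closed[where I = "{..<k}" and f = "\<lambda>j y. f j (y j)"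
      and T = "\<lambda>j. {y \<in> wedge_model k S b. \<forall>i. i \<noteq> j \<longrightarrow> y i = b}"])
  fix j assume j: "j \<in> {..<k}"
  let ?M = "wedge_model k S b" and ?T = "{y \<in> wedge_model k S b. \<forall>i. i \<noteq> j \<longrightarrow> y i = b}"
  have "closed (\<Inter>i\<in>- {j}. (\<lambda>y::nat \<Rightarrow> 'b. y i) -` {b})"
    by (intro closed_INT ballI closed_vimage closed_singleton continuous_on_apply)
  moreover have "?T = ?M \<inter> (\<Inter>i\<in>- {j}. (\<lambda>y::nat \<Rightarrow> 'b. y i) -` {b})" by auto
  ultimately show "closedin (top_of_set ?M) ?T" by (simp add: closedin_closed_Int)
  have "continuous_map (top_of_set ?T) (top_of_set S) (\<lambda>y. y j)"
    by (auto simp: continuous_map_in_subtopology continuous_on_apply wedge_model_def)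
  then have "continuous_map (top_of_set ?T) Y (f j \<circ> (\<lambda>y. y j))"
    using f j by (intro continuous_map_compose) auto
  moreover have "subtopology (top_of_set ?M) ?T = top_of_set ?T"
    by (auto simp: subtopology_subtopology intro: arg_cong[of _ _ top_of_set])
  ultimately show "continuous_map (subtopology (top_of_set ?M) ?T) Y (\<lambda>y. f j (y j))"
    by (simp add: o_def)
next
  fix i j y
  assume "i \<in> {..<k}" "j \<in> {..<k}" and y: "y \<in> topspace (top_of_set (wedge_model k S b)) \<inter>
    {y \<in> wedge_model k S b. \<forall>l. l \<noteq> i \<longrightarrow> y l = b} \<inter> {y \<in> wedge_model k S b. \<forall>l. l \<noteq> j \<longrightarrow> y l = b}"
  then show "f i (y i) = f j (y j)" using base by (cases "i = j") auto
next
  fix y assume "y \<in> topspace (top_of_set (wedge_model k S b))"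
  then have y: "y \<in> wedge_model k S b" by simp
  show "\<exists>j. j \<in> {..<k} \<and> y \<in> {y \<in> wedge_model k S b. \<forall>i. i \<noteq> j \<longrightarrow> y i = b} \<and> wedge_lift b p f y = f j (y j)"
  proof (cases "\<forall>j. y j = b")
    case True
    then have "y = (\<lambda>_. b)" by auto
    \<comment> \<open>The base point is assigned to axis 0, which exists since
      \<open>1 \<le> k\<close>.\<close>
    then show ?thesis using y base[of 0] \<open>1 \<le> k\<close> by (intro exI[of _ 0]) (auto simp: wedge_lift_base)
  next
    case False
    then obtain j where j: "y j \<noteq> b" by auto
    then have "j < k" using wedge_model_less[OF y] by blast
    moreover have "\<forall>i. i \<noteq> j \<longrightarrow> y i = b" using wedge_model_unique[OF y j] by blast
    ultimately show ?thesis using y wedge_lift_eq[where f = f, OF y j] by auto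
  qed
qed simp

lemma continuous_map_from_sum_topology:
  assumes f: "\<And>i. i \<in> I \<Longrightarrow> continuous_map (X i) Y (\<lambda>x. f (i, x))"
  shows "continuous_map (sum_topology X I) Y f"
  unfolding continuous_map_def
proof (intro conjI allI impI)
  show "f \<in> topspace (sum_topology X I) \<rightarrow> topspace Y"
    using continuous_map_funspace[OF f] by fastforce
  fix U assume U: "openin Y U"
  have "openin (X i) {x \<in> topspace (X i). f (i, x) \<in> U}" if "i \<in> I" for i
    using f[OF that] U by (auto simp: continuous_map_def)
  moreover have "{x. (i, x) \<in> {x \<in> topspace (sum_topology X I). f x \<in> U}} =
      {x \<in> topspace (X i). f (i, x) \<in> U}" if "i \<in> I" for i
    using that by auto
  ultimately show "openin (sum_topology X I) {x \<in> topspace (sum_topology X I). f x \<in> U}"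
    unfolding openin_sum_topology by auto
qed

text \<open>The map to the model is continuous by the universal property of the quotient, its
  inverse by pasting over the axes.\<close>

lemma wedge_sum_homeomorphic_model:
  fixes S :: "'b::t1_space set"
  assumes "1 \<le> k" "b \<in> S"
  shows "wedge_sum {..<k} (\<lambda>_. top_of_set S) (\<lambda>_. b) homeomorphic_space top_of_set (wedge_model k S b)"
proof -
  let ?Z = "sum_topology (\<lambda>_. top_of_set S) {..<k}"
  let ?M = "wedge_model k S b"
  let ?p = "\<lambda>(i, x). if x = b then None else Some (i :: nat, x)"
  let ?W = "wedge_sum {..<k} (\<lambda>_. top_of_set S) (\<lambda>_. b)"
  define \<phi> where "\<phi> w = (case w of None \<Rightarrow> (\<lambda>_. b) | Some (i, x) \<Rightarrow> (\<lambda>j. if j = i then x else b))"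
    for w :: "(nat \<times> 'b) option"
  have quot: "quotient_map ?Z ?W ?p"
    using quotient_map_quotient_topology[of ?Z ?p] by (simp add: wedge_sum_def)
  have \<phi>p: "(\<phi> \<circ> ?p) (i, x) = (\<lambda>j. if j = i then x else b)" for i x
    by (auto simp: \<phi>_def)
  have inM: "(\<lambda>j. if j = i then x else b) \<in> ?M" if "i < k" "x \<in> S" for i x
    using that assms by (auto simp: wedge_model_def)
  have "continuous_map ?Z (top_of_set ?M) (\<phi> \<circ> ?p)"
  proof (rule continuous_map_from_sum_topology)
    show "continuous_map (top_of_set S) (top_of_set ?M) (\<lambda>x. (\<phi> \<circ> ?p) (i, x))" if "i \<in> {..<k}" for i
    proof -
      have "continuous_on S (\<lambda>x j. if j = i then x else b)"
      proof (rule continuous_on_coordinatewise_then_product)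
        fix j show "continuous_on S (\<lambda>x. if j = i then x else b)"
          by (cases "j = i") (simp_all add: continuous_on_id)
      qed
      then show ?thesis using inM that unfolding \<phi>p by (auto simp: continuous_map_in_subtopology)
    qed
  qed
  then have 1: "continuous_map ?W (top_of_set ?M) \<phi>"
    by (rule continuous_compose_quotient_map[OF quot])
  let ?\<psi> = "wedge_lift b None (\<lambda>j x. ?p (j, x))"
  have 2: "continuous_map (top_of_set ?M) ?W ?\<psi>"
  proof (rule continuous_map_wedge_lift[OF assms(1)])
    fix j assume "j < k"
    then have "continuous_map (top_of_set S) ?Z (\<lambda>x. (j, x))"
      using continuous_map_component_injection[of j "{..<k}" "\<lambda>_. top_of_set S"] by simp
    then have "continuous_map (top_of_set S) ?W (?p \<circ> (\<lambda>x. (j, x)))"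
      using quotient_imp_continuous_map[OF quot] by (rule continuous_map_compose)
    then show "continuous_map (top_of_set S) ?W (\<lambda>x. ?p (j, x))" by (simp add: o_def)
  qed simp
  have 3: "?\<psi> (\<phi> w) = w" if w: "w \<in> topspace ?W" for w
  proof -
    obtain i x where ix: "i < k" "x \<in> S" "w = ?p (i, x)"
    proof -
      have "w \<in> ?p ` ({..<k} \<times> S)"
        using w by (simp add: wedge_sum_def topspace_quotient_topology o_def)
      then obtain s where "s \<in> {..<k} \<times> S" "w = ?p s" by (rule imageE)
      then show thesis using that[of "fst s" "snd s"] by (cases s) simp
    qed
    show ?thesis
    proof (cases "x = b")
      case True
      then show ?thesis using ix by (simp add: \<phi>_def wedge_lift_base)
    next
      case False
      then have "\<phi> w = (\<lambda>j. if j = i then x else b)" using ix by (simp add: \<phi>_def)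
      moreover have "?\<psi> (\<lambda>j. if j = i then x else b) = ?p (i, x)"
        using wedge_lift_eq[OF inM[OF ix(1,2)], of i None "\<lambda>j x. ?p (j, x)"] False by simp
      ultimately show ?thesis using ix by simp
    qed
  qed
  have 4: "\<phi> (?\<psi> y) = y" if "y \<in> ?M" for y
  proof (cases "\<forall>j. y j = b")
    case True
    then have "y = (\<lambda>_. b)" by auto
    then show ?thesis by (simp add: wedge_lift_base \<phi>_def)
  next
    case False
    then obtain j where j: "y j \<noteq> b" by auto
    then have "?\<psi> y = Some (j, y j)"
      using wedge_lift_eq[OF that j, of None "\<lambda>j x. ?p (j, x)"] by simp
    then have "\<phi> (?\<psi> y) = (\<lambda>i. if i = j then y j else b)" by (simp add: \<phi>_def)
    also have "\<dots> = y"
    proof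
      fix i show "(if i = j then y j else b) = y i"
        using wedge_model_unique[OF that j, of i] by (cases "i = j") simp_all
    qed
    finally show ?thesis .
  qed
  show ?thesis
    unfolding homeomorphic_space_def homeomorphic_maps_def
    using 1 2 3 4 by (intro exI[of _ \<phi>] exI[of _ ?\<psi>]) simp
qed

text \<open>\<open>q j\<close> collapses everything outside the cell \<open>j\<close> and
  \<open>g j\<close> maps the sphere back. The composite on \<open>X\<close> is \<open>G\<close>.
  The composite on the wedge is \<open>q j\<close> after \<open>g j\<close> on each axis, since by
  \<open>qg\<close> the image of one sphere is invisible to the other collapses; the homotopies
  \<open>h j\<close> fit together because they fix the base point.\<close>

lemma homotopy_equivalent_wedge_model:
  fixes X :: "'a::topological_space set" and S :: "'b::t1_space set"
  assumes k: "1 \<le> k" and b: "b \<in> S"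
    and q: "\<And>j. j < k \<Longrightarrow> continuous_on X (q j)" "\<And>j x. j < k \<Longrightarrow> x \<in> X \<Longrightarrow> q j x \<in> S"
    and q_unique: "\<And>i j x. i < k \<Longrightarrow> j < k \<Longrightarrow> x \<in> X \<Longrightarrow> q i x \<noteq> b \<Longrightarrow> q j x \<noteq> b \<Longrightarrow> i = j"
    and g: "\<And>j. j < k \<Longrightarrow> continuous_on S (g j)" "\<And>j z. j < k \<Longrightarrow> z \<in> S \<Longrightarrow> g j z \<in> X"
    and g_base: "\<And>j. j < k \<Longrightarrow> g j b = p"
    and qg: "\<And>i j z. i < k \<Longrightarrow> j < k \<Longrightarrow> i \<noteq> j \<Longrightarrow> z \<in> S \<Longrightarrow> q i (g j z) = b"
    and G: "homotopic_with_canon (\<lambda>_. True) X X id G"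
    and G_base: "\<And>x. x \<in> X \<Longrightarrow> (\<And>j. j < k \<Longrightarrow> q j x = b) \<Longrightarrow> G x = p"
    and G_cell: "\<And>x j. x \<in> X \<Longrightarrow> j < k \<Longrightarrow> q j x \<noteq> b \<Longrightarrow> G x = g j (q j x)"
    and h: "\<And>j. j < k \<Longrightarrow> continuous_on ({0..1} \<times> S) (\<lambda>s. h j (fst s) (snd s))"
      "\<And>j u z. j < k \<Longrightarrow> 0 \<le> u \<Longrightarrow> u \<le> 1 \<Longrightarrow> z \<in> S \<Longrightarrow> h j u z \<in> S"
      "\<And>j z. j < k \<Longrightarrow> z \<in> S \<Longrightarrow> h j 0 z = q j (g j z)" "\<And>j z. j < k \<Longrightarrow> z \<in> S \<Longrightarrow> h j 1 z = z"
      "\<And>j u. j < k \<Longrightarrow> 0 \<le> u \<Longrightarrow> u \<le> (1::real) \<Longrightarrow> h j u b = b"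
  shows "top_of_set X homotopy_equivalent_space top_of_set (wedge_model k S b)"
proof -
  let ?M = "wedge_model k S b"
  let ?Q = "\<lambda>x j. if j < k then q j x else b"
  let ?\<Gamma> = "wedge_lift b p g"
  have lt: "j < k" if "y \<in> ?M" "y j \<noteq> b" for y j
    using wedge_model_less[OF that] .
  have QM: "?Q x \<in> ?M" if "x \<in> X" for x
    unfolding wedge_model_def using q(2) q_unique b that by (auto split: if_splits)
  have \<Gamma>Q: "?\<Gamma> (?Q x) = G x" if x: "x \<in> X" for x
  proof (cases "\<forall>j<k. q j x = b")
    case True
    then have "?Q x = (\<lambda>_. b)" by auto
    then show ?thesis using G_base[OF x] True by (simp add: wedge_lift_base)
  next
    case False
    then obtain j where "j < k" "q j x \<noteq> b" by auto
    then show ?thesis using wedge_lift_eq[OF QM[OF x], of j p g] G_cell[OF x] by simp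
  qed
  have Q\<Gamma>: "?Q (?\<Gamma> y) j = (if j < k then h j 0 (y j) else b)" if y: "y \<in> ?M" for y j
  proof (cases "\<forall>j. y j = b")
    case True
    then have "y = (\<lambda>_. b)" by auto
    then show ?thesis using h(3)[of j b] b g_base by (simp add: wedge_lift_base)
  next
    case False
    then obtain i where i: "y i \<noteq> b" by auto
    have \<Gamma>: "?\<Gamma> y = g i (y i)" using wedge_lift_eq[OF y i] .
    have S: "y i \<in> S" using y by (auto simp: wedge_model_def)
    show ?thesis
    proof (cases "j = i")
      case False
      then have "y j = b" by (rule wedge_model_unique[OF y i])
      moreover have "h j 0 b = b" if "j < k" using that h(5)[of j 0] by simp
      ultimately show ?thesis unfolding \<Gamma> using qg[OF _ lt[OF y i] False S] by simp
    qed (use S h(3) \<Gamma> in simp)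
  qed
  show ?thesis
  proof (rule homotopy_equivalent_canonI[where f = ?Q and g = ?\<Gamma>])
    show "?Q x \<in> ?M" if "x \<in> X" for x using QM[OF that] .
    show "continuous_on X ?Q"
    proof (rule continuous_on_coordinatewise_then_product)
      fix j show "continuous_on X (\<lambda>x. ?Q x j)" using q(1) by (cases "j < k") simp_all
    qed
    have "continuous_map (top_of_set ?M) (top_of_set X) ?\<Gamma>"
      using g g_base by (intro continuous_map_wedge_lift[OF k]) (auto simp: continuous_map_in_subtopology)
    then show "continuous_on ?M ?\<Gamma>" "y \<in> ?M \<Longrightarrow> ?\<Gamma> y \<in> X" for y
      by (auto simp: continuous_map_in_subtopology)
    show "homotopic_with_canon (\<lambda>_. True) X X (\<lambda>x. ?\<Gamma> (?Q x)) id"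
      using \<Gamma>Q by (intro homotopic_with_eq[OF homotopic_with_symD[OF G]]) auto
    show "homotopic_with_canon (\<lambda>_. True) ?M ?M (\<lambda>y. ?Q (?\<Gamma> y)) id"
    proof (rule homotopic_canonI[where h = "\<lambda>u y j. if j < k then h j u (y j) else b"])
      show "continuous_on ({0..1} \<times> ?M) (\<lambda>s j. if j < k then h j (fst s) (snd s j) else b)"
      proof (rule continuous_on_coordinatewise_then_product)
        fix j
        show "continuous_on ({0..1} \<times> ?M) (\<lambda>s. if j < k then h j (fst s) (snd s j) else b)"
        proof (cases "j < k")
          case True
          have "continuous_on ({0..1} \<times> ?M) (\<lambda>s. h j (fst (fst s, snd s j)) (snd (fst s, snd s j)))"
            by (rule continuous_on_compose2[OF h(1)[OF True]])
              (auto intro!: continuous_on_Pair continuous_on_fst continuous_on_id continuous_on_snd_apply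
                simp: wedge_model_def)
          then show ?thesis using True by simp
        qed simp
      qed
    next
      fix u :: real and y assume u: "0 \<le> u" "u \<le> 1" and y: "y \<in> ?M"
      \<comment> \<open>Since the base point is fixed throughout, no further coordinate leaves it
        and the homotopy stays in the wedge.\<close>
      have "y j \<noteq> b" if "j < k" "h j u (y j) \<noteq> b" for j using that h(5) u by metis
      then show "(\<lambda>j. if j < k then h j u (y j) else b) \<in> ?M"
        using y u b h(2) unfolding wedge_model_def by (auto split: if_splits)
    next
      fix y assume y: "y \<in> ?M"
      show "(\<lambda>j. if j < k then h j 0 (y j) else b) = ?Q (?\<Gamma> y)" using Q\<Gamma>[OF y] by auto
      show "(\<lambda>j. if j < k then h j 1 (y j) else b) = id y"
        using y h(4) lt[OF y] by (fastforce simp: wedge_model_def)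
    qed
  qed
qed

section \<open>Spheres in coordinates, with coordinate 0 as polar axis\<close>

definition sphere_set :: "nat \<Rightarrow> (nat \<Rightarrow> real) set" where
  "sphere_set d = {z. (\<Sum>i\<le>d. (z i)\<^sup>2) = 1 \<and> (\<forall>i>d. z i = 0)}"

lemma sphere_space_eq: "sphere_space (int d) = top_of_set (sphere_set d)"
  by (simp add: sphere_space_def nsphere sphere_set_def euclidean_product_topology)

lemma sphere_base_mem: "sphere_base \<in> sphere_set d"
  using sphere_base_in_sphere[of "int d"] by (simp add: sphere_space_eq)

lemma sphere_set_sum:
  assumes "z \<in> sphere_set d"
  shows "(\<Sum>i\<in>{1..d}. (z i)\<^sup>2) = 1 - (z 0)\<^sup>2"
proof -
  have "{..d} = insert 0 {1..d}" by auto
  then show ?thesis using assms by (simp add: sphere_set_def)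
qed

lemma sphere_set_pole:
  assumes "z \<in> sphere_set d" "(z 0)\<^sup>2 = 1" "i \<noteq> 0"
  shows "z i = 0"
proof (cases "i \<le> d")
  case True
  have "(\<Sum>i\<in>{1..d}. (z i)\<^sup>2) = 0" using sphere_set_sum[OF assms(1)] assms(2) by simp
  then have "\<forall>i\<in>{1..d}. (z i)\<^sup>2 = 0" by (subst (asm) sum_nonneg_eq_0_iff) auto
  then show ?thesis using True assms(3) by auto
qed (use assms in \<open>auto simp: sphere_set_def\<close>)

lemma sphere_base_iff: "z \<in> sphere_set d \<Longrightarrow> z = sphere_base \<longleftrightarrow> z 0 = 1"
  using sphere_set_pole[of z d] by (auto simp: sphere_base_def fun_eq_iff)

text \<open>Such a map never sends a point to its antipode, so the straight line normalises to a homotopy.\<close>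

lemma sphere_map_homotopic_id:
  assumes cont: "continuous_on (sphere_set d) \<kappa>" and \<kappa>: "\<And>z. z \<in> sphere_set d \<Longrightarrow> \<kappa> z \<in> sphere_set d"
    and ray: "\<And>z. z \<in> sphere_set d \<Longrightarrow> \<exists>c\<ge>0. \<forall>i\<ge>1. \<kappa> z i = c * z i"
    and base: "\<kappa> sphere_base = sphere_base"
    and pole: "\<And>z. z \<in> sphere_set d \<Longrightarrow> z 0 = -1 \<Longrightarrow> \<kappa> z = z"
  shows "\<exists>h. continuous_on ({0..1} \<times> sphere_set d) (\<lambda>s. h (fst s) (snd s)) \<and>
    (\<forall>u z. 0 \<le> u \<longrightarrow> u \<le> 1 \<longrightarrow> z \<in> sphere_set d \<longrightarrow> h u z \<in> sphere_set d) \<and>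
    (\<forall>z\<in>sphere_set d. h 0 z = \<kappa> z \<and> h 1 z = z) \<and>
    (\<forall>u. 0 \<le> u \<longrightarrow> u \<le> (1::real) \<longrightarrow> h u sphere_base = sphere_base)"
proof -
  let ?S = "sphere_set d"
  define l where "l u z i = (1 - u) * \<kappa> z i + u * z i" for u :: real and z and i :: nat
  define n where "n u z = (\<Sum>i\<le>d. (l u z i)\<^sup>2)" for u z
  define h where "h u z i = l u z i / sqrt (n u z)" for u z i
  have n_pos: "n u z > 0" if z: "z \<in> ?S" and u: "0 \<le> u" "u \<le> 1" for u z
  proof (rule ccontr)
    assume "\<not> n u z > 0"
    moreover have "n u z \<ge> 0" unfolding n_def by (rule sum_nonneg) simp
    ultimately have "n u z = 0" by simp
    then have "\<forall>i\<in>{..d}. (l u z i)\<^sup>2 = 0" unfolding n_def by (subst (asm) sum_nonneg_eq_0_iff) auto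
    then have l0: "l u z i = 0" if "i \<le> d" for i using that by auto
    obtain c where c: "c \<ge> 0" "\<forall>i\<ge>1. \<kappa> z i = c * z i" using ray[OF z] by auto
    \<comment> \<open>If the segment vanished with \<open>z i \<noteq> 0\<close>, then
      \<open>u = 0\<close> and \<open>c = 0\<close>, so \<kappa> would send \<open>z\<close> to a
      pole, whose coordinate 0 is nonzero.\<close>
    have z0: "z i = 0" if "i \<in> {1..d}" for i
    proof (rule ccontr)
      assume "z i \<noteq> 0"
      have "((1 - u) * c + u) * z i = 0" using l0[of i] c(2) that by (auto simp: l_def algebra_simps)
      then have "(1 - u) * c + u = 0" using \<open>z i \<noteq> 0\<close> by simp
      moreover have "0 \<le> (1 - u) * c" using u c by simp
      ultimately have "u = 0" "(1 - u) * c = 0" using u by linarith+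
      then have "c = 0" by simp
      then have "\<forall>i\<in>{1..d}. \<kappa> z i = 0" using c(2) by auto
      then have "(\<Sum>i\<in>{1..d}. (\<kappa> z i)\<^sup>2) = 0" by (intro sum.neutral) auto
      then have "(\<kappa> z 0)\<^sup>2 = 1" using sphere_set_sum[OF \<kappa>[OF z]] by simp
      then show False using l0[of 0] \<open>u = 0\<close> by (simp add: l_def)
    qed
    then have "(\<Sum>i\<in>{1..d}. (z i)\<^sup>2) = 0" by (intro sum.neutral) auto
    then have "(z 0)\<^sup>2 = 1" using sphere_set_sum[OF z] by simp
    then consider "z 0 = 1" | "z 0 = -1" by (auto simp: power2_eq_1_iff)
    \<comment> \<open>Now \<open>z\<close> is a pole, and \<kappa> fixes both poles, so the segment
      is constant.\<close>
    then have "\<kappa> z = z"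
    proof cases
      case 1
      then have "z = sphere_base" using sphere_base_iff[OF z] by simp
      then show ?thesis using base by simp
    next
      case 2
      then show ?thesis by (rule pole[OF z])
    qed
    then have "l u z 0 = z 0" by (simp add: l_def algebra_simps)
    then show False using l0[of 0] \<open>(z 0)\<^sup>2 = 1\<close> by simp
  qed
  have hS: "h u z \<in> ?S" if "0 \<le> u" "u \<le> 1" "z \<in> ?S" for u z
  proof -
    have "(\<Sum>i\<le>d. (h u z i)\<^sup>2) = n u z / n u z"
      using n_pos[OF that(3,1,2)] by (simp add: h_def power_divide sum_divide_distrib[symmetric] n_def)
    then have "(\<Sum>i\<le>d. (h u z i)\<^sup>2) = 1" using n_pos[OF that(3,1,2)] by simp
    moreover have "h u z i = 0" if "i > d" for i
      using that \<open>z \<in> ?S\<close> \<kappa>[OF \<open>z \<in> ?S\<close>] by (simp add: h_def l_def sphere_set_def)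
    ultimately show ?thesis by (simp add: sphere_set_def)
  qed
  have norm_id: "h u z = y" if "l u z = y" "y \<in> ?S" for u z y
    using that by (simp add: h_def n_def sphere_set_def fun_eq_iff)
  have "continuous_on ({0..1} \<times> ?S) (\<lambda>s. h (fst s) (snd s))"
  proof (rule continuous_on_coordinatewise_then_product)
    fix i
    have c\<kappa>: "continuous_on ({0..1} \<times> ?S) (\<lambda>s. \<kappa> (snd s) i)" for i
      by (rule continuous_on_compose2[OF continuous_on_product_then_coordinatewise[OF cont]])
        (auto intro: continuous_on_snd continuous_on_id)
    have cl: "continuous_on ({0..1} \<times> ?S) (\<lambda>s. l (fst s) (snd s) i)" for i
      unfolding l_def by (intro continuous_on_add continuous_on_mult continuous_on_diff continuous_on_const
          continuous_on_fst continuous_on_id c\<kappa> continuous_on_snd_apply)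
    have "\<forall>s\<in>{0..1} \<times> ?S. sqrt (n (fst s) (snd s)) \<noteq> 0"
    proof
      fix s :: "real \<times> (nat \<Rightarrow> real)" assume "s \<in> {0..1} \<times> ?S"
      then have "n (fst s) (snd s) > 0" using n_pos by (auto simp: mem_Times_iff)
      then show "sqrt (n (fst s) (snd s)) \<noteq> 0" by simp
    qed
    moreover have "continuous_on ({0..1} \<times> ?S) (\<lambda>s. sqrt (n (fst s) (snd s)))"
      unfolding n_def by (intro continuous_on_real_sqrt continuous_on_sum continuous_on_power cl)
    ultimately show "continuous_on ({0..1} \<times> ?S) (\<lambda>s. h (fst s) (snd s) i)"
      unfolding h_def by (intro continuous_on_divide cl)
  qed
  moreover have "h 0 z = \<kappa> z \<and> h 1 z = z" if "z \<in> ?S" for z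
    using that \<kappa>[OF that] by (intro conjI norm_id) (auto simp: l_def)
  moreover have "h u sphere_base = sphere_base" for u
    by (rule norm_id[OF _ sphere_base_mem[of d]]) (simp add: l_def base fun_eq_iff algebra_simps)
  ultimately show ?thesis using hS by (intro exI[of _ h]) blast
qed

section \<open>Complexes with cells attached to a contractible subcomplex\<close>

text \<open>The contraction \<open>c\<close> rests at \<open>p\<close> during the second half of the
  time. Hence the outer half of each collar goes to \<open>p\<close>, and the map from the sphere is
  constant near the base point, where the coordinates of the cell degenerate. The numbering
  \<open>\<beta> j\<close> makes vertex 0 the reference vertex of the cell.\<close>

locale attached_cells =
  fixes E :: "'a set" and K :: "'a set set" and d k :: nat and \<beta> :: "nat \<Rightarrow> nat \<Rightarrow> 'a"
    and c :: "real \<Rightarrow> ('a \<Rightarrow> real) \<Rightarrow> 'a \<Rightarrow> real" and p :: "'a \<Rightarrow> real"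
  assumes finite_E: "finite E"
    and K_sub: "\<rho> \<in> K \<Longrightarrow> \<rho> \<subseteq> E \<and> \<rho> \<noteq> {}"
    and K_down: "\<rho> \<in> K \<Longrightarrow> \<tau> \<subseteq> \<rho> \<Longrightarrow> \<tau> \<noteq> {} \<Longrightarrow> \<tau> \<in> K"
    and k_pos: "1 \<le> k"
    and inj: "j < k \<Longrightarrow> inj_on (\<beta> j) {..d}"
    and cell_in_K: "j < k \<Longrightarrow> \<beta> j ` {..d} \<in> K"
    and cell_maximal: "j < k \<Longrightarrow> \<rho> \<in> K \<Longrightarrow> \<beta> j ` {..d} \<subseteq> \<rho> \<Longrightarrow> \<rho> = \<beta> j ` {..d}"
    and cell_distinct: "i < k \<Longrightarrow> j < k \<Longrightarrow> \<beta> i ` {..d} = \<beta> j ` {..d} \<Longrightarrow> i = j"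
    and c_cont: "continuous_on ({0..1} \<times> polyhedron (K - (\<lambda>j. \<beta> j ` {..d}) ` {..<k})) (\<lambda>s. c (fst s) (snd s))"
    and c_in: "0 \<le> t \<Longrightarrow> t \<le> 1 \<Longrightarrow> x \<in> polyhedron (K - (\<lambda>j. \<beta> j ` {..d}) ` {..<k}) \<Longrightarrow>
      c t x \<in> polyhedron (K - (\<lambda>j. \<beta> j ` {..d}) ` {..<k})"
    and c_0: "x \<in> polyhedron (K - (\<lambda>j. \<beta> j ` {..d}) ` {..<k}) \<Longrightarrow> c 0 x = x"
    and c_half: "1 / 2 \<le> t \<Longrightarrow> t \<le> 1 \<Longrightarrow> x \<in> polyhedron (K - (\<lambda>j. \<beta> j ` {..d}) ` {..<k}) \<Longrightarrow> c t x = p"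
    and p_in: "p \<in> polyhedron (K - (\<lambda>j. \<beta> j ` {..d}) ` {..<k})"
begin

abbreviation "B j \<equiv> \<beta> j ` {..d}"
abbreviation "P \<equiv> polyhedron K"
abbreviation "P0 \<equiv> polyhedron (K - (\<lambda>j. \<beta> j ` {..d}) ` {..<k})"

section \<open>Depth in a cell and deviation from its barycentre\<close>

definition m :: "nat \<Rightarrow> ('a \<Rightarrow> real) \<Rightarrow> real" where
  "m j x = Min ((\<lambda>i. x (\<beta> j i)) ` {..d})"

text \<open>In the open cell the second sum vanishes and the first one measures the squared
  deviation from the barycentre. The second sum detects points with weight off the cell, so that
  \<open>m j x\<close> and \<open>n2 j x\<close> are never both zero on \<open>P\<close>.\<close>

definition n2 :: "nat \<Rightarrow> ('a \<Rightarrow> real) \<Rightarrow> real" where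
  "n2 j x = (\<Sum>i\<le>d. (x (\<beta> j i) - x (\<beta> j 0))\<^sup>2) + (\<Sum>e\<in>E - B j. (x e)\<^sup>2)"

abbreviation "\<nu> j x \<equiv> sqrt (n2 j x)"

lemma P0_P: "x \<in> P0 \<Longrightarrow> x \<in> P"
  by (auto simp: polyhedron_def)

lemma P_nonneg: "x \<in> P \<Longrightarrow> 0 \<le> x e"
  by (simp add: polyhedron_def)

lemma P_supp: "x \<in> P \<Longrightarrow> {e. x e \<noteq> 0} \<in> K"
  by (simp add: polyhedron_def)

lemma P_supp_sub: "x \<in> P \<Longrightarrow> {e. x e \<noteq> 0} \<subseteq> E"
  using K_sub[OF P_supp] by blast

lemma P_supp_ne: "x \<in> P \<Longrightarrow> {e. x e \<noteq> 0} \<noteq> {}"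
  using K_sub[OF P_supp] by blast

lemma B_sub: "j < k \<Longrightarrow> B j \<subseteq> E"
  using K_sub[OF cell_in_K] by blast

lemma m_le: "i \<le> d \<Longrightarrow> m j x \<le> x (\<beta> j i)"
  unfolding m_def by (rule Min_le) auto

lemma m_attained: "\<exists>i\<le>d. x (\<beta> j i) = m j x"
proof -
  have "m j x \<in> (\<lambda>i. x (\<beta> j i)) ` {..d}" unfolding m_def by (rule Min_in) auto
  then show ?thesis by auto
qed

lemma m_nonneg: "x \<in> P \<Longrightarrow> 0 \<le> m j x"
  using m_attained[of x j] P_nonneg[of x] by metis

lemma n2_nonneg: "0 \<le> n2 j x"
  unfolding n2_def by (intro add_nonneg_nonneg sum_nonneg) auto

lemma m_supp:
  assumes "x \<in> P" "j < k" "m j x \<noteq> 0"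
  shows "{e. x e \<noteq> 0} = B j"
proof -
  have "0 < x (\<beta> j i)" if "i \<le> d" for i
    using m_le[OF that, of j x] m_nonneg[OF assms(1), of j] assms(3) by linarith
  then have "B j \<subseteq> {e. x e \<noteq> 0}" by force
  then show ?thesis by (rule cell_maximal[OF assms(2) P_supp[OF assms(1)]])
qed

lemma m_unique:
  assumes "x \<in> P" "i < k" "j < k" "m i x \<noteq> 0" "m j x \<noteq> 0"
  shows "i = j"
proof -
  have "B i = B j" using m_supp[OF assms(1,2,4)] m_supp[OF assms(1,3,5)] by simp
  then show ?thesis by (rule cell_distinct[OF assms(2,3)])
qed

lemma P0_iff:
  assumes "x \<in> P"
  shows "x \<in> P0 \<longleftrightarrow> (\<forall>j<k. m j x = 0)"
proof
  assume x: "x \<in> P0"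
  show "\<forall>j<k. m j x = 0"
  proof (intro allI impI, rule ccontr)
    fix j assume "j < k" "m j x \<noteq> 0"
    then have "{e. x e \<noteq> 0} = B j" by (rule m_supp[OF assms])
    moreover have "{e. x e \<noteq> 0} \<in> K - (\<lambda>j. B j) ` {..<k}" using x unfolding polyhedron_def by blast
    ultimately show False using \<open>j < k\<close> by blast
  qed
next
  assume m0: "\<forall>j<k. m j x = 0"
  have "{e. x e \<noteq> 0} \<noteq> B j" if j: "j < k" for j
  proof
    assume "{e. x e \<noteq> 0} = B j"
    moreover obtain i where "i \<le> d" "x (\<beta> j i) = 0" using m_attained[of x j] m0 j by auto
    ultimately show False by blast
  qed
  then have "{e. x e \<noteq> 0} \<in> K - (\<lambda>j. B j) ` {..<k}" using P_supp[OF assms] by blast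
  then show "x \<in> P0" using assms unfolding polyhedron_def by blast
qed

lemma m_cases:
  assumes "x \<in> P"
  obtains "x \<in> P0" "\<And>j. j < k \<Longrightarrow> m j x = 0"
  | j where "j < k" "0 < m j x" "{e. x e \<noteq> 0} = B j" "\<And>i. i < k \<Longrightarrow> i \<noteq> j \<Longrightarrow> m i x = 0"
proof (cases "\<forall>j<k. m j x = 0")
  case True
  then show ?thesis using that(1) P0_iff[OF assms] by simp
next
  case False
  then obtain j where j: "j < k" "m j x \<noteq> 0" by auto
  show ?thesis
  proof (rule that(2)[OF j(1)])
    show "0 < m j x" using j(2) m_nonneg[OF assms, of j] by simp
    show "{e. x e \<noteq> 0} = B j" by (rule m_supp[OF assms j])
    show "m i x = 0" if "i < k" "i \<noteq> j" for i
      using m_unique[OF assms that(1) j(1) _ j(2)] that(2) by blast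
  qed
qed

lemma n2_zero:
  assumes "n2 j x = 0"
  shows "i \<le> d \<Longrightarrow> x (\<beta> j i) = x (\<beta> j 0)" "e \<in> E - B j \<Longrightarrow> x e = 0"
proof -
  have "0 \<le> (\<Sum>i\<le>d. (x (\<beta> j i) - x (\<beta> j 0))\<^sup>2)" "0 \<le> (\<Sum>e\<in>E - B j. (x e)\<^sup>2)"
    by (auto intro: sum_nonneg)
  with assms have "(\<Sum>i\<le>d. (x (\<beta> j i) - x (\<beta> j 0))\<^sup>2) = 0" "(\<Sum>e\<in>E - B j. (x e)\<^sup>2) = 0"
    unfolding n2_def by linarith+
  note sums = this
  have "(x (\<beta> j i) - x (\<beta> j 0))\<^sup>2 = 0" if "i \<le> d"
    by (rule sum_nonneg_0[OF _ _ sums(1)]) (use that in simp_all)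
  then show "i \<le> d \<Longrightarrow> x (\<beta> j i) = x (\<beta> j 0)" by simp
  have "(x e)\<^sup>2 = 0" if "e \<in> E - B j"
    by (rule sum_nonneg_0[OF _ _ sums(2) that]) (simp_all add: finite_E)
  then show "e \<in> E - B j \<Longrightarrow> x e = 0" by simp
qed

lemma n2_pos:
  assumes "x \<in> P" "m j x = 0"
  shows "0 < n2 j x"
proof (rule ccontr)
  assume "\<not> ?thesis"
  then have n0: "n2 j x = 0" using n2_nonneg[of j x] by simp
  obtain i where "i \<le> d" "x (\<beta> j i) = 0" using m_attained[of x j] assms(2) by auto
  then have x0: "x (\<beta> j 0) = 0" using n2_zero(1)[OF n0, of i] by simp
  have "x e = 0" if e: "e \<in> B j" for e
  proof -
    obtain i where "i \<le> d" "e = \<beta> j i" using e by auto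
    then show ?thesis using n2_zero(1)[OF n0, of i] x0 by simp
  qed
  then have "x e = 0" if "e \<in> E" for e using that n2_zero(2)[OF n0, of e] by blast
  then show False using P_supp_sub[OF assms(1)] P_supp_ne[OF assms(1)] by blast
qed

text \<open>Lowering all coordinates of a cell by the same amount keeps their differences, so after
  normalisation the point moves along its ray away from the barycentre; the cap \<open>m j x\<close>
  stops it at the boundary.\<close>

definition raw :: "real \<Rightarrow> ('a \<Rightarrow> real) \<Rightarrow> 'a \<Rightarrow> real" where
  "raw w x e = x e - (\<Sum>j<k. if e \<in> B j then min (m j x) (w * \<nu> j x) else 0)"

lemma raw_P0:
  assumes "x \<in> P0" "0 \<le> w"
  shows "raw w x = x"
proof
  fix e
  have "min (m j x) (w * \<nu> j x) = 0" if "j < k" for j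
    using that P0_iff[OF P0_P[OF assms(1)]] assms n2_nonneg[of j x] by simp
  then have "(\<Sum>j<k. if e \<in> B j then min (m j x) (w * \<nu> j x) else 0) = 0" by (intro sum.neutral) auto
  then show "raw w x e = x e" by (simp add: raw_def)
qed

lemma raw_cell:
  assumes "x \<in> P" "0 \<le> w" "j < k" "m j x \<noteq> 0"
  shows "raw w x e = (if e \<in> B j then x e - min (m j x) (w * \<nu> j x) else 0)"
proof -
  have "(if e \<in> B i then min (m i x) (w * \<nu> i x) else 0) = 0" if "i < k" "i \<noteq> j" for i
  proof -
    have "m i x = 0" using m_unique[OF assms(1) that(1) assms(3) _ assms(4)] that(2) by blast
    then show ?thesis using assms(2) n2_nonneg[of i x] by simp
  qed
  then have "(\<Sum>i<k. if e \<in> B i then min (m i x) (w * \<nu> i x) else 0) =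
      (\<Sum>i\<in>{j}. if e \<in> B i then min (m i x) (w * \<nu> i x) else 0)"
    using assms(3) by (intro sum.mono_neutral_right) auto
  moreover have "x e = 0" if "e \<notin> B j" using m_supp[OF assms(1,3,4)] that by auto
  ultimately show ?thesis by (auto simp: raw_def)
qed

lemma raw_props:
  assumes x: "x \<in> P" and w: "0 \<le> w"
  shows "0 \<le> raw w x e" "{e. raw w x e \<noteq> 0} \<subseteq> {e. x e \<noteq> 0}" "{e. raw w x e \<noteq> 0} \<noteq> {}"
proof -
  have "0 \<le> raw w x e \<and> {e. raw w x e \<noteq> 0} \<subseteq> {e. x e \<noteq> 0} \<and> {e. raw w x e \<noteq> 0} \<noteq> {}" for e
    using x
  proof (cases rule: m_cases)
    case 1
    then show ?thesis using raw_P0[OF _ w] P_nonneg[OF x] P_supp_ne[OF x] by simp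
  next
    case (2 j)
    have raw: "raw w x e = (if e \<in> B j then x e - min (m j x) (w * \<nu> j x) else 0)" for e
      using raw_cell[OF x w 2(1)] 2(2) by simp
    have "0 \<le> raw w x e" for e
    proof (cases "e \<in> B j")
      case True
      then obtain i where "i \<le> d" "e = \<beta> j i" by auto
      then show ?thesis using m_le[of i j x] True by (simp add: raw min_le_iff_disj)
    qed (simp add: raw)
    \<comment> \<open>If every coordinate dropped to zero, all would have been equal, that is
      \<open>n2 j x = 0\<close>; but then nothing was subtracted.\<close>
    moreover have "{e. raw w x e \<noteq> 0} \<noteq> {}"
    proof
      assume "{e. raw w x e \<noteq> 0} = {}"
      then have z: "x (\<beta> j i) = min (m j x) (w * \<nu> j x)" if "i \<le> d" for i
        using raw[of "\<beta> j i"] that by auto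
      have "(\<Sum>i\<le>d. (x (\<beta> j i) - x (\<beta> j 0))\<^sup>2) = 0" using z by (intro sum.neutral) auto
      moreover have "(\<Sum>e\<in>E - B j. (x e)\<^sup>2) = 0" using 2(3) by (intro sum.neutral) auto
      ultimately have "n2 j x = 0" by (simp add: n2_def)
      then have "x (\<beta> j 0) = 0" using z[of 0] 2(2) by simp
      then show False using m_le[of 0 j x] 2(2) by simp
    qed
    moreover have "{e. raw w x e \<noteq> 0} \<subseteq> B j" by (auto simp: raw)
    ultimately show ?thesis using 2(3) by simp
  qed
  then show "0 \<le> raw w x e" "{e. raw w x e \<noteq> 0} \<subseteq> {e. x e \<noteq> 0}" "{e. raw w x e \<noteq> 0} \<noteq> {}" by blast+
qed

definition push :: "real \<Rightarrow> ('a \<Rightarrow> real) \<Rightarrow> 'a \<Rightarrow> real" where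
  "push w x = normalize_on E (raw w x)"

lemma raw_sum_pos:
  assumes "x \<in> P" "0 \<le> w"
  shows "0 < (\<Sum>e\<in>E. raw w x e)"
  using raw_props[OF assms] P_supp_sub[OF assms(1)] finite_E by (intro normalize_on_support_sum_pos) blast+

lemma push_P:
  assumes "x \<in> P" "0 \<le> w"
  shows "push w x \<in> P"
  unfolding push_def
proof (rule normalize_on_polyhedron[OF finite_E])
  show "{v. raw w x v \<noteq> 0} \<in> K"
    by (rule K_down[OF P_supp[OF assms(1)] raw_props(2,3)[OF assms]])
  show "{v. raw w x v \<noteq> 0} \<subseteq> E" using raw_props(2)[OF assms] P_supp_sub[OF assms(1)] by blast
qed (rule raw_props[OF assms])+

text \<open>Inside the collar the full \<open>m j x\<close> is subtracted, so a vertex of least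
  coordinate drops out. What remains is a proper face of the cell, and it is no other cell because
  cells are maximal.\<close>

lemma push_P0:
  assumes x: "x \<in> P" and w: "0 \<le> w" and le: "\<And>j. j < k \<Longrightarrow> m j x \<le> w * \<nu> j x"
  shows "push w x \<in> P0"
  unfolding push_def
proof (rule normalize_on_polyhedron[OF finite_E])
  show "{v. raw w x v \<noteq> 0} \<subseteq> E" using raw_props(2)[OF x w] P_supp_sub[OF x] by blast
  have K: "{v. raw w x v \<noteq> 0} \<in> K"
    by (rule K_down[OF P_supp[OF x] raw_props(2,3)[OF x w]])
  have "{v. raw w x v \<noteq> 0} \<noteq> B i" if i: "i < k" for i
    using x
  proof (cases rule: m_cases)
    case 1
    have "{e. x e \<noteq> 0} \<in> K - (\<lambda>j. B j) ` {..<k}" using 1(1) unfolding polyhedron_def by blast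
    then show ?thesis using i unfolding raw_P0[OF 1(1) w] by blast
  next
    case (2 j)
    have raw: "raw w x e = (if e \<in> B j then x e - m j x else 0)" for e
      using raw_cell[OF x w 2(1)] 2(2) le[OF 2(1)] by (simp add: min_def)
    show ?thesis
    proof
      assume eq: "{v. raw w x v \<noteq> 0} = B i"
      obtain l where l: "l \<le> d" "x (\<beta> j l) = m j x" using m_attained by blast
      have "B i \<subseteq> B j" unfolding eq[symmetric] by (auto simp: raw)
      then have "B j = B i" using cell_maximal[OF i cell_in_K[OF 2(1)]] by simp
      moreover have "raw w x (\<beta> j l) = 0" using l by (simp add: raw)
      moreover have "\<beta> j l \<in> B j" using l by simp
      ultimately show False using eq by blast
    qed
  qed
  then show "{v. raw w x v \<noteq> 0} \<in> K - (\<lambda>j. B j) ` {..<k}" using K by blast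
qed (rule raw_props[OF x w])+

section \<open>The collar homotopy\<close>

definition lvl :: "real \<Rightarrow> ('a \<Rightarrow> real) \<Rightarrow> real" where
  "lvl w x = Max ((\<lambda>j. m j x - w * \<nu> j x) ` {..<k})"

text \<open>At most one summand is nonzero. It is the depth of the point in its collar: 0 on the
  boundary of the cell and \<open>w\<close> at the inner edge. It enters \<open>G\<close> only where
  \<open>lvl w x \<le> 0\<close>, and there the denominators are positive.\<close>

definition ratio :: "('a \<Rightarrow> real) \<Rightarrow> real" where
  "ratio x = (\<Sum>j<k. m j x / \<nu> j x)"

text \<open>The collar \<open>m j x \<le> w * \<nu> j x\<close> of each cell is used up for running the contraction \<open>c\<close>;
  the remaining part of the cell is stretched over the whole cell.\<close>

definition G :: "real \<Rightarrow> ('a \<Rightarrow> real) \<Rightarrow> 'a \<Rightarrow> real" where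
  "G w x = (if lvl w x \<le> 0 then c (w - ratio x) (push w x) else push w x)"

lemma k_ne: "{..<k} \<noteq> {}"
  using k_pos by (simp add: lessThan_empty_iff)

lemma lvl_le_iff: "lvl w x \<le> 0 \<longleftrightarrow> (\<forall>j<k. m j x \<le> w * \<nu> j x)"
  unfolding lvl_def using k_ne by (subst Max_le_iff) auto

lemma \<nu>_pos:
  assumes "x \<in> P" "lvl w x \<le> 0" "j < k"
  shows "0 < \<nu> j x"
proof (rule ccontr)
  assume "\<not> ?thesis"
  then have "n2 j x = 0" using n2_nonneg[of j x] by simp
  moreover have "m j x \<le> w * \<nu> j x" using assms by (simp add: lvl_le_iff)
  ultimately have "m j x = 0" using m_nonneg[OF assms(1), of j] by simp
  then show False using n2_pos[OF assms(1), of j] \<open>n2 j x = 0\<close> by simp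
qed

lemma ratio_P0: "x \<in> P0 \<Longrightarrow> ratio x = 0"
  using P0_iff[OF P0_P] by (simp add: ratio_def)

lemma ratio_cell:
  assumes "x \<in> P" "j < k" "m j x \<noteq> 0"
  shows "ratio x = m j x / \<nu> j x"
proof -
  have "m i x / \<nu> i x = 0" if "i < k" "i \<noteq> j" for i
    using m_unique[OF assms(1) that(1) assms(2) _ assms(3)] that(2) by auto
  then have "ratio x = (\<Sum>i\<in>{j}. m i x / \<nu> i x)"
    unfolding ratio_def using assms(2) by (intro sum.mono_neutral_right) auto
  then show ?thesis by simp
qed

lemma ratio_bounds:
  assumes "x \<in> P" "0 \<le> w" "lvl w x \<le> 0"
  shows "0 \<le> ratio x" "ratio x \<le> w"
proof -
  have "0 \<le> ratio x \<and> ratio x \<le> w"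
    using assms(1)
  proof (cases rule: m_cases)
    case 1
    then show ?thesis using ratio_P0 assms(2) by simp
  next
    case (2 j)
    have "m j x \<le> w * \<nu> j x" using assms(3) 2(1) by (simp add: lvl_le_iff)
    then show ?thesis
      using ratio_cell[OF assms(1) 2(1)] 2(2) \<nu>_pos[OF assms(1,3) 2(1)] by (simp add: divide_le_eq)
  qed
  then show "0 \<le> ratio x" "ratio x \<le> w" by auto
qed

text \<open>The matching condition for the two branches of \<open>G\<close>: at the inner edge the
  remaining contraction time \<open>w - ratio x\<close> is zero. A cell attaining level 0 without
  containing the point in its interior forces \<open>w = 0\<close>.\<close>

lemma ratio_boundary:
  assumes x: "x \<in> P" and w: "0 \<le> w" and lvl: "lvl w x = 0"
  shows "ratio x = w"
proof -
  have "lvl w x \<in> (\<lambda>j. m j x - w * \<nu> j x) ` {..<k}"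
    unfolding lvl_def using k_ne by (intro Max_in) auto
  then obtain j where j: "j < k" "m j x = w * \<nu> j x" using lvl by auto
  have pos: "0 < \<nu> j x" using \<nu>_pos[OF x _ j(1), of w] lvl by simp
  show ?thesis
    using x
  proof (cases rule: m_cases)
    case 1
    then show ?thesis using ratio_P0[OF 1(1)] j pos by simp
  next
    case (2 i)
    show ?thesis
    proof (cases "i = j")
      case True
      have "ratio x = m j x / \<nu> j x" using ratio_cell[OF x j(1)] 2(2) unfolding True by simp
      then show ?thesis using j(2) pos by simp
    next
      case False
      then have "m j x = 0" using 2(4)[OF j(1)] by auto
      then have "w = 0" using j pos by simp
      moreover have "m i x \<le> w * \<nu> i x" using lvl lvl_le_iff[of w x] 2(1) by simp
      ultimately show ?thesis using 2(2) by simp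
    qed
  qed
qed

lemma G_P0:
  assumes "x \<in> P" "0 \<le> w" "w \<le> 1" "lvl w x \<le> 0"
  shows "G w x \<in> P0"
proof -
  have "push w x \<in> P0" using push_P0[OF assms(1,2)] assms(4) by (simp add: lvl_le_iff)
  then show ?thesis using ratio_bounds[OF assms(1,2,4)] assms(3,4) c_in[of "w - ratio x" "push w x"] by (simp add: G_def)
qed

lemma G_P:
  assumes "x \<in> P" "0 \<le> w" "w \<le> 1"
  shows "G w x \<in> P"
proof (cases "lvl w x \<le> 0")
  case True
  then show ?thesis by (intro P0_P G_P0 assms)
next
  case False
  then show ?thesis using push_P[OF assms(1,2)] by (simp add: G_def)
qed

lemma G_0:
  assumes "x \<in> P"
  shows "G 0 x = x"
proof -
  have "raw 0 x = x"
  proof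
    fix e
    have "min (m j x) 0 = 0" for j using m_nonneg[OF assms, of j] by simp
    then show "raw 0 x e = x e" by (simp add: raw_def cong: if_cong)
  qed
  then have push: "push 0 x = x" unfolding push_def using normalize_on_id[OF finite_E assms P_supp_sub[OF assms]] by simp
  show ?thesis
  proof (cases "lvl 0 x \<le> 0")
    case True
    then have "ratio x = 0" using ratio_bounds[OF assms order.refl True] by simp
    moreover have "x \<in> P0" using push_P0[OF assms, of 0] True push by (simp add: lvl_le_iff)
    ultimately show ?thesis using True push c_0 by (simp add: G_def)
  qed (simp add: G_def push)
qed

lemma continuous_on_m: "continuous_on S (m j)"
  unfolding m_def by (intro continuous_on_Min_image) (auto simp: continuous_on_apply)

lemma continuous_on_n2: "continuous_on S (n2 j)"
  unfolding n2_def
  by (intro continuous_on_add continuous_on_sum continuous_on_power continuous_on_diff continuous_on_apply)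

lemma continuous_on_snd_m: "continuous_on S (\<lambda>s. m j (snd s))"
  by (rule continuous_on_compose2[OF continuous_on_m[of UNIV j]]) (simp_all add: continuous_on_snd continuous_on_id)

lemma continuous_on_snd_n2: "continuous_on S (\<lambda>s. n2 j (snd s))"
  by (rule continuous_on_compose2[OF continuous_on_n2[of UNIV j]]) (simp_all add: continuous_on_snd continuous_on_id)

lemma continuous_on_fst_id: "continuous_on S (\<lambda>s :: real \<times> ('a \<Rightarrow> real). fst s)"
  by (intro continuous_on_fst continuous_on_id)

lemma continuous_on_push:
  assumes "S \<subseteq> {0..1} \<times> P"
  shows "continuous_on S (\<lambda>s. push (fst s) (snd s))"
  unfolding push_def
proof (rule continuous_on_normalize)
  fix e
  have "continuous_on S (\<lambda>s. if e \<in> B j then min (m j (snd s)) (fst s * \<nu> j (snd s)) else 0)" for j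
    by (cases "e \<in> B j") (auto intro!: continuous_on_min continuous_on_mult continuous_on_real_sqrt
        continuous_on_snd_m continuous_on_snd_n2 continuous_on_fst_id)
  then show "continuous_on S (\<lambda>s. raw (fst s) (snd s) e)"
    unfolding raw_def by (intro continuous_on_diff continuous_on_snd_apply continuous_on_sum)
next
  fix s assume "s \<in> S"
  then have "snd s \<in> P" "0 \<le> fst s" using assms by auto
  then show "(\<Sum>e\<in>E. raw (fst s) (snd s) e) \<noteq> 0" using raw_sum_pos by force
qed

lemma continuous_on_G: "continuous_on ({0..1} \<times> P) (\<lambda>s. G (fst s) (snd s))"
  unfolding G_def
proof (rule continuous_on_cases_le)
  let ?S = "{s \<in> {0..1} \<times> P. lvl (fst s) (snd s) \<le> 0}"
  have S: "fst s \<in> {0..1}" "snd s \<in> P" "lvl (fst s) (snd s) \<le> 0" if "s \<in> ?S" for s using that by auto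
  have "continuous_on ?S (\<lambda>s. ratio (snd s))"
    unfolding ratio_def
  proof (intro continuous_on_sum continuous_on_divide continuous_on_real_sqrt continuous_on_snd_m continuous_on_snd_n2 ballI)
    fix j s assume "j \<in> {..<k}" "s \<in> ?S"
    then show "\<nu> j (snd s) \<noteq> 0" using \<nu>_pos[OF S(2,3)] by force
  qed
  then have "continuous_on ?S (\<lambda>s. (fst s - ratio (snd s), push (fst s) (snd s)))"
    by (intro continuous_on_Pair continuous_on_diff continuous_on_fst_id continuous_on_push) auto
  moreover have "(fst s - ratio (snd s), push (fst s) (snd s)) \<in> {0..1} \<times> P0" if "s \<in> ?S" for s
    using ratio_bounds[OF S(2)[OF that] _ S(3)[OF that]] push_P0[OF S(2)[OF that], of "fst s"] S[OF that]
    by (auto simp: lvl_le_iff)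
  then have "(\<lambda>s. (fst s - ratio (snd s), push (fst s) (snd s))) ` ?S \<subseteq> {0..1} \<times> P0" by blast
  ultimately show "continuous_on ?S (\<lambda>s. c (fst s - ratio (snd s)) (push (fst s) (snd s)))"
    using continuous_on_compose2[OF c_cont, of ?S "\<lambda>s. (fst s - ratio (snd s), push (fst s) (snd s))"] by simp
  show "continuous_on {s \<in> {0..1} \<times> P. 0 \<le> lvl (fst s) (snd s)} (\<lambda>s. push (fst s) (snd s))"
    by (rule continuous_on_push) auto
  show "continuous_on ({0..1} \<times> P) (\<lambda>s. lvl (fst s) (snd s))"
    unfolding lvl_def using k_ne
    by (intro continuous_on_Max_image continuous_on_diff continuous_on_mult continuous_on_real_sqrt
        continuous_on_snd_m continuous_on_snd_n2 continuous_on_fst_id) auto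
  fix s assume s: "s \<in> {0..1} \<times> P" "lvl (fst s) (snd s) = 0"
  then have "snd s \<in> P" "0 \<le> fst s" by auto
  then have "ratio (snd s) = fst s" using s(2) by (rule ratio_boundary)
  moreover have "push (fst s) (snd s) \<in> P0"
    using push_P0[OF \<open>snd s \<in> P\<close> \<open>0 \<le> fst s\<close>] s(2) lvl_le_iff[of "fst s" "snd s"] by simp
  ultimately show "c (fst s - ratio (snd s)) (push (fst s) (snd s)) = push (fst s) (snd s)"
    using c_0 by simp
qed

lemma homotopic_id_G: "homotopic_with_canon (\<lambda>_. True) P P id (G 1)"
  by (rule homotopic_canonI[where h = G]) (simp_all add: continuous_on_G G_P G_0)

lemma G_base:
  assumes "x \<in> P0"
  shows "G 1 x = p"
proof -
  have x: "x \<in> P" using P0_P[OF assms] .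
  have "\<forall>j<k. m j x = 0" using P0_iff[OF x] assms by simp
  then have "lvl 1 x \<le> 0" using n2_nonneg by (simp add: lvl_le_iff)
  moreover from this have "push 1 x \<in> P0" using push_P0[OF x, of 1] by (simp add: lvl_le_iff)
  ultimately show ?thesis using ratio_P0[OF assms] c_half[of 1] by (simp add: G_def)
qed

text \<open>The condition says that \<open>ratio x\<close> is at most 1/2, so the contraction runs
  for time at least 1/2 and has reached \<open>p\<close>.\<close>

lemma G_outer:
  assumes x: "x \<in> P" and j: "j < k" and le: "m j x \<noteq> 0" "2 * m j x \<le> \<nu> j x"
  shows "G 1 x = p"
proof -
  have "m i x \<le> \<nu> i x" if "i < k" for i
  proof (cases "m i x = 0")
    case False
    then have "i = j" using m_unique[OF x that j] le(1) by blast
    then show ?thesis using le(2) m_nonneg[OF x, of j] by simp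
  qed (use n2_nonneg in simp)
  then have lvl: "lvl 1 x \<le> 0" by (simp add: lvl_le_iff)
  have "ratio x \<le> 1 / 2"
    using ratio_cell[OF x j le(1)] \<nu>_pos[OF x lvl j] le(2) by (simp add: divide_le_eq)
  moreover have "push 1 x \<in> P0" using push_P0[OF x, of 1] lvl by (simp add: lvl_le_iff)
  ultimately show ?thesis
    using ratio_bounds[OF x _ lvl] c_half[of "1 - ratio x" "push 1 x"] lvl by (simp add: G_def)
qed

text \<open>Inverse stereographic projection of \<open>(x (\<beta> j i) - x (\<beta> j 0)) / m j x\<close>; the boundary of the
  cell and everything outside it goes to the base point.\<close>

definition q :: "nat \<Rightarrow> ('a \<Rightarrow> real) \<Rightarrow> nat \<Rightarrow> real" where
  "q j x i = (if i = 0 then (n2 j x - (m j x)\<^sup>2) / (n2 j x + (m j x)\<^sup>2)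
    else if i \<le> d then 2 * m j x * (x (\<beta> j i) - x (\<beta> j 0)) / (n2 j x + (m j x)\<^sup>2) else 0)"

lemma den_pos: "x \<in> P \<Longrightarrow> 0 < n2 j x + (m j x)\<^sup>2"
  using n2_pos[of x j] n2_nonneg[of j x] by (cases "m j x = 0") (auto simp: add_nonneg_pos)

lemma continuous_on_q: "continuous_on P (q j)"
proof (rule continuous_on_coordinatewise_then_product)
  fix i
  have "\<forall>x\<in>P. n2 j x + (m j x)\<^sup>2 \<noteq> 0" using den_pos[of _ j] by (intro ballI) force
  then show "continuous_on P (\<lambda>x. q j x i)"
    unfolding q_def
    by (cases "i = 0"; cases "i \<le> d")
      (auto intro!: continuous_on_divide continuous_on_add continuous_on_diff continuous_on_mult continuous_on_power
        continuous_on_m continuous_on_n2 continuous_on_apply)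
qed

lemma n2_cell:
  assumes "x \<in> P" "j < k" "m j x \<noteq> 0"
  shows "n2 j x = (\<Sum>i\<in>{1..d}. (x (\<beta> j i) - x (\<beta> j 0))\<^sup>2)"
proof -
  have "(\<Sum>e\<in>E - B j. (x e)\<^sup>2) = 0" using m_supp[OF assms] by (intro sum.neutral) auto
  moreover have "{..d} = insert 0 {1..d}" by auto
  ultimately show ?thesis by (simp add: n2_def)
qed

lemma q_sphere:
  assumes "x \<in> P" "j < k"
  shows "q j x \<in> sphere_set d"
proof -
  let ?D = "n2 j x + (m j x)\<^sup>2"
  let ?V = "\<Sum>i\<in>{1..d}. (x (\<beta> j i) - x (\<beta> j 0))\<^sup>2"
  have D: "?D > 0" by (rule den_pos[OF assms(1)])
  have "(\<Sum>i\<in>{1..d}. (q j x i)\<^sup>2) = (\<Sum>i\<in>{1..d}. (2 * m j x / ?D)\<^sup>2 * (x (\<beta> j i) - x (\<beta> j 0))\<^sup>2)"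
    by (rule sum.cong) (auto simp: q_def power_divide power_mult_distrib)
  also have "\<dots> = (2 * m j x / ?D)\<^sup>2 * ?V" by (simp add: sum_distrib_left)
  \<comment> \<open>The formula of \<open>n2_cell\<close> holds in the open cell only; where
    \<open>m j x = 0\<close>, the factor in front vanishes.\<close>
  also have "\<dots> = (2 * m j x / ?D)\<^sup>2 * n2 j x"
    using n2_cell[OF assms] by (cases "m j x = 0") auto
  finally have "(\<Sum>i\<le>d. (q j x i)\<^sup>2) = (q j x 0)\<^sup>2 + (2 * m j x / ?D)\<^sup>2 * n2 j x"
  proof -
    have "{..d} = insert 0 {1..d}" by auto
    moreover assume "(\<Sum>i\<in>{1..d}. (q j x i)\<^sup>2) = (2 * m j x / ?D)\<^sup>2 * n2 j x"
    ultimately show ?thesis by simp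
  qed
  also have "\<dots> = ((n2 j x - (m j x)\<^sup>2)\<^sup>2 + 4 * (m j x)\<^sup>2 * n2 j x) / ?D\<^sup>2"
    by (simp add: q_def power_divide power_mult_distrib add_divide_distrib)
  also have "(n2 j x - (m j x)\<^sup>2)\<^sup>2 + 4 * (m j x)\<^sup>2 * n2 j x = ?D\<^sup>2" by algebra
  finally show ?thesis using D by (simp add: sphere_set_def q_def)
qed

lemma q_base_iff:
  assumes "x \<in> P" "j < k"
  shows "q j x = sphere_base \<longleftrightarrow> m j x = 0"
proof -
  have "q j x = sphere_base \<longleftrightarrow> q j x 0 = 1" by (rule sphere_base_iff[OF q_sphere[OF assms]])
  also have "\<dots> \<longleftrightarrow> n2 j x - (m j x)\<^sup>2 = n2 j x + (m j x)\<^sup>2"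
    using den_pos[OF assms(1), of j] by (simp add: q_def divide_eq_1_iff)
  also have "\<dots> \<longleftrightarrow> m j x = 0" by auto
  finally show ?thesis .
qed

section \<open>Parametrising the open cell by the sphere without its base point\<close>

definition vec :: "(nat \<Rightarrow> real) \<Rightarrow> nat \<Rightarrow> real" where
  "vec z i = (if i = 0 then 0 else z i)"

text \<open>Inverts \<open>q j\<close> up to a scalar. With
  \<open>r = 2 * m j x / (n2 j x + (m j x)\<^sup>2)\<close>, the point \<open>z = q j x\<close>
  satisfies \<open>z i = r * (x (\<beta> j i) - x (\<beta> j 0))\<close> for
  \<open>1 \<le> i \<le> d\<close> and \<open>1 - z 0 = r * m j x\<close>. So the scaled coordinates
  have differences \<open>vec z\<close>, which is 0 at the reference vertex, and least value
  \<open>1 - z 0\<close>.\<close>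

definition cell_raw :: "nat \<Rightarrow> (nat \<Rightarrow> real) \<Rightarrow> 'a \<Rightarrow> real" where
  "cell_raw j z e = (\<Sum>i\<le>d. if \<beta> j i = e then vec z i - Min (vec z ` {..d}) + (1 - z 0) else 0)"

definition cell_pt :: "nat \<Rightarrow> (nat \<Rightarrow> real) \<Rightarrow> 'a \<Rightarrow> real" where
  "cell_pt j z = normalize_on E (cell_raw j z)"

lemma cell_raw_vertex:
  assumes "j < k" "i \<le> d"
  shows "cell_raw j z (\<beta> j i) = vec z i - Min (vec z ` {..d}) + (1 - z 0)"
proof -
  have "cell_raw j z (\<beta> j i) = (\<Sum>l\<le>d. if l = i then vec z l - Min (vec z ` {..d}) + (1 - z 0) else 0)"
    unfolding cell_raw_def using inj_on_eq_iff[OF inj[OF assms(1)]] assms(2)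
    by (intro sum.cong[OF refl]) auto
  also have "\<dots> = vec z i - Min (vec z ` {..d}) + (1 - z 0)" using assms(2) by simp
  finally show ?thesis .
qed

lemma cell_raw_off: "e \<notin> B j \<Longrightarrow> cell_raw j z e = 0"
  unfolding cell_raw_def by (intro sum.neutral) auto

lemma cell_raw_supp:
  assumes "j < k" "z 0 < 1"
  shows "0 \<le> cell_raw j z e" "{e. cell_raw j z e \<noteq> 0} = B j"
proof -
  have pos: "0 < cell_raw j z (\<beta> j i)" if "i \<le> d" for i
  proof -
    have "Min (vec z ` {..d}) \<le> vec z i" using that by (intro Min_le) auto
    then show ?thesis using assms(2) by (simp add: cell_raw_vertex[OF assms(1) that])
  qed
  show "0 \<le> cell_raw j z e"
  proof (cases "e \<in> B j")
    case True
    then obtain i where "i \<le> d" "e = \<beta> j i" by auto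
    then show ?thesis using pos[of i] by simp
  qed (simp add: cell_raw_off)
  show "{e. cell_raw j z e \<noteq> 0} = B j"
    using pos cell_raw_off[of _ j z] by force
qed

lemma cell_pt_props:
  assumes j: "j < k" and z: "z \<in> sphere_set d" "z 0 < 1"
  defines "s \<equiv> \<Sum>e\<in>E. cell_raw j z e"
  shows "cell_pt j z \<in> P" "0 < s" "m j (cell_pt j z) = (1 - z 0) / s"
    "\<And>i. i \<le> d \<Longrightarrow> cell_pt j z (\<beta> j i) - cell_pt j z (\<beta> j 0) = vec z i / s"
    "n2 j (cell_pt j z) = (1 - (z 0)\<^sup>2) / s\<^sup>2"
proof -
  note supp = cell_raw_supp[OF j, of z, OF z(2)]
  have BE: "{e. cell_raw j z e \<noteq> 0} \<subseteq> E" "{e. cell_raw j z e \<noteq> 0} \<noteq> {}"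
    using B_sub[OF j] unfolding supp(2) by auto
  show s: "0 < s" unfolding s_def using normalize_on_support_sum_pos[OF finite_E _ BE] supp(1) by blast
  show P: "cell_pt j z \<in> P"
    unfolding cell_pt_def
  proof (rule normalize_on_polyhedron[OF finite_E])
    show "{e. cell_raw j z e \<noteq> 0} \<in> K" unfolding supp(2) by (rule cell_in_K[OF j])
  qed (rule supp(1) BE)+
  have v: "cell_pt j z (\<beta> j i) = (vec z i - Min (vec z ` {..d}) + (1 - z 0)) / s" if "i \<le> d" for i
    using cell_raw_vertex[OF j that] by (simp add: cell_pt_def normalize_on_def s_def)
  show diff: "cell_pt j z (\<beta> j i) - cell_pt j z (\<beta> j 0) = vec z i / s" if "i \<le> d" for i
  proof -
    have "(a - b + c) / s - (0 - b + c) / s = a / s" for a b c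
      by (simp add: diff_divide_distrib[symmetric])
    moreover have "vec z 0 = 0" by (simp add: vec_def)
    ultimately show ?thesis unfolding v[OF that] v[OF le0] by (simp only:)
  qed
  show m: "m j (cell_pt j z) = (1 - z 0) / s"
    unfolding m_def
  proof (rule Min_eqI)
    fix y assume "y \<in> (\<lambda>i. cell_pt j z (\<beta> j i)) ` {..d}"
    then obtain i where i: "i \<le> d" "y = cell_pt j z (\<beta> j i)" by auto
    have "Min (vec z ` {..d}) \<le> vec z i" using i(1) by (intro Min_le) auto
    then show "(1 - z 0) / s \<le> y" using s unfolding i(2) v[OF i(1)] by (intro divide_right_mono) auto
  next
    have "Min (vec z ` {..d}) \<in> vec z ` {..d}" by (rule Min_in) auto
    then obtain i where "i \<in> {..d}" "Min (vec z ` {..d}) = vec z i" by (rule imageE)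
    then have "i \<le> d" "Min (vec z ` {..d}) = vec z i" by simp_all
    then have "(1 - z 0) / s = cell_pt j z (\<beta> j i)" using v[of i] by simp
    then show "(1 - z 0) / s \<in> (\<lambda>i. cell_pt j z (\<beta> j i)) ` {..d}" using \<open>i \<le> d\<close> by blast
  qed simp
  have mx: "m j (cell_pt j z) \<noteq> 0" using m s z(2) by simp
  have "n2 j (cell_pt j z) = (\<Sum>i\<in>{1..d}. (vec z i / s)\<^sup>2)"
    unfolding n2_cell[OF P j mx] by (intro sum.cong[OF refl]) (simp add: diff)
  also have "\<dots> = (\<Sum>i\<in>{1..d}. (z i)\<^sup>2) / s\<^sup>2"
    unfolding sum_divide_distrib by (rule sum.cong) (auto simp: vec_def power_divide)
  finally show "n2 j (cell_pt j z) = (1 - (z 0)\<^sup>2) / s\<^sup>2" unfolding sphere_set_sum[OF z(1)] .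
qed

text \<open>The case distinction is forced at the base point, where all coordinates of
  \<open>cell_raw\<close> vanish and normalisation fails; the constant \<open>p\<close> takes over
  before that.\<close>

definition g :: "nat \<Rightarrow> (nat \<Rightarrow> real) \<Rightarrow> 'a \<Rightarrow> real" where
  "g j z = (if z 0 \<le> 3 / 5 then G 1 (cell_pt j z) else p)"

text \<open>The bound \<open>3/5\<close> is where \<open>2 * m j x = \<nu> j x\<close>, from which on \<open>G 1\<close> is constant.\<close>

lemma G_cell_pt_cap:
  assumes j: "j < k" and z: "z \<in> sphere_set d" "3 / 5 \<le> z 0" "z 0 < 1"
  shows "G 1 (cell_pt j z) = p"
proof -
  let ?s = "\<Sum>e\<in>E. cell_raw j z e"
  note c = cell_pt_props[OF j z(1,3)]
  have "(2 * (1 - z 0))\<^sup>2 \<le> 1 - (z 0)\<^sup>2"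
  proof -
    \<comment> \<open>The product equals \<open>1 - (z 0)\<^sup>2 - (2 * (1 - z 0))\<^sup>2\<close>;
      its second factor is where the bound 3/5 comes from.\<close>
    have "0 \<le> (1 - z 0) * (5 * z 0 - 3)" using z by (intro mult_nonneg_nonneg) auto
    then show ?thesis by (simp add: algebra_simps power2_eq_square)
  qed
  then have "2 * (1 - z 0) \<le> sqrt (1 - (z 0)\<^sup>2)" by (rule real_le_rsqrt)
  then have "2 * m j (cell_pt j z) \<le> \<nu> j (cell_pt j z)"
    using c(2) by (simp add: c(3,5) real_sqrt_divide divide_right_mono)
  moreover have "m j (cell_pt j z) \<noteq> 0" using c(2,3) z(3) by simp
  ultimately show ?thesis using G_outer[OF c(1) j] by simp
qed

lemma g_P:
  assumes "j < k" "z \<in> sphere_set d"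
  shows "g j z \<in> P"
  using cell_pt_props(1)[OF assms] G_P[of "cell_pt j z" 1] P0_P[OF p_in] by (simp add: g_def)

lemma continuous_on_cell_pt:
  assumes j: "j < k"
  shows "continuous_on {z \<in> sphere_set d. z 0 \<le> 3 / 5} (cell_pt j)"
  unfolding cell_pt_def
proof (rule continuous_on_normalize)
  fix e
  let ?S = "{z \<in> sphere_set d. z 0 \<le> 3 / 5}"
  have v: "continuous_on S (\<lambda>z. vec z i)" for i S
    unfolding vec_def by (cases "i = 0") (simp_all add: continuous_on_apply)
  have "continuous_on ?S (\<lambda>z. if \<beta> j i = e then vec z i - Min (vec z ` {..d}) + (1 - z 0) else 0)" for i
    by (cases "\<beta> j i = e")
      (auto intro!: continuous_on_add continuous_on_diff continuous_on_Min_image v continuous_on_apply)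
  then show "continuous_on ?S (\<lambda>z. cell_raw j z e)"
    unfolding cell_raw_def by (rule continuous_on_sum)
next
  fix z assume "z \<in> {z \<in> sphere_set d. z 0 \<le> 3 / 5}"
  then show "(\<Sum>e\<in>E. cell_raw j z e) \<noteq> 0" using cell_pt_props(2)[OF j, of z] by simp
qed

lemma continuous_on_g:
  assumes j: "j < k"
  shows "continuous_on (sphere_set d) (g j)"
  unfolding g_def
proof (rule continuous_on_cases_le)
  let ?S = "{z \<in> sphere_set d. z 0 \<le> 3 / 5}"
  have "continuous_on ?S (\<lambda>z. (1 :: real, cell_pt j z))"
    by (intro continuous_on_Pair continuous_on_const continuous_on_cell_pt[OF j])
  moreover have "(1, cell_pt j z) \<in> {0..1::real} \<times> P" if "z \<in> ?S" for z
    using that cell_pt_props(1)[OF j, of z] by simp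
  then have "(\<lambda>z. (1, cell_pt j z)) ` ?S \<subseteq> {0..1::real} \<times> P" by blast
  ultimately show "continuous_on ?S (\<lambda>z. G 1 (cell_pt j z))"
    using continuous_on_compose2[OF continuous_on_G, of ?S "\<lambda>z. (1, cell_pt j z)"] by simp
  show "G 1 (cell_pt j z) = p" if "z \<in> sphere_set d" "z 0 = 3 / 5" for z
    using G_cell_pt_cap[OF j that(1)] that(2) by simp
qed (rule continuous_on_const continuous_on_apply)+

text \<open>Each coordinate of \<open>cell_raw j (q j x)\<close> is that of \<open>x\<close> times
  the common factor \<open>2 * m j x / (n2 j x + (m j x)\<^sup>2)\<close>, which normalisation
  removes.\<close>

lemma cell_pt_q:
  assumes x: "x \<in> P" and j: "j < k" and m: "m j x \<noteq> 0"
  shows "q j x 0 < 1" "cell_pt j (q j x) = x"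
proof -
  let ?z = "q j x" and ?D = "n2 j x + (m j x)\<^sup>2"
  have D: "0 < ?D" by (rule den_pos[OF x])
  have m_pos: "0 < m j x" using m m_nonneg[OF x, of j] by simp
  have z0: "1 - ?z 0 = 2 * m j x / ?D * m j x"
    using D by (simp add: q_def field_simps power2_eq_square)
  moreover have l: "0 < 2 * m j x / ?D" using m_pos D by simp
  ultimately show "?z 0 < 1" using mult_pos_pos[OF l m_pos] by linarith
  have vec: "vec ?z i = 2 * m j x / ?D * (x (\<beta> j i) - x (\<beta> j 0))" if "i \<le> d" for i
    using that by (simp add: vec_def q_def)
  have min: "Min (vec ?z ` {..d}) = 2 * m j x / ?D * (m j x - x (\<beta> j 0))"
  proof (rule Min_eqI)
    fix y assume "y \<in> vec ?z ` {..d}"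
    then obtain i where i: "i \<le> d" "y = vec ?z i" by auto
    show "2 * m j x / ?D * (m j x - x (\<beta> j 0)) \<le> y"
      unfolding i(2) vec[OF i(1)] using l m_le[OF i(1), of j x] by (intro mult_left_mono) auto
  next
    obtain i where i: "i \<le> d" "x (\<beta> j i) = m j x" using m_attained by blast
    then have "vec ?z i = 2 * m j x / ?D * (m j x - x (\<beta> j 0))" using vec[of i] by simp
    then show "2 * m j x / ?D * (m j x - x (\<beta> j 0)) \<in> vec ?z ` {..d}" using i(1) by (metis atMost_iff image_eqI)
  qed simp
  have "cell_raw j ?z = (\<lambda>e. 2 * m j x / ?D * x e)"
  proof
    fix e
    show "cell_raw j ?z e = 2 * m j x / ?D * x e"
    proof (cases "e \<in> B j")
      case True
      then obtain i where i: "i \<le> d" "e = \<beta> j i" by auto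
      have "r * (a - b) - r * (a' - b) + r * a' = r * a" for r a a' b :: real by (simp add: algebra_simps)
      then show ?thesis unfolding i(2) cell_raw_vertex[OF j i(1)] vec[OF i(1)] min z0 by (simp only:)
    next
      case False
      then have "x e = 0" using m_supp[OF x j m] by auto
      then show ?thesis using cell_raw_off[OF False] by simp
    qed
  qed
  then have "cell_pt j ?z = normalize_on E (\<lambda>e. 2 * m j x / ?D * x e)" by (simp only: cell_pt_def)
  also have "\<dots> = normalize_on E x" by (rule normalize_on_scale[OF less_imp_neq[OF l, THEN not_sym]])
  finally have "cell_pt j ?z = normalize_on E x" .
  then show "cell_pt j ?z = x" using normalize_on_id[OF finite_E x P_supp_sub[OF x]] by simp
qed

lemma g_q:
  assumes x: "x \<in> P" and j: "j < k" and m: "m j x \<noteq> 0"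
  shows "g j (q j x) = G 1 x"
  using cell_pt_q[OF assms] G_cell_pt_cap[OF j q_sphere[OF x j]] by (auto simp: g_def)

lemma g_cases:
  assumes j: "j < k" and z: "z \<in> sphere_set d"
  obtains "g j z \<in> P0" | "z 0 < 1" "g j z = push 1 (cell_pt j z)"
proof (cases "z 0 \<le> 3 / 5 \<and> \<not> lvl 1 (cell_pt j z) \<le> 0")
  case True
  then show ?thesis using that(2) by (simp add: g_def G_def)
next
  case False
  have "g j z \<in> P0"
  proof (cases "z 0 \<le> 3 / 5")
    case True
    then show ?thesis using False G_P0[OF cell_pt_props(1)[OF j z], of 1] by (simp add: g_def)
  qed (use p_in in \<open>simp add: g_def\<close>)
  then show ?thesis by (rule that(1))
qed

section \<open>The composites on the spheres\<close>

lemma q_g_other: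
  assumes i: "i < k" and j: "j < k" and "i \<noteq> j" and z: "z \<in> sphere_set d"
  shows "q i (g j z) = sphere_base"
proof -
  have P: "g j z \<in> P" by (rule g_P[OF j z])
  have "m i (g j z) = 0"
    using j z
  proof (cases rule: g_cases)
    case 1
    then show ?thesis using P0_iff[OF P] i by simp
  next
    case 2
    let ?x = "cell_pt j z"
    note c = cell_pt_props[OF j z 2(1)]
    show ?thesis
    proof (rule ccontr)
      assume *: "m i (g j z) \<noteq> 0"
      have "m j ?x \<noteq> 0" using c(2,3) 2(1) by simp
      then have "{e. ?x e \<noteq> 0} = B j" by (rule m_supp[OF c(1) j])
      moreover have "{e. g j z e \<noteq> 0} \<subseteq> {e. ?x e \<noteq> 0}"
        using raw_props(2)[OF c(1), of 1] unfolding 2(2) push_def normalize_on_def by auto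
      ultimately have "B i \<subseteq> B j" using m_supp[OF P i *] by simp
      then have "B j = B i" using cell_maximal[OF i cell_in_K[OF j]] by simp
      then show False using cell_distinct[OF i j] \<open>i \<noteq> j\<close> by simp
    qed
  qed
  then show ?thesis using q_base_iff[OF P i] by simp
qed

text \<open>Parametrisation, push and projection only rescale the differences of the coordinates of
  the cell. A value in \<open>P0\<close> goes to the base point, which is the case
  \<open>r = 0\<close>. This is the condition that rules out antipodes in
  \<open>sphere_map_homotopic_id\<close>.\<close>

lemma q_g_ray:
  assumes j: "j < k" and z: "z \<in> sphere_set d"
  shows "\<exists>r\<ge>0. \<forall>i\<ge>1. q j (g j z) i = r * z i"
proof -
  have P: "g j z \<in> P" by (rule g_P[OF j z])
  show ?thesis
    using j z
  proof (cases rule: g_cases)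
    case 1
    then have "q j (g j z) = sphere_base" using P0_iff[OF P] q_base_iff[OF P j] j by simp
    then show ?thesis by (intro exI[of _ 0]) (simp add: sphere_base_def)
  next
    case 2
    let ?x = "cell_pt j z" and ?y = "g j z"
    let ?s = "\<Sum>e\<in>E. cell_raw j z e" and ?t = "\<Sum>e\<in>E. raw 1 (cell_pt j z) e"
    note c = cell_pt_props[OF j z 2(1)]
    have mx: "m j ?x \<noteq> 0" using c(2,3) 2(1) by simp
    have t: "0 < ?t" by (rule raw_sum_pos[OF c(1)]) simp
    have y: "?y (\<beta> j i) - ?y (\<beta> j 0) = z i / (?s * ?t)" if "1 \<le> i" "i \<le> d" for i
    proof -
      have "?y (\<beta> j i) - ?y (\<beta> j 0) = (raw 1 ?x (\<beta> j i) - raw 1 ?x (\<beta> j 0)) / ?t"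
        by (simp add: 2(2) push_def normalize_on_def diff_divide_distrib)
      also have "raw 1 ?x (\<beta> j i) - raw 1 ?x (\<beta> j 0) = ?x (\<beta> j i) - ?x (\<beta> j 0)"
        using that(2) by (simp add: raw_cell[OF c(1) _ j mx])
      also have "\<dots> = z i / ?s" using c(4)[OF that(2)] that(1) by (simp add: vec_def)
      finally show ?thesis by simp
    qed
    let ?r = "2 * m j ?y / (n2 j ?y + (m j ?y)\<^sup>2) / (?s * ?t)"
    have "q j ?y i = ?r * z i" if "1 \<le> i" for i
    proof (cases "i \<le> d")
      case True
      then show ?thesis using that y[OF that True] by (simp add: q_def)
    next
      case False
      then show ?thesis using that z by (simp add: q_def sphere_set_def)
    qed
    moreover have "0 \<le> ?r" using m_nonneg[OF P, of j] den_pos[OF P, of j] c(2) t by simp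
    ultimately show ?thesis by blast
  qed
qed

lemma g_base: "g j sphere_base = p"
  by (simp add: g_def sphere_base_def)

lemma q_p: "j < k \<Longrightarrow> q j p = sphere_base"
  using q_base_iff[OF P0_P[OF p_in]] P0_iff[OF P0_P[OF p_in]] p_in by simp

text \<open>The pole opposite to the base point corresponds to the barycentre of the cell. There
  \<open>n2\<close> vanishes, so the push does not move it.\<close>

lemma q_g_pole:
  assumes j: "j < k" and z: "z \<in> sphere_set d" "z 0 = -1"
  shows "q j (g j z) = z"
proof -
  let ?x = "cell_pt j z"
  have z1: "z 0 < 1" using z(2) by simp
  note c = cell_pt_props[OF j z(1) z1]
  have m: "0 < m j ?x" using c(2,3) z(2) by simp
  have n: "n2 j ?x = 0" using c(5) z(2) by simp
  have "\<not> lvl 1 ?x \<le> 0" using m n j by (auto simp: lvl_le_iff)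
  then have g: "g j z = push 1 ?x" using z(2) by (simp add: g_def G_def)
  have "raw 1 ?x e = ?x e" for e
    using raw_cell[OF c(1) _ j, of 1 e] m n m_supp[OF c(1) j] by auto
  then have "push 1 ?x = normalize_on E ?x" by (simp add: push_def normalize_on_def)
  then have g: "g j z = ?x" using g normalize_on_id[OF finite_E c(1) P_supp_sub[OF c(1)]] by simp
  have "q j ?x 0 = -1" using m n by (simp add: q_def)
  then have "q j ?x i = z i" for i
    using sphere_set_pole[OF q_sphere[OF c(1) j], of i] sphere_set_pole[OF z(1), of i] z(2) by (cases "i = 0") auto
  then show ?thesis using g by auto
qed

theorem homotopy_equivalent_wedge:
  "top_of_set P homotopy_equivalent_space top_of_set (wedge_model k (sphere_set d) sphere_base)"
proof -
  have "\<forall>j\<in>{..<k}. \<exists>h. continuous_on ({0..1} \<times> sphere_set d) (\<lambda>s. h (fst s) (snd s)) \<and>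
    (\<forall>u z. 0 \<le> u \<longrightarrow> u \<le> 1 \<longrightarrow> z \<in> sphere_set d \<longrightarrow> h u z \<in> sphere_set d) \<and>
    (\<forall>z\<in>sphere_set d. h 0 z = q j (g j z) \<and> h 1 z = z) \<and>
    (\<forall>u. 0 \<le> u \<longrightarrow> u \<le> (1::real) \<longrightarrow> h u sphere_base = sphere_base)"
  proof
    fix j assume "j \<in> {..<k}"
    then have j: "j < k" by simp
    show "\<exists>h. continuous_on ({0..1} \<times> sphere_set d) (\<lambda>s. h (fst s) (snd s)) \<and>
      (\<forall>u z. 0 \<le> u \<longrightarrow> u \<le> 1 \<longrightarrow> z \<in> sphere_set d \<longrightarrow> h u z \<in> sphere_set d) \<and>
      (\<forall>z\<in>sphere_set d. h 0 z = q j (g j z) \<and> h 1 z = z) \<and>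
      (\<forall>u. 0 \<le> u \<longrightarrow> u \<le> (1::real) \<longrightarrow> h u sphere_base = sphere_base)"
    proof (rule sphere_map_homotopic_id)
      show "continuous_on (sphere_set d) (\<lambda>z. q j (g j z))"
        by (rule continuous_on_compose2[OF continuous_on_q continuous_on_g[OF j]]) (use g_P[OF j] in auto)
      show "q j (g j z) \<in> sphere_set d" if "z \<in> sphere_set d" for z
        by (rule q_sphere[OF g_P[OF j that] j])
    qed (use q_g_ray[OF j] q_g_pole[OF j] q_p[OF j] g_base in simp_all)
  qed
  then obtain h where h: "\<forall>j\<in>{..<k}. continuous_on ({0..1} \<times> sphere_set d) (\<lambda>s. h j (fst s) (snd s)) \<and>
    (\<forall>u z. 0 \<le> u \<longrightarrow> u \<le> 1 \<longrightarrow> z \<in> sphere_set d \<longrightarrow> h j u z \<in> sphere_set d) \<and>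
    (\<forall>z\<in>sphere_set d. h j 0 z = q j (g j z) \<and> h j 1 z = z) \<and>
    (\<forall>u. 0 \<le> u \<longrightarrow> u \<le> (1::real) \<longrightarrow> h j u sphere_base = sphere_base)"
    by (elim bchoice[THEN exE]) (rule that)
  show ?thesis
  proof (rule homotopy_equivalent_wedge_model[where q = q and g = g and G = "G 1" and p = p and h = h])
    show "i = j" if "i < k" "j < k" "x \<in> P" "q i x \<noteq> sphere_base" "q j x \<noteq> sphere_base" for i j x
      using that m_unique[OF that(3,1,2)] q_base_iff by simp
    show "G 1 x = p" if "x \<in> P" "\<And>j. j < k \<Longrightarrow> q j x = sphere_base" for x
      using that q_base_iff[OF that(1)] by (intro G_base) (simp add: P0_iff)
    show "G 1 x = g j (q j x)" if "x \<in> P" "j < k" "q j x \<noteq> sphere_base" for x j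
      using that q_base_iff g_q by simp
  qed (use h k_pos sphere_base_mem continuous_on_q q_sphere continuous_on_g g_P g_base q_g_other homotopic_id_G in simp_all)
qed

end

section \<open>Homotopy type of the complex of non-flats\<close>

text \<open>The removed simplices are maximal because no simplex has more than \<open>Suc d\<close>
  vertices, so they meet the rest in their boundaries only and serve as the attached cells.\<close>

lemma polyhedron_homotopy_wedge:
  fixes K :: "'a set set"
  assumes fin: "finite E" and K: "\<And>\<rho>. \<rho> \<in> K \<Longrightarrow> \<rho> \<subseteq> E \<and> \<rho> \<noteq> {}"
    and down: "\<And>\<rho> \<tau>. \<rho> \<in> K \<Longrightarrow> \<tau> \<subseteq> \<rho> \<Longrightarrow> \<tau> \<noteq> {} \<Longrightarrow> \<tau> \<in> K"
    and dim: "\<And>\<rho>. \<rho> \<in> K \<Longrightarrow> card \<rho> \<le> Suc d"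
    and H: "H \<subseteq> K" "\<And>\<rho>. \<rho> \<in> H \<Longrightarrow> card \<rho> = Suc d" "H \<noteq> {}"
    and contr: "contractible (polyhedron (K - H))" and ne: "polyhedron (K - H) \<noteq> {}"
  shows "top_of_set (polyhedron K) homotopy_equivalent_space wedge_of_spheres (card H) (int d)"
proof -
  have "K \<subseteq> Pow E" using K by auto
  then have finH: "finite H" using H(1) fin by (meson finite_Pow_iff finite_subset)
  have fin\<rho>: "finite \<rho>" if "\<rho> \<in> K" for \<rho> using K[OF that] fin finite_subset by auto
  obtain b where b: "bij_betw b {0..<card H} H" using ex_bij_betw_nat_finite[OF finH] by blast
  have bH: "b j \<in> H" if "j < card H" for j using b that by (auto simp: bij_betw_def)
  have "\<exists>f. bij_betw f {..d} (b j)" if "j < card H" for j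
  proof -
    have "finite (b j)" "card (b j) = Suc d" using bH[OF that] H(1,2) fin\<rho> by auto
    then obtain f where "bij_betw f {0..<Suc d} (b j)" using ex_bij_betw_nat_finite by metis
    moreover have "{0..<Suc d} = {..d}" by auto
    ultimately show ?thesis by auto
  qed
  then have "\<forall>j\<in>{..<card H}. \<exists>f. bij_betw f {..d} (b j)" by blast
  then obtain \<beta> where \<beta>: "\<forall>j\<in>{..<card H}. bij_betw (\<beta> j) {..d} (b j)"
    by (elim bchoice[THEN exE]) (rule that)
  have img: "\<beta> j ` {..d} = b j" if "j < card H" for j using \<beta> that by (auto simp: bij_betw_def)
  have "(\<lambda>j. \<beta> j ` {..d}) ` {..<card H} = b ` {0..<card H}"
    using img by (intro image_cong) auto
  then have K0: "K - (\<lambda>j. \<beta> j ` {..d}) ` {..<card H} = K - H"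
    using b by (simp add: bij_betw_def)
  let ?A = "polyhedron (K - H)"
  obtain p where "homotopic_with_canon (\<lambda>_. True) ?A ?A id (\<lambda>_. p)" using contr by (auto simp: contractible_def)
  then have "\<exists>h. continuous_map (prod_topology (top_of_set {0..1::real}) (top_of_set ?A)) (top_of_set ?A) h \<and>
      (\<forall>x\<in>topspace (top_of_set ?A). h (0, x) = id x) \<and> (\<forall>x\<in>topspace (top_of_set ?A). h (1, x) = p)"
    by (subst (asm) homotopic_with) auto
  then obtain h where h: "continuous_map (top_of_set ({0..1::real} \<times> ?A)) (top_of_set ?A) h"
    "\<forall>x\<in>?A. h (0, x) = x" "\<forall>x\<in>?A. h (1, x) = p"
    by auto
  have h_cont: "continuous_on ({0..1} \<times> ?A) h" and h_in: "\<And>s. s \<in> {0..1} \<times> ?A \<Longrightarrow> h s \<in> ?A"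
    using h(1) by (auto simp: continuous_map_in_subtopology)
  obtain x0 where "x0 \<in> ?A" using ne by auto
  then have p: "p \<in> ?A" using h_in[of "(1, x0)"] h(3) by simp
  \<comment> \<open>The null-homotopy is run at double speed and then rests, as the collar argument
    requires.\<close>
  define c where "c t x = h (min 1 (2 * t), x)" for t x
  interpret attached_cells E K d "card H" \<beta> c p
  proof
    show "finite E" by (rule fin)
    show "\<rho> \<subseteq> E \<and> \<rho> \<noteq> {}" if "\<rho> \<in> K" for \<rho> by (rule K[OF that])
    show "\<tau> \<in> K" if "\<rho> \<in> K" "\<tau> \<subseteq> \<rho>" "\<tau> \<noteq> {}" for \<rho> \<tau> by (rule down[OF that])
    show "1 \<le> card H" using finH H(3) by (simp add: Suc_le_eq card_gt_0_iff)
    show "inj_on (\<beta> j) {..d}" if "j < card H" for j using \<beta> that by (auto simp: bij_betw_def)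
    show "\<beta> j ` {..d} \<in> K" if "j < card H" for j using img[OF that] bH[OF that] H(1) by auto
    show "\<rho> = \<beta> j ` {..d}" if "j < card H" "\<rho> \<in> K" "\<beta> j ` {..d} \<subseteq> \<rho>" for j \<rho>
      using that(3) card_seteq[OF fin\<rho>[OF that(2)], of "b j"] H(2)[OF bH[OF that(1)]] dim[OF that(2)]
      unfolding img[OF that(1)] by simp
    show "i = j" if "i < card H" "j < card H" "\<beta> i ` {..d} = \<beta> j ` {..d}" for i j
      using that(3) unfolding img[OF that(1)] img[OF that(2)]
      using b that(1,2) by (auto simp: bij_betw_def dest: inj_onD)
    show "continuous_on ({0..1} \<times> polyhedron (K - (\<lambda>j. \<beta> j ` {..d}) ` {..<card H})) (\<lambda>s. c (fst s) (snd s))"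
      unfolding K0 c_def
      by (rule continuous_on_compose2[OF h_cont])
        (auto intro!: continuous_on_Pair continuous_on_min continuous_on_mult continuous_on_const
          continuous_on_fst continuous_on_snd continuous_on_id)
    fix t :: real and x
    assume t: "t \<le> 1" and x: "x \<in> polyhedron (K - (\<lambda>j. \<beta> j ` {..d}) ` {..<card H})"
    show "c t x = p" if "1 / 2 \<le> t"
      using that h(3) x unfolding K0 by (simp add: c_def)
    show "c t x \<in> polyhedron (K - (\<lambda>j. \<beta> j ` {..d}) ` {..<card H})" if "0 \<le> t"
      using that x h_in unfolding K0 by (simp add: c_def)
  next
    show "c 0 x = x" if "x \<in> polyhedron (K - (\<lambda>j. \<beta> j ` {..d}) ` {..<card H})" for x
      using that h(2) unfolding K0 by (simp add: c_def)
    show "p \<in> polyhedron (K - (\<lambda>j. \<beta> j ` {..d}) ` {..<card H})" using p unfolding K0 .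
  qed
  have "wedge_of_spheres (card H) (int d) homeomorphic_space
      top_of_set (wedge_model (card H) (sphere_set d) sphere_base)"
    unfolding wedge_of_spheres_def sphere_space_eq
    by (rule wedge_sum_homeomorphic_model[OF k_pos sphere_base_mem])
  then have "top_of_set (wedge_model (card H) (sphere_set d) sphere_base) homotopy_equivalent_space
      wedge_of_spheres (card H) (int d)"
    using homeomorphic_imp_homotopy_equivalent_space homotopy_equivalent_space_sym by blast
  with homotopy_equivalent_wedge show ?thesis by (rule homotopy_eqv_trans)
qed

lemma nonempty_collapsible: "collapsible K \<Longrightarrow> polyhedron K \<noteq> {}"
proof (induction rule: collapsible.induct)
  case (point v)
  have "(\<lambda>w. if w = v then 1 else 0) \<in> polyhedron {{v}}" by (auto simp: polyhedron_def)
  then show ?case by blast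
next
  case (expand K \<sigma> v)
  then show ?case by (auto simp: polyhedron_def)
qed

section \<open>Non-flats in terms of the dual matroid\<close>

context matroid
begin

text \<open>The dual rank of \<open>Y\<close> is |Y| - r(E) + r(E - Y); the equation says that
  removing \<open>c\<close> from \<open>Y\<close> lowers it by one, so \<open>c\<close> is a coloop
  of the dual restricted to \<open>Y\<close>.\<close>

definition spanned :: "'a set \<Rightarrow> 'a \<Rightarrow> bool" where
  "spanned Y c \<longleftrightarrow> Y \<subseteq> E \<and> c \<in> Y \<and> rk (insert c (E - Y)) = rk (E - Y)"

text \<open>Passing to a smaller set enlarges the complement, and closure is monotone. The
  complement of the ground set is empty, and the empty set spans no non-loop.\<close>

lemma coloops_spanned:
  assumes "loopless E indep"
  shows "coloops E spanned"
proof
  show "finite E" by (rule finite_ground)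
  show "c \<in> Y" if "spanned Y c" for Y c using that by (simp add: spanned_def)
  show "spanned Z c" if "spanned Y c" "Z \<subseteq> Y" "c \<in> Z" for Y c Z
  proof -
    have "rk (insert c (E - Z)) = rk (E - Z)"
      by (rule rk_insert_eq_mono[of c "E - Y"]) (use that in \<open>auto simp: spanned_def\<close>)
    then show ?thesis using that by (auto simp: spanned_def)
  qed
  show "\<not> spanned E c" for c
  proof
    assume "spanned E c"
    then have c: "c \<in> E" "rk {c} = rk {}" by (auto simp: spanned_def)
    then have "indep {c}" using assms by (auto simp: loopless_def)
    then have "1 \<le> rk {c}" using card_le_rk[of "{c}" "{c}"] by simp
    moreover have "rk {} = 0" using rk_attained[of "{}"] by auto
    ultimately show False using c by simp
  qed
qed

lemma spanned_coindep:
  assumes "coindep S" "c \<in> S"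
  shows "spanned S c"
proof -
  have "S \<subseteq> E" "rk (E - S) = rk E" using assms by (simp_all add: coindep_def)
  moreover have "rk (insert c (E - S)) \<le> rk E" using \<open>S \<subseteq> E\<close> assms by (intro rk_mono) auto
  moreover have "rk (E - S) \<le> rk (insert c (E - S))" by (rule rk_mono) auto
  ultimately show ?thesis using assms by (simp add: spanned_def)
qed

text \<open>A set all of whose nonempty subsets have a coloop is emptied by removing coloops one at
  a time; each step leaves the rank of the complement unchanged, so this rank was full from the
  start.\<close>

lemma free_iff_coindep:
  assumes "loopless E indep"
  shows "coloops.free E spanned S \<longleftrightarrow> coindep S \<and> S \<noteq> {}"
proof -
  interpret coloops E spanned by (rule coloops_spanned[OF assms])
  have "rk (E - S) = rk E" if "finite S" "\<forall>C\<subseteq>S. C \<noteq> {} \<longrightarrow> has_col C" for S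
    using that
  proof (induction "card S" arbitrary: S)
    case 0
    then show ?case by simp
  next
    case (Suc n)
    then have "S \<noteq> {}" by auto
    then have "has_col S" using Suc.prems(2) by simp
    then obtain c where c: "spanned S c" by (auto simp: has_col_def)
    then have "rk (E - (S - {c})) = rk E"
      using Suc by (intro Suc.hyps(1)) (auto simp: spanned_def)
    moreover have "E - (S - {c}) = insert c (E - S)" using c by (auto simp: spanned_def)
    ultimately show ?case using c by (simp add: spanned_def)
  qed
  note span = this
  show ?thesis
  proof
    assume S: "free S"
    then have "S \<noteq> {}" "S \<subseteq> E" by (auto simp: free_def has_col_def)
    moreover have "finite S" using \<open>S \<subseteq> E\<close> finite_ground by (rule finite_subset)
    ultimately show "coindep S \<and> S \<noteq> {}" using S span[of S] by (simp add: free_def coindep_def)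
  next
    assume S: "coindep S \<and> S \<noteq> {}"
    have "has_col C" if C: "C \<subseteq> S" "C \<noteq> {}" for C
    proof -
      obtain e where e: "e \<in> C" using C by auto
      have "coindep C" using S C(1) matroid.indep_subset[OF matroid_coindep] by blast
      then have "spanned C e" using e by (rule spanned_coindep)
      then show ?thesis by (auto simp: has_col_def spanned_def)
    qed
    then show "free S" using S by (simp add: free_def)
  qed
qed

lemma nonflats_eq:
  assumes "loopless E indep"
  shows "coloops.nonflats E spanned = proper_boolean E - proper_flats E indep"
proof -
  interpret coloops E spanned by (rule coloops_spanned[OF assms])
  have flat: "flat E indep X \<longleftrightarrow> \<not> has_col (E - X)" if "X \<subseteq> E" for X
  proof -
    have "E - (E - X) = X" using that by auto
    moreover have "rk X < rk (insert e X) \<longleftrightarrow> rk (insert e X) \<noteq> rk X" for e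
      using rk_mono[OF subset_insertI, of X e] by linarith
    ultimately show ?thesis using that by (auto simp: flat_def has_col_def spanned_def)
  qed
  show ?thesis
  proof (intro equalityI subsetI)
    fix X assume X: "X \<in> nonflats"
    then have "X \<in> proper_boolean E" using nonflats_proper[OF X] by (auto simp: proper_boolean_def)
    then show "X \<in> proper_boolean E - proper_flats E indep"
      using X flat[of X] by (auto simp: nonflats_def proper_flats_def)
  next
    fix X assume "X \<in> proper_boolean E - proper_flats E indep"
    then show "X \<in> nonflats"
      using flat[of X] by (auto simp: nonflats_def proper_flats_def proper_boolean_def)
  qed
qed

lemma nonflats_homotopy_coindep:
  assumes "loopless E indep"
  shows "geometric_realization
      (induced_subcomplex (order_complex (proper_boolean E)) (proper_boolean E - proper_flats E indep))
    homotopy_equivalent_space top_of_set (polyhedron {S. coindep S \<and> S \<noteq> {}})"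
proof -
  interpret coloops E spanned by (rule coloops_spanned[OF assms])
  have "induced_subcomplex (order_complex (proper_boolean E)) (proper_boolean E - proper_flats E indep)
      = order_complex nonflats"
    unfolding nonflats_eq[OF assms] induced_subcomplex_def order_complex_def by auto
  moreover have "top_of_set weights homotopy_equivalent_space top_of_set (polyhedron {S. free S})"
    by (rule weights_homotopy_free) (simp add: free_iff_coindep[OF assms] spanned_coindep)
  ultimately show ?thesis
    using homotopy_eqv_trans[OF nonflats_homotopy_weights]
    by (simp add: geometric_realization_eq free_iff_coindep[OF assms])
qed

end

theorem corollary3p8:
  fixes E :: "'a set" and indep :: "'a set \<Rightarrow> bool" and r :: nat
  assumes "matroid E indep"
    and "loopless E indep"
    and "matroid_rank indep E = r"
    and "r \<ge> 2"
  shows "\<exists>k\<ge>1. geometric_realization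
             (induced_subcomplex (order_complex (proper_boolean E))
               (proper_boolean E - proper_flats E indep))
           homotopy_equivalent_space
           wedge_of_spheres k (int (card E) - int r - 1)"
proof -
  interpret matroid E indep by (rule assms(1))
  let ?X = "geometric_realization (induced_subcomplex (order_complex (proper_boolean E))
    (proper_boolean E - proper_flats E indep))"
  let ?K = "{S. coindep S \<and> S \<noteq> {}}"
  define s where "s = card E - r"
  obtain B where "indep B" "B \<subseteq> E" "card B = r" using rk_attained[of E] assms(3) by blast
  then have "r \<le> card E" using card_mono[OF finite_ground] by blast
  note X = nonflats_homotopy_coindep[OF assms(2)]
  show ?thesis
  proof (cases "s = 0")
    case True
    \<comment> \<open>The ground set is a basis here, so the complex is empty. Every wedge of
      (-1)-spheres is empty as well, and \<open>k = 1\<close> serves as witness.\<close>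
    have "S = {}" if "coindep S" for S
    proof -
      have "card S = 0" using coindep_card_le[OF that] True assms(3) by (simp add: s_def)
      moreover have "finite S" using matroid.indep_finite[OF matroid_coindep that] .
      ultimately show ?thesis by simp
    qed
    then have "?K = {}" by blast
    then have "polyhedron ?K = {}" unfolding polyhedron_def by blast
    moreover have "top_of_set ({} :: ('a \<Rightarrow> real) set) homotopy_equivalent_space wedge_of_spheres 1 (-1)"
    proof -
      have "topspace (wedge_of_spheres 1 (-1)) = {}"
        by (simp add: wedge_of_spheres_def wedge_sum_def topspace_quotient_topology sphere_space_def)
      then have "top_of_set ({} :: ('a \<Rightarrow> real) set) homeomorphic_space wedge_of_spheres 1 (-1)"
        by (subst homeomorphic_empty_space_eq) (simp_all add: null_topspace_iff_trivial)
      then show ?thesis by (rule homeomorphic_imp_homotopy_equivalent_space)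
    qed
    ultimately have "?X homotopy_equivalent_space wedge_of_spheres 1 (-1)"
      using X homotopy_eqv_trans by metis
    moreover have "int (card E) - int r - 1 = -1" using True \<open>r \<le> card E\<close> by (simp add: s_def)
    ultimately show ?thesis by (intro exI[of _ 1]) simp
  next
    case False
    have "\<exists>H. (\<forall>B\<in>H. coindep B \<and> card B = s) \<and> collapsible ({I. coindep I \<and> I \<noteq> {}} - H) \<and>
      ((\<forall>e\<in>E. \<exists>I. coindep I \<and> \<not> coindep (insert e I)) \<longrightarrow> H \<noteq> {})"
      using coindep_card_le coindep_card_attained assms(3) False
      by (intro independence_complex_collapsible matroid_coindep) (simp_all add: s_def)
    moreover have "\<forall>e\<in>E. \<exists>I. coindep I \<and> \<not> coindep (insert e I)"
      using coindep_no_coloop[OF assms(2)] by blast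
    ultimately obtain H where H: "\<forall>B\<in>H. coindep B \<and> card B = s" "collapsible (?K - H)" "H \<noteq> {}"
      by auto
    \<comment> \<open>A basis of the dual has \<open>s\<close> elements and spans a simplex of
      dimension \<open>s - 1\<close>.\<close>
    have s: "s = Suc (s - 1)" using False by simp
    have H_sub: "H \<subseteq> ?K" using H(1) False by fastforce
    have "top_of_set (polyhedron ?K) homotopy_equivalent_space wedge_of_spheres (card H) (int (s - 1))"
    proof (rule polyhedron_homotopy_wedge[OF finite_ground])
      show "\<rho> \<subseteq> E \<and> \<rho> \<noteq> {}" if "\<rho> \<in> ?K" for \<rho> using that by (simp add: coindep_def)
      show "\<tau> \<in> ?K" if "\<rho> \<in> ?K" "\<tau> \<subseteq> \<rho>" "\<tau> \<noteq> {}" for \<rho> \<tau>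
        using that matroid.indep_subset[OF matroid_coindep] by blast
      show "card \<rho> \<le> Suc (s - 1)" if "\<rho> \<in> ?K" for \<rho>
        using that coindep_card_le[of \<rho>] assms(3) False by (simp add: s_def)
      show "card \<rho> = Suc (s - 1)" if "\<rho> \<in> H" for \<rho> using H(1) that s by simp
    qed (use H H_sub contractible_collapsible nonempty_collapsible in auto)
    then have "?X homotopy_equivalent_space wedge_of_spheres (card H) (int (s - 1))"
      by (rule homotopy_eqv_trans[OF X])
    moreover have "int (s - 1) = int (card E) - int r - 1"
      using False \<open>r \<le> card E\<close> by (simp add: s_def)
    moreover have "finite H"
      using H_sub finite_ground by (intro finite_subset[OF H_sub] finite_subset[of ?K "Pow E"]) (auto simp: coindep_def)
    then have "1 \<le> card H" using H(3) by (simp add: Suc_le_eq card_gt_0_iff)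
    ultimately show ?thesis by auto
  qed
qed

end
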